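(* Let $\rho$ be a $g$-measure on $A^{\mathbb N}$ associated to $\phi=\log g$, let $x_1^n$ be a sample path distributed according to $\rho$, and assume that the sequence of positive integers $(k(n))_{n\in\mathbb N}$ diverges and eventually satisfies $k(n)\leq\frac{1-\epsilon}{\log|A|}\log n$ for some $0<\epsilon<1$. Let $$\mathbf I(u)=\inf\{h(\nu|\rho):\nu\in\mathcal M_s,\ h(\nu)=u\}\ \text{ if } u\in[0,\log|A|],\qquad \mathbf I(u)=+\infty\ \text{ otherwise.}$$ Then $\mathbf I$ is in Legendre duality with the convex function $t\mapsto\mathbf R(t)$, $t\in\mathbb R$, defined by $$\mathbf R(t)=(t+1)\,P_{top}\big(\phi/(t+1)\big)\ \text{ for } t>-1,\qquad \mathbf R(t)=\sup\{\mathbb E_\eta[\phi]:\eta\in\mathcal E\}\ \text{ for } t\leq-1.$$ Moreover, for every $t\in\mathbb R$, $$\lim_{n\to\infty}\frac1n\log\mathbb E_\rho\left[e^{nt\hat h_{k(n)}(x_1^n)}\right]=\lim_{n\to\infty}\frac1n\log\mathbb E_\rho\left[e^{nt\frac{\hat H_{k(n)}(x_1^n)}{k(n)}}\right]=\mathbf R(t).$$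
   Context: $A$ is a finite alphabet; $a_1^k$ denotes the string $(a_1,\dots,a_k)\in A^k$; $T$ is the shift on $A^{\mathbb N}$, $Tx_1^\infty=x_2^\infty$; $[a_1^n]$ is the cylinder of infinite strings beginning with $a_1^n$. $\mathcal M_s$ is the set of shift-invariant Borel probability measures on $A^{\mathbb N}$ and $\mathcal E\subset\mathcal M_s$ the ergodic ones; $\mathbb E_\nu$ is expectation with respect to $\nu$; $h(\nu)$ is the Shannon-Kolmogorov-Sinai entropy of $\nu\in\mathcal M_s$. $g$-measures: $g:A^{\mathbb N}\to(0,1)$ is a continuous, strictly positive function with $\sum_{b_1^\infty:Tb_1^\infty=a_1^\infty}g(b_1^\infty)=1$ for all $a_1^\infty$; $\phi=\log g$. For continuous $\psi:A^{\mathbb N}\to\mathbb R$, the topological pressure is $P_{top}(\psi)=\lim_{n\to\infty}\frac1n\log\sum_{a_1^n}\exp\big(\sup\{\sum_{j=1}^n\psi(b_j^\infty):b_1^\infty\in[a_1^n]\}\big)=\sup\{\mathbb E_\eta[\psi]+h(\eta):\eta\in\mathcal M_s\}$, and an equilibrium state of $\psi$ is a measure in $\mathcal M_s$ attaining this last supremum. A $g$-measure is an equilibrium state of $\phi=\log g$ (not assumed unique); $\rho$ is one fixed such measure. Relative entropy: for $\nu\in\mathcal M_s$, $h(\nu|\rho)=\lim_{k\to\infty}\frac1k\sum_{a_1^k}\nu([a_1^k])\log\frac{\nu([a_1^k])}{\rho([a_1^k])}=-\mathbb E_\nu[\phi]-h(\nu)$. Empirical entropies: for $x_1^n\in A^n$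 let $\tilde x_1^\infty$ be its $n$-periodic extension $x_1^nx_1^nx_1^n\cdots$ and $\pi_k(a_1^k;x_1^n)=\frac1n\#\{1\le i\le n:\tilde x_i^{i+k-1}=a_1^k\}$. For a probability measure $\nu_k$ on $A^k$, with $\nu_{k-1}(a_1^{k-1})=\sum_b\nu_k(a_1^{k-1}b)$, let $H_k(\nu_k)=-\sum_{a_1^k}\nu_k(a_1^k)\log\nu_k(a_1^k)$, $H_0=0$, and $h_k(\nu_k)=H_k(\nu_k)-H_{k-1}(\nu_{k-1})$ (convention $0\log 0=0$). Then $\hat H_k(x_1^n)=H_k(\pi_k(\cdot;x_1^n))$ and $\hat h_k(x_1^n)=h_k(\pi_k(\cdot;x_1^n))$. Legendre duality of $\mathbf I$ and $\mathbf R$ means $\mathbf R(t)=\sup_{u\in\mathbb R}\{tu-\mathbf I(u)\}$ for all $t$ and $\mathbf I(u)=\sup_{t\in\mathbb R}\{tu-\mathbf R(t)\}$ for all $u$. *)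

theory Defs
  imports "HOL-Probability.Probability"
begin

text \<open>
  The alphabet is a finite type with the discrete topology, so that on \<^typ>\<open>nat \<Rightarrow> 'a\<close> the class
  topology is the product topology and \<^term>\<open>borel\<close> its Borel sigma-algebra. Sequences are indexed
  from 0: the coordinate written $x_i$ in the literature is \<open>x (i - 1)\<close>. Elements of $A^k$ are
  lists of length \<open>k\<close>. All logarithms are natural.
\<close>

definition shift_map :: "(nat \<Rightarrow> 'a) \<Rightarrow> nat \<Rightarrow> 'a" where
  "shift_map x = (\<lambda>i. x (Suc i))"

definition words :: "nat \<Rightarrow> 'a list set" where
  "words k = {w. length w = k}"

definition initial :: "nat \<Rightarrow> (nat \<Rightarrow> 'a) \<Rightarrow> 'a list" where
  "initial k x = map x [0..<k]"

definition cylinder :: "'a list \<Rightarrow> (nat \<Rightarrow> 'a) set" where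
  "cylinder a = {x. initial (length a) x = a}"

definition invariant_measures :: "(nat \<Rightarrow> 'a::{finite,discrete_topology}) measure set" where
  "invariant_measures =
     {\<nu>. prob_space \<nu> \<and> sets \<nu> = sets borel \<and> distr \<nu> borel shift_map = \<nu>}"

definition ergodic_measures :: "(nat \<Rightarrow> 'a::{finite,discrete_topology}) measure set" where
  "ergodic_measures =
     {\<nu> \<in> invariant_measures.
        \<forall>B\<in>sets borel. shift_map -` B = B \<longrightarrow> measure \<nu> B = 0 \<or> measure \<nu> B = 1}"

text \<open>
  Since \<open>ln 0 = 0\<close>, the convention $0 \log 0 = 0$ is built in. For \<open>k = 0\<close> the only word is the empty
  one, which a probability vector gives mass 1, so that $H_0 = 0$.
\<close>

definition block_entropy :: "nat \<Rightarrow> ('a::finite list \<Rightarrow> real) \<Rightarrow> real" where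
  "block_entropy k p = - (\<Sum>a\<in>words k. p a * ln (p a))"

definition marginal :: "('a::finite list \<Rightarrow> real) \<Rightarrow> 'a list \<Rightarrow> real" where
  "marginal p a = (\<Sum>b\<in>UNIV. p (a @ [b]))"

definition conditional_entropy :: "nat \<Rightarrow> ('a::finite list \<Rightarrow> real) \<Rightarrow> real" where
  "conditional_entropy k p = block_entropy k p - block_entropy (k - 1) (marginal p)"

text \<open>
  Kolmogorov-Sinai entropy of the shift in Shannon's form, as the rate $\lim H_k(\nu_k)/k$ along the
  generating partition into 1-cylinders; meaningful for shift-invariant \<open>\<nu>\<close>.
\<close>

definition ks_entropy :: "(nat \<Rightarrow> 'a::{finite,discrete_topology}) measure \<Rightarrow> real" where
  "ks_entropy \<nu> = lim (\<lambda>k. block_entropy k (\<lambda>a. measure \<nu> (cylinder a)) / real k)"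

text \<open>
  The formula below has its usual meaning if \<open>\<rho>\<close> charges every cylinder, as \<open>g\<close>-measures do
  (they have full support because \<open>g > 0\<close>).
\<close>

definition relative_entropy ::
    "(nat \<Rightarrow> 'a::{finite,discrete_topology}) measure \<Rightarrow> (nat \<Rightarrow> 'a) measure \<Rightarrow> real" where
  "relative_entropy \<nu> \<rho> =
     lim (\<lambda>k. (\<Sum>a\<in>words k. measure \<nu> (cylinder a)
                   * ln (measure \<nu> (cylinder a) / measure \<rho> (cylinder a))) / real k)"

definition top_pressure :: "((nat \<Rightarrow> 'a::{finite,discrete_topology}) \<Rightarrow> real) \<Rightarrow> real" where
  "top_pressure \<psi> =
     lim (\<lambda>n. ln (\<Sum>a\<in>words n.
                  exp (SUP b\<in>cylinder a. \<Sum>j<n. \<psi> ((shift_map ^^ j) b))) / real n)"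

definition equilibrium_state ::
    "((nat \<Rightarrow> 'a::{finite,discrete_topology}) \<Rightarrow> real) \<Rightarrow> (nat \<Rightarrow> 'a) measure \<Rightarrow> bool" where
  "equilibrium_state \<psi> \<nu> \<longleftrightarrow>
     is_arg_max (\<lambda>\<eta>. (\<integral>x. \<psi> x \<partial>\<eta>) + ks_entropy \<eta>) (\<lambda>\<eta>. \<eta> \<in> invariant_measures) \<nu>"

definition g_function :: "((nat \<Rightarrow> 'a::{finite,discrete_topology}) \<Rightarrow> real) \<Rightarrow> bool" where
  "g_function g \<longleftrightarrow>
     continuous_on UNIV g \<and> (\<forall>x. 0 < g x \<and> g x < 1) \<and>
     (\<forall>a. (\<Sum>b\<in>{b. shift_map b = a}. g b) = 1)"

definition g_measure ::
    "((nat \<Rightarrow> 'a::{finite,discrete_topology}) \<Rightarrow> real) \<Rightarrow> (nat \<Rightarrow> 'a) measure \<Rightarrow> bool" where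
  "g_measure g \<rho> \<longleftrightarrow> g_function g \<and> equilibrium_state (\<lambda>x. ln (g x)) \<rho>"

definition periodic_extension :: "'a list \<Rightarrow> nat \<Rightarrow> 'a" where
  "periodic_extension w = (\<lambda>i. w ! (i mod length w))"

definition empirical :: "'a list \<Rightarrow> nat \<Rightarrow> 'a list \<Rightarrow> real" where
  "empirical w k a =
     real (card {i. i < length w \<and> initial k ((shift_map ^^ i) (periodic_extension w)) = a})
       / real (length w)"

definition empirical_block_entropy :: "nat \<Rightarrow> 'a::finite list \<Rightarrow> real" where
  "empirical_block_entropy k w = block_entropy k (empirical w k)"

definition empirical_conditional_entropy :: "nat \<Rightarrow> 'a::finite list \<Rightarrow> real" where
  "empirical_conditional_entropy k w = conditional_entropy k (empirical w k)"

definition rate_I :: "(nat \<Rightarrow> 'a::{finite,discrete_topology}) measure \<Rightarrow> real \<Rightarrow> ereal" where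
  "rate_I \<rho> u =
     (if u \<in> {0..ln (real CARD('a))}
      then (INF \<nu>\<in>{\<nu> \<in> invariant_measures. ks_entropy \<nu> = u}. ereal (relative_entropy \<nu> \<rho>))
      else \<infinity>)"

definition pressure_R :: "((nat \<Rightarrow> 'a::{finite,discrete_topology}) \<Rightarrow> real) \<Rightarrow> real \<Rightarrow> real" where
  "pressure_R \<phi> t =
     (if t > -1 then (t + 1) * top_pressure (\<lambda>x. \<phi> x / (t + 1))
      else (SUP \<eta>\<in>ergodic_measures. \<integral>x. \<phi> x \<partial>\<eta>))"

definition legendre_dual :: "(real \<Rightarrow> ereal) \<Rightarrow> (real \<Rightarrow> real) \<Rightarrow> bool" where
  "legendre_dual I R \<longleftrightarrow>
     (\<forall>t. ereal (R t) = (SUP u. ereal (t * u) - I u)) \<and>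
     (\<forall>u. I u = (SUP t. ereal (t * u - R t)))"

end

theory Submission
  imports Defs
begin

text \<open>
Write \<open>\<phi> = ln g\<close>, \<open>S\<^sub>n\<close> for Birkhoff sums, and \<open>w'\<close> for the periodic extension of a word \<open>w\<close>.

\<^bold>\<open>Exponential moments.\<close> A \<open>g\<close>-measure has the Gibbs property up to a subexponential error:
\<open>\<rho>[w] = exp (S\<^sub>n \<phi>(w') + o(n))\<close> uniformly over words of length \<open>n\<close> (\<open>g_measure_gibbs\<close>). The moments are
therefore finite sums \<open>\<Sum>\<^sub>w exp (S\<^sub>n \<phi>(w') + n t F(w))\<close>, and two inequalities control them. The first is a Kraft inequality, \<open>\<Sum>\<^sub>w exp (- n h\<^sub>k(w)) = exp (o(n))\<close>, where \<open>h\<^sub>k(w)\<close> is the empirical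
conditional entropy (\<open>kraft_empirical\<close>); it holds as long as there are only subexponentially many
empirical distributions of \<open>k\<close>-blocks, which is what the logarithmic bound on \<open>k(n)\<close> ensures. The
second one is Gibbs' inequality, \<open>H\<^sub>k(w) / k \<le> P\<^sub>k(\<psi>) - S\<^sub>n \<psi>(w') / n\<close> for every continuous \<open>\<psi>\<close>, where
\<open>P\<^sub>k(\<psi>)\<close> is the normalised logarithm of the \<open>k\<close>-th partition sum. For \<open>t > -1\<close> choose
\<open>\<psi> = \<phi> / (t + 1)\<close>: the second inequality bounds the moment sum from one side, and the first one, by
convexity of log-sum-exp, from the other side, with the same rate \<open>(t + 1) P(\<psi>)\<close>. For \<open>t \<le> -1\<close> the
Kraft inequality leaves only the supremum of \<open>\<integral>\<phi> d\<eta>\<close> over ergodic \<open>\<eta>\<close>, and single periodic words,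
whose empirical entropy is negligible, come arbitrarily close to it.

\<^bold>\<open>Variational principle.\<close> Periodic orbit measures mixed with weights proportional to
\<open>exp (S\<^sub>n \<psi>(w'))\<close> have large block entropies, again by the Kraft inequality, so every cluster point is
an equilibrium state (\<open>variational_principle\<close>). As \<open>\<integral>\<phi> d\<nu>\<close> is nearly maximal on suitable periodic orbits, whose entropy is 0, this gives
\<open>R(t) = sup\<^sub>\<nu> ((t + 1) h(\<nu>) + \<integral>\<phi> d\<nu>)\<close> for every real \<open>t\<close>; in particular \<open>R\<close> is convex.

\<^bold>\<open>Gibbs property.\<close> The pressure of \<open>\<phi>\<close> is 0, so an equilibrium state \<open>\<rho>\<close> satisfies
\<open>h(\<rho>) = - \<integral>\<phi> d\<rho>\<close>. This is the equality case of Gibbs' inequality, and it forces the conditional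
probability of the first symbol given all the others to be \<open>g\<close>.

\<^bold>\<open>Duality.\<close> By the Gibbs property \<open>h(\<nu>|\<rho>) = - h(\<nu>) - \<integral>\<phi> d\<nu>\<close>, so the formula for \<open>R\<close> says that \<open>R\<close> is
the conjugate of \<open>I\<close>. The converse is the existence of supporting lines of the convex plane set of
all pairs \<open>(h(\<nu>), \<integral>\<phi> d\<nu>)\<close>; at the maximal entropy, where the supporting line may become vertical,
compactness of the set of invariant measures is needed.
\<close>

type_synonym 'a process = "(nat \<Rightarrow> 'a) measure"

type_synonym 'a observable = "(nat \<Rightarrow> 'a) \<Rightarrow> real"

section \<open>Words\<close>

abbreviation H :: "nat \<Rightarrow> ('a::finite list \<Rightarrow> real) \<Rightarrow> real" where
  "H \<equiv> block_entropy"

lemma words_0: "words 0 = {[]}"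
  by (auto simp: words_def)

lemma finite_words [simp]: "finite (words k :: 'a::finite list set)"
  using finite_lists_length_eq[of "UNIV :: 'a set" k] by (simp add: words_def)

lemma card_words: "card (words k :: 'a::finite list set) = CARD('a) ^ k"
  using card_lists_length_eq[of "UNIV :: 'a set" k] by (simp add: words_def)

lemma words_nonempty [simp]: "words k \<noteq> {}"
  by (auto simp: words_def intro: Ex_list_of_length)

lemma sum_words_snoc:
  "(\<Sum>a\<in>words (Suc k). f a) = (\<Sum>a\<in>words k. \<Sum>b\<in>UNIV. f (a @ [b :: 'a::finite]))"
proof -
  have "(\<Sum>a\<in>words k. \<Sum>b\<in>UNIV. f (a @ [b])) = (\<Sum>(a, b)\<in>words k \<times> UNIV. f (a @ [b]))"
    by (simp add: sum.cartesian_product)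
  also have "\<dots> = (\<Sum>a\<in>words (Suc k). f a)"
    by (rule sum.reindex_bij_witness[of _ "\<lambda>a. (butlast a, last a)" "\<lambda>(a, b). a @ [b]"])
       (auto simp: words_def length_Suc_conv_rev)
  finally show ?thesis by simp
qed

lemma sum_words_Cons:
  "(\<Sum>a\<in>words (Suc k). f a) = (\<Sum>a\<in>words k. \<Sum>b\<in>UNIV. f ((b :: 'a::finite) # a))"
proof -
  have "(\<Sum>a\<in>words k. \<Sum>b\<in>UNIV. f (b # a)) = (\<Sum>(a, b)\<in>words k \<times> UNIV. f (b # a))"
    by (simp add: sum.cartesian_product)
  also have "\<dots> = (\<Sum>a\<in>words (Suc k). f a)"
    by (rule sum.reindex_bij_witness[of _ "\<lambda>a. (tl a, hd a)" "\<lambda>(a, b). b # a"])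
       (auto simp: words_def length_Suc_conv)
  finally show ?thesis by simp
qed

section \<open>Gibbs' inequality\<close>

text \<open>
Everything below about entropies rests on \<open>ln x \<le> x - 1\<close> in this form. The convention \<open>ln 0 = 0\<close> makes
it valid when \<open>p = 0\<close>.
\<close>

lemma gibbs_pointwise:
  fixes p q :: real
  assumes "0 \<le> p" "0 \<le> q" "q = 0 \<Longrightarrow> p = 0"
  shows "p * (ln q - ln p) \<le> q - p"
proof (cases "p = 0")
  case False
  then have pq: "0 < p" "0 < q" using assms by (auto simp: less_le)
  then have "ln q - ln p = ln (q / p)" by (simp add: ln_div)
  also have "\<dots> \<le> q / p - 1" using pq by (intro ln_le_minus_one) auto
  finally have "p * (ln q - ln p) \<le> p * (q / p - 1)" using pq by (intro mult_left_mono) auto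
  also have "\<dots> = q - p" using pq by (simp add: field_simps)
  finally show ?thesis .
qed (use assms in auto)

lemma gibbs_inequality:
  fixes p q :: "'b \<Rightarrow> real"
  assumes "\<And>x. x \<in> S \<Longrightarrow> 0 \<le> p x" "\<And>x. x \<in> S \<Longrightarrow> 0 \<le> q x"
    and "\<And>x. x \<in> S \<Longrightarrow> q x = 0 \<Longrightarrow> p x = 0" and "sum q S \<le> sum p S"
  shows "(\<Sum>x\<in>S. p x * ln (q x)) \<le> (\<Sum>x\<in>S. p x * ln (p x))"
proof -
  have "(\<Sum>x\<in>S. p x * (ln (q x) - ln (p x))) \<le> (\<Sum>x\<in>S. q x - p x)"
    using assms by (intro sum_mono gibbs_pointwise) auto
  also have "\<dots> \<le> 0" using assms by (simp add: sum_subtractf)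
  finally show ?thesis by (simp add: right_diff_distrib sum_subtractf)
qed

lemma variational_log_sum_exp:
  fixes p s :: "'b \<Rightarrow> real"
  assumes "finite S" "\<And>x. x \<in> S \<Longrightarrow> 0 \<le> p x" "sum p S = 1"
  shows "(\<Sum>x\<in>S. p x * (s x - ln (p x))) \<le> ln (\<Sum>x\<in>S. exp (s x))"
proof -
  define Z where "Z = (\<Sum>x\<in>S. exp (s x))"
  have "S \<noteq> {}" using assms(3) by auto
  then have Z: "0 < Z" unfolding Z_def using assms(1) by (intro sum_pos) auto
  have "(\<Sum>x\<in>S. p x * ln (exp (s x) / Z)) \<le> (\<Sum>x\<in>S. p x * ln (p x))"
    using assms Z by (intro gibbs_inequality) (auto simp: Z_def simp flip: sum_divide_distrib)
  also have "(\<Sum>x\<in>S. p x * ln (exp (s x) / Z)) = (\<Sum>x\<in>S. p x * s x) - sum p S * ln Z"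
    using Z by (simp add: ln_div right_diff_distrib sum_subtractf sum_distrib_right)
  finally show ?thesis using assms(3) by (simp add: Z_def right_diff_distrib sum_subtractf)
qed

lemma log_sum_exp_attained:
  fixes s :: "'b \<Rightarrow> real"
  assumes "finite S" "S \<noteq> {}" and p: "p = (\<lambda>x. exp (s x) / (\<Sum>x\<in>S. exp (s x)))"
  shows "\<And>x. 0 < p x" "sum p S = 1" "(\<Sum>x\<in>S. p x * (s x - ln (p x))) = ln (\<Sum>x\<in>S. exp (s x))"
proof -
  define Z where "Z = (\<Sum>x\<in>S. exp (s x))"
  have Z: "0 < Z" unfolding Z_def using assms by (intro sum_pos) auto
  show "0 < p x" for x using Z by (simp add: p Z_def)
  show p1: "sum p S = 1" using Z by (simp add: p flip: sum_divide_distrib Z_def)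
  have "(\<Sum>x\<in>S. p x * (s x - ln (p x))) = (\<Sum>x\<in>S. p x * ln Z)"
    using Z by (intro sum.cong) (auto simp: p ln_div simp flip: Z_def)
  also have "\<dots> = ln Z" using p1 by (simp flip: sum_distrib_right)
  finally show "(\<Sum>x\<in>S. p x * (s x - ln (p x))) = ln (\<Sum>x\<in>S. exp (s x))" by (simp add: Z_def)
qed

text \<open>
Evaluated at the Gibbs distribution of the convex combination, the functional in
\<open>variational_log_sum_exp\<close> is affine in \<open>s\<close>. This is Hoelder's inequality.
\<close>

lemma log_sum_exp_convex:
  fixes a b :: "'b \<Rightarrow> real"
  assumes "finite S" "S \<noteq> {}" "0 \<le> \<alpha>" "0 \<le> \<beta>" "\<alpha> + \<beta> = 1"
  shows "ln (\<Sum>x\<in>S. exp (\<alpha> * a x + \<beta> * b x))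
      \<le> \<alpha> * ln (\<Sum>x\<in>S. exp (a x)) + \<beta> * ln (\<Sum>x\<in>S. exp (b x))"
proof -
  define s where "s x = \<alpha> * a x + \<beta> * b x" for x
  define p where "p = (\<lambda>x. exp (s x) / (\<Sum>x\<in>S. exp (s x)))"
  note p = log_sum_exp_attained[OF assms(1,2) p_def]
  have "ln (\<Sum>x\<in>S. exp (s x)) = (\<Sum>x\<in>S. p x * (s x - ln (p x)))" using p by simp
  also have "\<dots> = (\<Sum>x\<in>S. \<alpha> * (p x * (a x - ln (p x))) + \<beta> * (p x * (b x - ln (p x))))"
  proof (rule sum.cong)
    fix x
    have "ln (p x) = (\<alpha> + \<beta>) * ln (p x)" using assms by simp
    then show "p x * (s x - ln (p x)) = \<alpha> * (p x * (a x - ln (p x))) + \<beta> * (p x * (b x - ln (p x)))"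
      unfolding s_def by algebra
  qed simp
  also have "\<dots> = \<alpha> * (\<Sum>x\<in>S. p x * (a x - ln (p x))) + \<beta> * (\<Sum>x\<in>S. p x * (b x - ln (p x)))"
    by (simp add: sum.distrib sum_distrib_left)
  also have "\<dots> \<le> \<alpha> * ln (\<Sum>x\<in>S. exp (a x)) + \<beta> * ln (\<Sum>x\<in>S. exp (b x))"
    using assms p by (intro add_mono mult_left_mono variational_log_sum_exp) (auto intro: less_imp_le)
  finally show ?thesis by (simp add: s_def)
qed

section \<open>Entropies of stationary weights\<close>

text \<open>
A consistent family of block probabilities, indexed by words of all lengths; summing over the last
letter is consistency and summing over the first letter is shift invariance. Such families are the
cylinder probabilities of invariant measures, and the empirical frequencies on a cyclically
closed word are of this kind too, so that both can be treated together.
\<close>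

definition stationary :: "('a::finite list \<Rightarrow> real) \<Rightarrow> bool" where
  "stationary p \<longleftrightarrow> (\<forall>a. 0 \<le> p a) \<and> p [] = 1 \<and>
     (\<forall>a. (\<Sum>b\<in>UNIV. p (a @ [b])) = p a) \<and> (\<forall>a. (\<Sum>b\<in>UNIV. p (b # a)) = p a)"

lemma stationaryD:
  assumes "stationary p"
  shows "0 \<le> p a" "p [] = 1" "(\<Sum>b\<in>UNIV. p (a @ [b])) = p a" "(\<Sum>b\<in>UNIV. p (b # a)) = p a"
  using assms by (auto simp: stationary_def)

lemma stationary_sum_words:
  assumes "stationary p"
  shows "sum p (words k) = 1"
proof (induction k)
  case (Suc k)
  then show ?case by (simp add: sum_words_snoc stationaryD[OF assms])
qed (simp add: words_0 stationaryD[OF assms])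

lemma stationary_snoc_le: assumes "stationary p" shows "p (a @ [b]) \<le> p a"
  using member_le_sum[of b UNIV "\<lambda>b. p (a @ [b])"] by (simp add: stationaryD[OF assms])

lemma stationary_Cons_le: assumes "stationary p" shows "p (b # a) \<le> p a"
  using member_le_sum[of b UNIV "\<lambda>b. p (b # a)"] by (simp add: stationaryD[OF assms])

lemma stationary_le_1: assumes "stationary p" shows "p a \<le> 1"
  using member_le_sum[of a "words (length a)" p] stationary_sum_words[OF assms, of "length a"]
  by (simp add: stationaryD[OF assms] words_def) (use finite_words words_def in metis)

lemma block_entropy_cong:
  "(\<And>a. a \<in> words k \<Longrightarrow> p a = q a) \<Longrightarrow> H k p = H k q"
  by (simp add: block_entropy_def)

lemma block_entropy_0: "stationary p \<Longrightarrow> H 0 p = 0"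
  by (simp add: block_entropy_def words_0 stationaryD)

lemma marginal_stationary: "stationary p \<Longrightarrow> marginal p = p"
  by (simp add: marginal_def stationaryD fun_eq_iff)

lemma conditional_entropy_stationary:
  "stationary p \<Longrightarrow> conditional_entropy (Suc k) p = H (Suc k) p - H k p"
  by (simp add: conditional_entropy_def marginal_stationary)

lemma block_entropy_eq_snoc:
  assumes "stationary p"
  shows "H k p = - (\<Sum>a\<in>words (Suc k). p a * ln (p (butlast a)))"
  by (simp add: block_entropy_def sum_words_snoc stationaryD(3)[OF assms] flip: sum_distrib_right)

lemma block_entropy_eq_Cons:
  assumes "stationary p"
  shows "H k p = - (\<Sum>a\<in>words (Suc k). p a * ln (p (tl a)))"
  by (simp add: block_entropy_def sum_words_Cons stationaryD(4)[OF assms] flip: sum_distrib_right)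

lemma block_entropy_incr:
  assumes "stationary p"
  shows "H k p \<le> H (Suc k) p"
proof -
  have "(\<Sum>a\<in>words (Suc k). p a * ln (p a)) \<le> (\<Sum>a\<in>words (Suc k). p a * ln (p (butlast a)))"
  proof (rule sum_mono)
    fix a :: "'a list" assume a: "a \<in> words (Suc k)"
    then have ab: "a = butlast a @ [last a]" by (auto simp: words_def length_Suc_conv_rev)
    have "p a \<le> p (butlast a)" using stationary_snoc_le[OF assms, of "butlast a" "last a"] ab by simp
    then show "p a * ln (p a) \<le> p a * ln (p (butlast a))"
      using stationaryD(1)[OF assms, of a] by (cases "p a = 0") (auto intro!: mult_left_mono)
  qed
  then show ?thesis using block_entropy_eq_snoc[OF assms, of k] by (simp add: block_entropy_def)
qed

lemma block_entropy_nonneg: assumes "stationary p" shows "0 \<le> H k p"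
proof (induction k)
  case (Suc k)
  then show ?case using block_entropy_incr[OF assms, of k] by linarith
qed (simp add: block_entropy_0[OF assms])

lemma conditional_entropy_nonneg:
  "stationary p \<Longrightarrow> 0 \<le> conditional_entropy (Suc k) p"
  by (simp add: conditional_entropy_stationary block_entropy_incr)

lemma block_entropy_le_log_card:
  assumes "stationary p" "S \<subseteq> words k" "\<And>a. a \<in> words k \<Longrightarrow> p a \<noteq> 0 \<Longrightarrow> a \<in> S" "S \<noteq> {}"
  shows "H k p \<le> ln (card S)"
proof -
  have fin: "finite S" using assms(2) finite_words finite_subset by blast
  have sp: "(\<Sum>a\<in>S. p a * f a) = (\<Sum>a\<in>words k. p a * f a)" for f
    using assms by (intro sum.mono_neutral_left) auto
  have "(\<Sum>a\<in>S. p a * (0 - ln (p a))) \<le> ln (\<Sum>a\<in>S. exp 0)"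
    using assms fin stationary_sum_words[OF assms(1), of k] sp[of "\<lambda>_. 1"]
    by (intro variational_log_sum_exp) (auto simp: stationaryD)
  then show ?thesis using sp[of "\<lambda>a. - ln (p a)"] by (simp add: block_entropy_def sum_negf)
qed

lemma block_entropy_le:
  fixes p :: "'a::finite list \<Rightarrow> real"
  assumes "stationary p"
  shows "H k p \<le> real k * ln (real CARD('a))"
  using block_entropy_le_log_card[OF assms, of "words k" k]
  by (simp add: card_words ln_realpow)

text \<open>
Strong subadditivity: conditioning on one more letter decreases the entropy of the next letter.
Gibbs' inequality is applied against the law \<open>q\<close> under which the first and the last letter are
conditionally independent given the letters in between.
\<close>

lemma entropy_increments_decreasing:
  fixes p :: "'a::finite list \<Rightarrow> real"
  assumes "stationary p"
  shows "H (Suc (Suc k)) p - H (Suc k) p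
       \<le> H (Suc k) p - H k p"
proof -
  let ?W = "words (Suc (Suc k)) :: 'a list set"
  have pos: "0 < p (a @ [b]) \<Longrightarrow> 0 < p a" "0 < p (b # a) \<Longrightarrow> 0 < p a" for a b
    using stationary_snoc_le[OF assms, of a b] stationary_Cons_le[OF assms, of b a] by linarith+
  have nz: "p a \<noteq> 0 \<longleftrightarrow> 0 < p a" for a using stationaryD(1)[OF assms, of a] by linarith
  define q where "q c = p (butlast c) * p (tl c) / p (tl (butlast c))" for c
  have exp2: "(\<Sum>c\<in>?W. f c) = (\<Sum>a\<in>words k. \<Sum>x\<in>UNIV. \<Sum>y\<in>UNIV. f (x # a @ [y]))"
    for f :: "'a list \<Rightarrow> real"
    by (simp add: sum_words_snoc[of _ "Suc k"] sum_words_Cons[of _ k])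
  have "sum q (?W) = (\<Sum>a\<in>words k. p a)"
    unfolding exp2
  proof (rule sum.cong)
    fix a :: "'a list"
    have "(\<Sum>x\<in>UNIV. \<Sum>y\<in>UNIV. q (x # a @ [y])) = (\<Sum>x\<in>UNIV. \<Sum>y\<in>UNIV. p (x # a) * p (a @ [y])) / p a"
      by (simp add: q_def sum_divide_distrib butlast_append)
    also have "(\<Sum>x\<in>UNIV. \<Sum>y\<in>UNIV. p (x # a) * p (a @ [y])) = p a * p a"
      by (simp add: sum_product[symmetric] stationaryD[OF assms])
    finally show "(\<Sum>x\<in>UNIV. \<Sum>y\<in>UNIV. q (x # a @ [y])) = p a" by simp
  qed simp
  also have "\<dots> = sum p (?W)" by (simp add: stationary_sum_words[OF assms])
  finally have sq: "sum q (?W) = sum p (?W)" .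
  have key: "p c * ln (q c) = p c * ln (p (butlast c)) + p c * ln (p (tl c)) - p c * ln (p (tl (butlast c)))
      \<and> (q c = 0 \<longrightarrow> p c = 0)"
    if c: "c \<in> ?W" for c
  proof (cases "p c = 0")
    case False
    obtain x a y where xy: "c = x # a @ [y]"
      using c by (cases c; cases "tl c" rule: rev_cases) (auto simp: words_def)
    have 1: "0 < p ((x # a) @ [y])" "0 < p (x # (a @ [y]))" using False nz xy by auto
    then have "0 < p (x # a)" "0 < p (a @ [y])" "0 < p a" using pos by blast+
    then show ?thesis by (simp add: xy q_def ln_div ln_mult butlast_append algebra_simps)
  qed auto
  have "(\<Sum>c\<in>?W. p c * ln (q c)) \<le> (\<Sum>c\<in>?W. p c * ln (p c))"
    using sq key stationaryD(1)[OF assms] by (intro gibbs_inequality) (auto simp: q_def)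
  moreover have "(\<Sum>c\<in>?W. p c * ln (q c)) =
     (\<Sum>c\<in>?W. p c * ln (p (butlast c)) + p c * ln (p (tl c)) - p c * ln (p (tl (butlast c))))"
    using key by (intro sum.cong) auto
  moreover have "(\<Sum>c\<in>?W. p c * ln (p (tl (butlast c)))) = - H k p"
    unfolding sum_words_snoc[of _ "Suc k"]
    by (simp add: stationaryD(3)[OF assms] block_entropy_eq_Cons[OF assms] flip: sum_distrib_right)
  ultimately show ?thesis
    using block_entropy_eq_snoc[OF assms, of "Suc k"] block_entropy_eq_Cons[OF assms, of "Suc k"]
    by (simp add: sum_subtractf sum.distrib block_entropy_def[of "Suc (Suc k)"])
qed

section \<open>Entropy rates\<close>

lemma Cesaro_mean:
  fixes u :: "nat \<Rightarrow> real"
  assumes "u \<longlonglongrightarrow> l"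
  shows "(\<lambda>n. (\<Sum>j<n. u j) / real n) \<longlonglongrightarrow> l"
proof (rule LIMSEQ_I)
  fix e :: real assume e: "0 < e"
  obtain N where N: "\<And>j. j \<ge> N \<Longrightarrow> \<bar>u j - l\<bar> < e / 2"
    using LIMSEQ_D[OF assms, of "e/2"] e by auto
  define B where "B = (\<Sum>j<N. \<bar>u j - l\<bar>)"
  have B0: "0 \<le> B" unfolding B_def by (intro sum_nonneg) auto
  obtain M where M: "real M > 2 * B / e" using reals_Archimedean2 by blast
  show "\<exists>no. \<forall>n\<ge>no. norm ((\<Sum>j<n. u j) / real n - l) < e"
  proof (intro exI[of _ "Suc (max N M)"] allI impI)
    fix n assume n: "Suc (max N M) \<le> n"
    then have n0: "0 < real n" by auto
    have "\<bar>(\<Sum>j<n. u j) - real n * l\<bar> = \<bar>\<Sum>j<n. u j - l\<bar>" by (simp add: sum_subtractf)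
    also have "\<dots> \<le> (\<Sum>j<n. \<bar>u j - l\<bar>)" by (rule sum_abs)
    also have "\<dots> = B + (\<Sum>j\<in>{N..<n}. \<bar>u j - l\<bar>)"
      using n unfolding B_def by (simp add: sum.atLeastLessThan_concat lessThan_atLeast0)
    also have "(\<Sum>j\<in>{N..<n}. \<bar>u j - l\<bar>) \<le> (\<Sum>j\<in>{N..<n}. e / 2)"
      using N by (intro sum_mono) (auto intro: less_imp_le)
    also have "\<dots> \<le> real n * (e / 2)" using e n by (simp add: mult_right_mono)
    also have "B < real n * (e / 2)"
    proof -
      have "2 * B / e < real n" using M n by linarith
      then show ?thesis using e by (simp add: field_simps)
    qed
    finally have "\<bar>(\<Sum>j<n. u j) - real n * l\<bar> < real n * e" by (simp add: mult.commute)
    moreover have "(\<Sum>j<n. u j) / real n - l = ((\<Sum>j<n. u j) - real n * l) / real n"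
      using n0 by (simp add: field_simps)
    ultimately show "norm ((\<Sum>j<n. u j) / real n - l) < e"
      using n0 by (simp add: abs_divide divide_less_eq mult.commute[of e])
  qed
qed

definition entropy_rate :: "('a::finite list \<Rightarrow> real) \<Rightarrow> real" where
  "entropy_rate p = lim (\<lambda>k. H k p / real k)"

lemma entropy_increment_antimono:
  assumes "stationary p" "i \<le> j"
  shows "H (Suc j) p - H j p \<le> H (Suc i) p - H i p"
  using assms(2)
proof (induction j rule: dec_induct)
  case (step n)
  then show ?case using entropy_increments_decreasing[OF assms(1), of n] by linarith
qed simp

text \<open>
The conditional entropy is the last, hence the smallest, of the \<open>k\<close> increments whose mean is
\<open>H\<^sub>k / k\<close>.
\<close>

lemma conditional_entropy_le:
  assumes "stationary p" "1 \<le> k"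
  shows "conditional_entropy k p \<le> H k p / real k"
proof -
  obtain m where k: "k = Suc m" using assms(2) by (cases k) auto
  have "real k * (H (Suc m) p - H m p)
      = (\<Sum>j<k. H (Suc m) p - H m p)" by simp
  also have "\<dots> \<le> (\<Sum>j<k. H (Suc j) p - H j p)"
    using k by (intro sum_mono entropy_increment_antimono[OF assms(1)]) auto
  also have "\<dots> = H k p"
    using sum_lessThan_telescope[of "\<lambda>j. H j p" k] by (simp add: block_entropy_0[OF assms(1)])
  finally show ?thesis using k
    by (simp add: conditional_entropy_stationary[OF assms(1)] field_simps)
qed

lemma entropy_increments_tendsto:
  assumes "stationary p"
  shows "(\<lambda>k. H (Suc k) p - H k p) \<longlonglongrightarrow> entropy_rate p" (is "?d \<longlonglongrightarrow> _")
    and "(\<lambda>k. H k p / real k) \<longlonglongrightarrow> entropy_rate p"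
proof -
  have "decseq ?d" using entropy_increment_antimono[OF assms] by (auto simp: decseq_def)
  moreover have "\<And>k. 0 \<le> ?d k" using block_entropy_incr[OF assms] by simp
  ultimately obtain l where l: "?d \<longlonglongrightarrow> l"
    using decseq_convergent[of ?d 0] by blast
  have "(\<lambda>n. (\<Sum>j<n. ?d j) / real n) \<longlonglongrightarrow> l" by (rule Cesaro_mean[OF l])
  moreover have "(\<Sum>j<n. ?d j) = H n p" for n
    using sum_lessThan_telescope[of "\<lambda>j. H j p" n] by (simp add: block_entropy_0[OF assms])
  ultimately have *: "(\<lambda>k. H k p / real k) \<longlonglongrightarrow> l" by simp
  then have "entropy_rate p = l" unfolding entropy_rate_def by (rule limI)
  then show "?d \<longlonglongrightarrow> entropy_rate p" "(\<lambda>k. H k p / real k) \<longlonglongrightarrow> entropy_rate p"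
    using l * by auto
qed

lemma entropy_rate_le:
  assumes "stationary p" "1 \<le> k"
  shows "entropy_rate p \<le> H k p / real k"
proof -
  obtain m where k: "k = Suc m" using assms(2) by (cases k) auto
  have "entropy_rate p \<le> H (Suc m) p - H m p"
    using entropy_increment_antimono[OF assms(1)]
    by (intro LIMSEQ_le_const2[OF entropy_increments_tendsto(1)[OF assms(1)]] exI[of _ m]) auto
  also have "\<dots> \<le> H k p / real k"
    using conditional_entropy_le[OF assms] k by (simp add: conditional_entropy_stationary[OF assms(1)])
  finally show ?thesis .
qed

lemma entropy_rate_bounds:
  fixes p :: "'a::finite list \<Rightarrow> real"
  assumes "stationary p"
  shows "0 \<le> entropy_rate p" "entropy_rate p \<le> ln (real CARD('a))"
proof -
  show "0 \<le> entropy_rate p"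
    using block_entropy_nonneg[OF assms]
    by (intro LIMSEQ_le_const[OF entropy_increments_tendsto(2)[OF assms]]) auto
  show "entropy_rate p \<le> ln (real CARD('a))"
    using entropy_rate_le[OF assms, of 1] block_entropy_le[OF assms, of 1] by simp
qed

lemma block_entropy_concave:
  fixes p :: "'i \<Rightarrow> 'a::finite list \<Rightarrow> real"
  assumes "finite I" "\<And>i. i \<in> I \<Longrightarrow> 0 \<le> c i" "\<And>i. i \<in> I \<Longrightarrow> stationary (p i)" "sum c I = 1"
  shows "(\<Sum>i\<in>I. c i * H k (p i)) \<le> H k (\<lambda>a. \<Sum>i\<in>I. c i * p i a)"
proof -
  define q where "q a = (\<Sum>i\<in>I. c i * p i a)" for a
  have q0: "0 \<le> q a" for a
    unfolding q_def using assms by (intro sum_nonneg mult_nonneg_nonneg) (auto simp: stationaryD)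
  have qp: "c i * p i a = 0" if "i \<in> I" "q a = 0" for i a
    using that assms sum_nonneg_eq_0_iff[of I "\<lambda>i. c i * p i a"] by (auto simp: q_def stationaryD)
  have sq: "sum q (words k) = 1"
    unfolding q_def by (subst sum.swap)
      (simp add: stationary_sum_words assms flip: sum_distrib_left cong: sum.cong)
  have "c i * H k (p i) \<le> c i * - (\<Sum>a\<in>words k. p i a * ln (q a))" if i: "i \<in> I" for i
  proof (cases "c i = 0")
    case False
    have "(\<Sum>a\<in>words k. p i a * ln (q a)) \<le> (\<Sum>a\<in>words k. p i a * ln (p i a))"
      using i q0 qp[OF i] False sq stationary_sum_words[OF assms(3)[OF i], of k] assms(3)[OF i]
      by (intro gibbs_inequality) (auto simp: stationaryD)
    then show ?thesis using assms(2)[OF i] by (intro mult_left_mono) (auto simp: block_entropy_def)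
  qed auto
  then have "(\<Sum>i\<in>I. c i * H k (p i)) \<le> (\<Sum>i\<in>I. c i * - (\<Sum>a\<in>words k. p i a * ln (q a)))"
    by (rule sum_mono)
  also have "\<dots> = - (\<Sum>i\<in>I. \<Sum>a\<in>words k. c i * p i a * ln (q a))"
    by (simp add: sum_distrib_left sum_negf mult.assoc)
  also have "\<dots> = H k q"
    by (subst sum.swap) (simp add: block_entropy_def q_def sum_distrib_right)
  finally show ?thesis by (simp add: q_def[abs_def])
qed

lemma stationary_mixture:
  assumes "finite I" "\<And>i. i \<in> I \<Longrightarrow> 0 \<le> c i" "\<And>i. i \<in> I \<Longrightarrow> stationary (p i)" "sum c I = 1"
  shows "stationary (\<lambda>a. \<Sum>i\<in>I. c i * p i a)"
  unfolding stationary_def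
proof (intro conjI allI)
  show "0 \<le> (\<Sum>i\<in>I. c i * p i a)" for a using assms by (intro sum_nonneg) (auto simp: stationaryD)
  show "(\<Sum>i\<in>I. c i * p i []) = 1" using assms by (simp add: stationaryD cong: sum.cong)
  show "(\<Sum>b\<in>UNIV. \<Sum>i\<in>I. c i * p i (a @ [b])) = (\<Sum>i\<in>I. c i * p i a)" for a
    using assms by (subst sum.swap) (simp add: stationaryD flip: sum_distrib_left cong: sum.cong)
  show "(\<Sum>b\<in>UNIV. \<Sum>i\<in>I. c i * p i (b # a)) = (\<Sum>i\<in>I. c i * p i a)" for a
    using assms by (subst sum.swap) (simp add: stationaryD flip: sum_distrib_left cong: sum.cong)
qed

lemma stationary_convex:
  assumes "stationary p" "stationary q" "0 \<le> s" "s \<le> 1"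
  shows "stationary (\<lambda>a. s * p a + (1 - s) * q a)"
  using stationary_mixture[of "UNIV :: bool set" "\<lambda>b. if b then s else 1 - s" "\<lambda>b. if b then p else q"] assms
  by (simp add: UNIV_bool add.commute)

text \<open>
Concavity gives one inequality. In the other direction the block entropy of a mixture exceeds
the mixture of the block entropies by at most the entropy of the choice of the component, which
does not grow with the block length. \<open>C\<close> is a convenient bound.
\<close>

lemma entropy_rate_affine:
  assumes "stationary p" "stationary q" "0 < s" "s < 1"
  shows "entropy_rate (\<lambda>a. s * p a + (1 - s) * q a) = s * entropy_rate p + (1 - s) * entropy_rate q"
proof -
  define r where "r a = s * p a + (1 - s) * q a" for a
  have r: "stationary r" using stationary_convex[of p q s] assms by (simp add: r_def[abs_def])
  define C where "C = - ln s - ln (1 - s)"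
  have lower: "s * H k p + (1 - s) * H k q \<le> H k r" for k
    using block_entropy_concave[of "UNIV :: bool set" "\<lambda>b. if b then s else 1 - s" "\<lambda>b. if b then p else q" k] assms
    by (simp add: UNIV_bool r_def[abs_def] add.commute)
  have superadditive: "x * ln x + y * ln y \<le> (x + y) * ln (x + y)" if "0 \<le> x" "0 \<le> y" for x y :: real
  proof -
    have "z * ln z \<le> z * ln (x + y)" if "z = x \<or> z = y" for z
      using that \<open>0 \<le> x\<close> \<open>0 \<le> y\<close> by (cases "z = 0") (auto intro!: mult_left_mono ln_mono simp: less_le)
    from this[of x] this[of y] show ?thesis by (simp add: distrib_right)
  qed
  have scale: "c * x * (ln c + ln x) = c * x * ln (c * x)" if "0 < c" "0 \<le> x" for c x :: real
    using that by (cases "x = 0") (auto simp: ln_mult)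
  have upper: "H k r \<le> s * H k p + (1 - s) * H k q + C" for k
  proof -
    have "s * p a * (ln s + ln (p a)) + (1 - s) * q a * (ln (1 - s) + ln (q a)) \<le> r a * ln (r a)" for a
      using superadditive[of "s * p a" "(1 - s) * q a"] assms stationaryD(1)[OF assms(1), of a]
        stationaryD(1)[OF assms(2), of a] by (simp add: scale r_def)
    then have "(\<Sum>a\<in>words k. s * p a * (ln s + ln (p a)) + (1 - s) * q a * (ln (1 - s) + ln (q a)))
        \<le> (\<Sum>a\<in>words k. r a * ln (r a))"
      by (rule sum_mono)
    also have "(\<Sum>a\<in>words k. s * p a * (ln s + ln (p a)) + (1 - s) * q a * (ln (1 - s) + ln (q a)))
       = s * ln s * sum p (words k) + s * (\<Sum>a\<in>words k. p a * ln (p a))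
         + (1 - s) * ln (1 - s) * sum q (words k) + (1 - s) * (\<Sum>a\<in>words k. q a * ln (q a))"
      unfolding sum_distrib_left sum.distrib[symmetric]
      by (intro sum.cong refl) (simp add: algebra_simps)
    finally have "H k r \<le> s * H k p + (1 - s) * H k q
        - s * ln s - (1 - s) * ln (1 - s)"
      by (simp add: block_entropy_def stationary_sum_words[OF assms(1)] stationary_sum_words[OF assms(2)])
    moreover have "- s * ln s \<le> - ln s" "- (1 - s) * ln (1 - s) \<le> - ln (1 - s)"
      using assms mult_nonneg_nonpos[of "1 - s" "ln s"] mult_nonneg_nonpos[of s "ln (1 - s)"]
      by (auto simp: algebra_simps)
    ultimately show ?thesis unfolding C_def by linarith
  qed
  define m where "m k = s * H k p + (1 - s) * H k q" for k
  have m: "(\<lambda>k. m k / real k) \<longlonglongrightarrow> s * entropy_rate p + (1 - s) * entropy_rate q"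
    unfolding m_def add_divide_distrib times_divide_eq_right[symmetric]
    by (intro tendsto_intros entropy_increments_tendsto assms)
  have "(\<lambda>k. m k / real k + C / real k) \<longlonglongrightarrow> s * entropy_rate p + (1 - s) * entropy_rate q + 0"
    by (intro tendsto_add m lim_const_over_n)
  then have m2: "(\<lambda>k. (m k + C) / real k) \<longlonglongrightarrow> s * entropy_rate p + (1 - s) * entropy_rate q"
    by (simp add: add_divide_distrib)
  have "(\<lambda>k. H k r / real k) \<longlonglongrightarrow> s * entropy_rate p + (1 - s) * entropy_rate q"
    using lower upper
    by (intro tendsto_sandwich[OF _ _ m m2] always_eventually allI divide_right_mono) (auto simp: m_def)
  then show ?thesis
    using entropy_increments_tendsto(2)[OF r] LIMSEQ_unique unfolding r_def by blast
qed

section \<open>Empirical weights and the Kraft inequality\<close>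

lemma funpow_shift: "(shift_map ^^ i) x = (\<lambda>j. x (i + j))"
  by (induction i) (auto simp: shift_map_def)

lemma length_initial [simp]: "length (initial k x) = k"
  by (simp add: initial_def)

lemma initial_in_words [simp]: "initial k x \<in> words k"
  by (simp add: words_def)

lemma initial_snoc: "initial (Suc k) x = initial k x @ [x k]"
  by (simp add: initial_def)

lemma initial_Cons: "initial (Suc k) x = x 0 # initial k (shift_map x)"
  by (simp add: initial_def shift_map_def map_upt_Suc del: upt_Suc)

lemma initial_0 [simp]: "initial 0 x = []"
  by (simp add: initial_def)

lemma butlast_initial: "butlast (initial (Suc k) x) = initial k x"
  by (simp add: initial_snoc)

lemma initial_periodic_extension: "initial (length w) (periodic_extension w) = w"
  by (rule nth_equalityI) (auto simp: initial_def periodic_extension_def)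

lemma periodic_shift: "(shift_map ^^ length w) (periodic_extension w) = periodic_extension w"
  by (simp add: funpow_shift periodic_extension_def)

lemma sum_Suc_periodic:
  fixes f :: "nat \<Rightarrow> 'b::ab_group_add"
  assumes "f n = f 0"
  shows "(\<Sum>i<n. f (Suc i)) = (\<Sum>i<n. f i)"
  using sum.lessThan_Suc_shift[of f n] sum.lessThan_Suc[of f n] assms by simp

definition empirical_weights :: "'a list \<Rightarrow> 'a list \<Rightarrow> real" where
  "empirical_weights w a = empirical w (length a) a"

abbreviation cyclic_orbit :: "'a list \<Rightarrow> nat \<Rightarrow> nat \<Rightarrow> 'a" where
  "cyclic_orbit w i \<equiv> (shift_map ^^ i) (periodic_extension w)"

abbreviation cyclic_H :: "nat \<Rightarrow> 'a::finite list \<Rightarrow> real" where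
  "cyclic_H k w \<equiv> H k (empirical_weights w)"

abbreviation cyclic_h :: "nat \<Rightarrow> 'a::finite list \<Rightarrow> real" where
  "cyclic_h k w \<equiv> conditional_entropy k (empirical_weights w)"

lemma empirical_eq_sum:
  "empirical w k a = (\<Sum>i<length w. of_bool (initial k (cyclic_orbit w i) = a)) / real (length w)"
proof -
  have "{i. i < length w \<and> P i} = {..<length w} \<inter> {i. P i}" for P by auto
  then show ?thesis by (simp add: empirical_def)
qed

text \<open>
The cyclic closure of the word is what makes the frequencies shift invariant exactly and not only
up to boundary terms.
\<close>

lemma stationary_empirical:
  fixes w :: "'a::finite list"
  assumes "w \<noteq> []"
  shows "stationary (empirical_weights w)"
  unfolding stationary_def empirical_weights_def
proof (intro conjI allI)
  let ?x = "\<lambda>i. cyclic_orbit w i"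
  show "0 \<le> empirical w (length a) a" for a by (simp add: empirical_def)
  show "empirical w (length []) [] = 1" using assms by (simp add: empirical_def)
  show "(\<Sum>b\<in>UNIV. empirical w (length (a @ [b])) (a @ [b])) = empirical w (length a) a" for a
  proof -
    have "(\<Sum>b\<in>UNIV. of_bool (initial (Suc (length a)) x = a @ [b]) :: real) = of_bool (initial (length a) x = a)"
      for x by (cases "initial (length a) x = a") (auto simp: initial_snoc of_bool_def)
    then show ?thesis
      by (simp add: empirical_eq_sum del: sum_of_bool_eq flip: sum_divide_distrib)
         (subst sum.swap, simp del: sum_of_bool_eq)
  qed
  show "(\<Sum>b\<in>UNIV. empirical w (length (b # a)) (b # a)) = empirical w (length a) a" for a
  proof -
    have "(\<Sum>b\<in>UNIV. of_bool (initial (Suc (length a)) x = b # a) :: real) = of_bool (initial (length a) (shift_map x) = a)"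
      for x by (cases "initial (length a) (shift_map x) = a") (auto simp: initial_Cons of_bool_def)
    then have "(\<Sum>b\<in>UNIV. empirical w (length (b # a)) (b # a))
      = (\<Sum>i<length w. of_bool (initial (length a) (?x (Suc i)) = a)) / real (length w)"
      by (simp add: empirical_eq_sum del: sum_of_bool_eq flip: sum_divide_distrib)
         (subst sum.swap, simp del: sum_of_bool_eq)
    also have "(\<Sum>i<length w. of_bool (initial (length a) (?x (Suc i)) = a) :: real)
       = (\<Sum>i<length w. of_bool (initial (length a) (?x i) = a))"
      by (rule sum_Suc_periodic) (simp add: periodic_shift)
    finally show ?thesis by (simp add: empirical_eq_sum)
  qed
qed

lemma sum_empirical:
  fixes w :: "'a::finite list"
  shows "(\<Sum>a\<in>words k. empirical_weights w a * f a)
    = (\<Sum>i<length w. f (initial k (cyclic_orbit w i))) / real (length w)"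
proof -
  let ?x = "\<lambda>i. cyclic_orbit w i"
  have "(\<Sum>a\<in>words k. empirical_weights w a * f a)
     = (\<Sum>a\<in>words k. \<Sum>i<length w. of_bool (initial k (?x i) = a) * f a / real (length w))"
    by (intro sum.cong refl)
       (auto simp: empirical_weights_def empirical_eq_sum words_def sum_distrib_right sum_divide_distrib
         simp del: sum_of_bool_eq)
  also have "\<dots> = (\<Sum>i<length w. \<Sum>a\<in>words k. of_bool (initial k (?x i) = a) * f a / real (length w))"
    by (rule sum.swap)
  also have "\<dots> = (\<Sum>i<length w. f (initial k (?x i)) / real (length w))"
    by (intro sum.cong refl) (simp add: of_bool_def if_distrib[of "\<lambda>x. x * _ / _"] cong: if_cong)
  finally show ?thesis by (simp add: sum_divide_distrib)
qed

lemma empirical_entropies: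
  fixes w :: "'a::finite list"
  assumes "w \<noteq> []"
  shows "empirical_block_entropy k w = cyclic_H k w"
    and "1 \<le> k \<Longrightarrow> empirical_conditional_entropy k w = cyclic_h k w"
proof -
  show b: "empirical_block_entropy k w = cyclic_H k w" for k
    unfolding empirical_block_entropy_def
    by (rule block_entropy_cong) (simp add: words_def empirical_weights_def)
  assume "1 \<le> k"
  then obtain m where k: "k = Suc m" by (cases k) auto
  have "marginal (empirical w k) a = empirical_weights w a" if "a \<in> words m" for a
    using that k stationaryD(3)[OF stationary_empirical[OF assms], of a]
    by (simp add: marginal_def words_def empirical_weights_def)
  then have "H (k - 1) (marginal (empirical w k)) = H m (empirical_weights w)"
    unfolding k by (auto intro!: block_entropy_cong)
  then show "empirical_conditional_entropy k w = cyclic_h k w"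
    using b[of k] k unfolding empirical_conditional_entropy_def empirical_block_entropy_def
    by (simp add: conditional_entropy_def marginal_stationary[OF stationary_empirical[OF assms]])
qed

text \<open>
If \<open>q\<close> is substochastic as a transition kernel from words of length \<open>m\<close>, the products of transition
probabilities along all paths from a fixed starting word sum up to at most 1, and there are
\<open>CARD('a) ^ m\<close> starting words.
\<close>

lemma sum_path_products_le:
  fixes q :: "'a::finite list \<Rightarrow> real"
  assumes "\<And>a. 0 \<le> q a" "\<And>c. (\<Sum>b\<in>UNIV. q (c @ [b])) \<le> 1"
  shows "(\<Sum>u\<in>words (n + m). \<Prod>i<n. q (take (Suc m) (drop i u))) \<le> real CARD('a) ^ m"
proof (induction n)
  case 0
  show ?case by (simp add: card_words)
next
  case (Suc n)
  have "(\<Sum>u\<in>words (Suc n + m). \<Prod>i<Suc n. q (take (Suc m) (drop i u)))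
    = (\<Sum>u\<in>words (n + m). (\<Prod>i<n. q (take (Suc m) (drop i u))) * (\<Sum>b\<in>UNIV. q (drop n u @ [b])))"
    unfolding add_Suc sum_words_snoc sum_distrib_left
  proof (intro sum.cong refl)
    fix u :: "'a list" and b :: 'a
    assume u: "u \<in> words (n + m)"
    have "(\<Prod>i<n. q (take (Suc m) (drop i (u @ [b])))) = (\<Prod>i<n. q (take (Suc m) (drop i u)))"
      using u by (intro prod.cong refl) (auto simp: words_def)
    then show "(\<Prod>i<Suc n. q (take (Suc m) (drop i (u @ [b]))))
      = (\<Prod>i<n. q (take (Suc m) (drop i u))) * q (drop n u @ [b])"
      using u by (simp add: words_def)
  qed
  also have "\<dots> \<le> (\<Sum>u\<in>words (n + m). \<Prod>i<n. q (take (Suc m) (drop i u)))"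
    using assms by (intro sum_mono mult_left_le prod_nonneg) auto
  finally show ?case using Suc by linarith
qed

text \<open>
Unrolling a cyclic word by \<open>m\<close> more letters embeds the cyclic words into the paths.
\<close>

lemma sum_cyclic_products_le:
  fixes q :: "'a::finite list \<Rightarrow> real"
  assumes "\<And>a. 0 \<le> q a" "\<And>c. (\<Sum>b\<in>UNIV. q (c @ [b])) \<le> 1"
  shows "(\<Sum>w\<in>words n. \<Prod>i<n. q (initial (Suc m) (cyclic_orbit w i))) \<le> real CARD('a) ^ m"
proof -
  let ?e = "\<lambda>w :: 'a list. initial (n + m) (periodic_extension w)"
  have "inj_on ?e (words n)"
  proof (rule inj_on_inverseI)
    fix w :: "'a list" assume w: "w \<in> words n"
    have "take n (?e w) = initial n (periodic_extension w)"
      by (simp add: initial_def take_map)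
    then show "take n (?e w) = w" using w initial_periodic_extension[of w] by (simp add: words_def)
  qed
  moreover have "initial (Suc m) (cyclic_orbit w i) = take (Suc m) (drop i (?e w))"
    if "i < n" for w :: "'a list" and i
    using that by (intro nth_equalityI) (auto simp: initial_def funpow_shift simp del: upt_Suc)
  ultimately have "(\<Sum>w\<in>words n. \<Prod>i<n. q (initial (Suc m) (cyclic_orbit w i)))
      = (\<Sum>u\<in>?e ` words n. \<Prod>i<n. q (take (Suc m) (drop i u)))"
    by (subst sum.reindex) (auto intro!: sum.cong prod.cong)
  also have "\<dots> \<le> (\<Sum>u\<in>words (n + m). \<Prod>i<n. q (take (Suc m) (drop i u)))"
    using assms by (intro sum_mono2) (auto intro!: prod_nonneg)
  also have "\<dots> \<le> real CARD('a) ^ m" by (rule sum_path_products_le[OF assms])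
  finally show ?thesis .
qed

text \<open>
The exponential of \<open>- n h\<close> is the probability that the Markov chain with the empirical transition
probabilities of \<open>w\<close> runs once around \<open>w\<close>.
\<close>

lemma exp_empirical_conditional_entropy:
  fixes w :: "'a::finite list"
  assumes w: "w \<noteq> []"
  shows "exp (- real (length w) * cyclic_h (Suc m) w)
     = (\<Prod>i<length w. empirical_weights w (initial (Suc m) (cyclic_orbit w i))
         / empirical_weights w (initial m (cyclic_orbit w i)))"
proof -
  let ?\<pi> = "empirical_weights w" and ?n = "length w"
  let ?x = "\<lambda>i. cyclic_orbit w i"
  note st = stationary_empirical[OF w]
  have pos: "0 < ?\<pi> (initial k (?x i))" if "i < ?n" for i k
  proof -
    have "0 < card {j. j < ?n \<and> initial k (?x j) = initial k (?x i)}"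
      unfolding card_gt_0_iff using that by auto
    then have "0 < real (card {j. j < ?n \<and> initial k (?x j) = initial k (?x i)})" by linarith
    moreover have "0 < real ?n" using w by simp
    ultimately show ?thesis unfolding empirical_weights_def empirical_def length_initial
      by (rule divide_pos_pos)
  qed
  have "conditional_entropy (Suc m) ?\<pi>
     = (\<Sum>a\<in>words (Suc m). ?\<pi> a * ln (?\<pi> (butlast a))) - (\<Sum>a\<in>words (Suc m). ?\<pi> a * ln (?\<pi> a))"
    using block_entropy_eq_snoc[OF st, of m]
    by (simp add: conditional_entropy_stationary[OF st] block_entropy_def[of "Suc m"])
  also have "\<dots> = (\<Sum>i<?n. ln (?\<pi> (initial m (?x i))) - ln (?\<pi> (initial (Suc m) (?x i)))) / real ?n"
    by (simp add: sum_empirical butlast_initial sum_subtractf diff_divide_distrib)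
  finally have "- real ?n * conditional_entropy (Suc m) ?\<pi>
     = (\<Sum>i<?n. ln (?\<pi> (initial (Suc m) (?x i))) - ln (?\<pi> (initial m (?x i))))"
    using w by (simp add: sum_subtractf)
  then show ?thesis
    using pos by (simp add: exp_sum exp_diff)
qed

text \<open>
The two terms are the logarithms of a bound for the number of empirical distributions of
\<open>k\<close>-blocks in words of length \<open>n\<close>, and of the number of initial states of the Markov chain that a
distribution of \<open>k\<close>-blocks defines.
\<close>

definition kraft_cost :: "'a itself \<Rightarrow> nat \<Rightarrow> nat \<Rightarrow> real" where
  "kraft_cost _ n k = real (CARD('a) ^ k) * ln (real n + 1) + real k * ln (real CARD('a))"

text \<open>
Group the words by their type, that is, by the empirical distribution of their \<open>k\<close>-blocks. For
the words of one type the summands are path probabilities of one Markov chain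
(\<open>exp_empirical_conditional_entropy\<close>), so they contribute at most the number of initial states.
The number of types is at most \<open>(n + 1) ^ CARD('a) ^ k\<close>, because all frequencies are multiples of \<open>1 / n\<close>.
\<close>

lemma kraft_empirical:
  assumes "1 \<le> n" "1 \<le> k"
  shows "ln (\<Sum>w\<in>words n. exp (- real n * conditional_entropy k (empirical_weights (w :: 'a::finite list))))
     \<le> kraft_cost TYPE('a) n k"
proof -
  obtain m where k: "k = Suc m" using assms(2) by (cases k) auto
  let ?x = "\<lambda>w i. (shift_map ^^ i) (periodic_extension (w :: 'a list))"
  define \<tau> where "\<tau> w = restrict (empirical_weights w) (words (Suc m))" for w :: "'a list"
  define q where "q \<theta> a = \<theta> a / (\<Sum>b\<in>UNIV. \<theta> (butlast a @ [b]))" for \<theta> :: "'a list \<Rightarrow> real" and a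
  let ?Q = "\<lambda>\<theta> w. \<Prod>i<n. q \<theta> (initial (Suc m) (?x w i))"
  have exp_eq: "exp (- real n * cyclic_h k w) = ?Q (\<tau> w) w" if "w \<in> words n" for w
  proof -
    have w: "w \<noteq> []" "length w = n" using that assms by (auto simp: words_def)
    have "(\<Sum>b\<in>UNIV. \<tau> w (initial m (?x w i) @ [b])) = empirical_weights w (initial m (?x w i))" for i
      using stationaryD(3)[OF stationary_empirical[OF w(1)], of "initial m (?x w i)"]
      by (simp add: \<tau>_def words_def)
    then show ?thesis
      using exp_empirical_conditional_entropy[OF w(1), of m] w k
      by (simp add: q_def butlast_initial) (simp add: \<tau>_def)
  qed
  have \<tau>_nonneg: "0 \<le> \<theta> a" if "\<theta> \<in> \<tau> ` words n" "a \<in> words (Suc m)" for \<theta> a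
    using that by (auto simp: \<tau>_def empirical_weights_def empirical_def)
  have Q_le: "(\<Sum>w\<in>words n. ?Q \<theta> w) \<le> real CARD('a) ^ m" if \<theta>: "\<theta> \<in> \<tau> ` words n" for \<theta>
  proof -
    \<comment> \<open>A type is only meaningful on words of length \<open>Suc m\<close>, so the kernel is cut off elsewhere.\<close>
    define q' where "q' a = (if a \<in> words (Suc m) then q \<theta> a else 0)" for a
    have q'0: "0 \<le> q' a" for a
    proof (cases "a \<in> words (Suc m)")
      case True
      then have "butlast a @ [b] \<in> words (Suc m)" for b by (auto simp: words_def)
      then show ?thesis unfolding q'_def q_def using True \<tau>_nonneg[OF \<theta>] by (auto intro!: divide_nonneg_nonneg sum_nonneg)
    qed (simp add: q'_def)
    have q'1: "(\<Sum>b\<in>UNIV. q' (c @ [b])) \<le> 1" for c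
    proof (cases "c \<in> words m")
      case True
      then have "(\<Sum>b\<in>UNIV. q' (c @ [b])) = (\<Sum>b\<in>UNIV. \<theta> (c @ [b])) / (\<Sum>b\<in>UNIV. \<theta> (c @ [b]))"
        by (simp add: q'_def q_def words_def flip: sum_divide_distrib)
      then show ?thesis by simp
    qed (simp add: q'_def words_def)
    have "(\<Sum>w\<in>words n. \<Prod>i<n. q' (initial (Suc m) (?x w i))) \<le> real CARD('a) ^ m"
      by (rule sum_cyclic_products_le[OF q'0 q'1])
    then show ?thesis by (simp add: q'_def)
  qed
  have "(\<Sum>w\<in>(words n :: 'a list set). exp (- real n * cyclic_h k w)) = (\<Sum>w\<in>words n. ?Q (\<tau> w) w)"
    by (rule sum.cong[OF refl exp_eq])
  also have "\<dots> \<le> (\<Sum>w\<in>words n. \<Sum>\<theta>\<in>\<tau> ` words n. ?Q \<theta> w)"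
  proof (intro sum_mono member_le_sum[where f = "\<lambda>\<theta>. ?Q \<theta> _"])
    fix w \<theta> assume "\<theta> \<in> \<tau> ` words n - {\<tau> (w :: 'a list)}"
    then have "\<theta> \<in> \<tau> ` words n" by blast
    moreover have "butlast (initial (Suc m) (?x w i)) @ [b] \<in> words (Suc m)" for i b by (simp add: words_def)
    ultimately show "0 \<le> ?Q \<theta> w"
      unfolding q_def by (intro prod_nonneg divide_nonneg_nonneg sum_nonneg) (auto intro!: \<tau>_nonneg)
  qed auto
  also have "\<dots> = (\<Sum>\<theta>\<in>\<tau> ` words n. \<Sum>w\<in>words n. ?Q \<theta> w)" by (rule sum.swap)
  also have "\<dots> \<le> (\<Sum>\<theta>\<in>\<tau> ` words n. real CARD('a) ^ m)" by (intro sum_mono Q_le)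
  also have "\<dots> = real (card (\<tau> ` words n)) * real CARD('a) ^ m" by simp
  also have "\<dots> \<le> (real n + 1) ^ (CARD('a) ^ k) * real CARD('a) ^ m"
  proof (intro mult_right_mono)
    let ?V = "(\<lambda>j. real j / real n) ` {..n}"
    have "\<tau> ` words n \<subseteq> words (Suc m) \<rightarrow>\<^sub>E ?V"
    proof
      fix \<theta> assume "\<theta> \<in> \<tau> ` words n"
      then obtain w where w: "w \<in> words n" "\<theta> = \<tau> w" by auto
      have "card {i. i < n \<and> P i} \<le> n" for P
        using card_mono[of "{..<n}" "{i. i < n \<and> P i}"] by auto
      then show "\<theta> \<in> words (Suc m) \<rightarrow>\<^sub>E ?V"
        using w by (auto simp: \<tau>_def empirical_weights_def empirical_def words_def)
    qed
    then have "card (\<tau> ` words n) \<le> card (words (Suc m :: nat) \<rightarrow>\<^sub>E ?V :: ('a list \<Rightarrow> real) set)"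
      by (intro card_mono finite_PiE) auto
    also have "\<dots> = card ?V ^ (CARD('a) ^ k)" by (simp add: card_PiE card_words k)
    also have "\<dots> \<le> (n + 1) ^ (CARD('a) ^ k)"
      using card_image_le[of "{..n}" "\<lambda>j. real j / real n"] by (intro power_mono) auto
    finally have "real (card (\<tau> ` words n)) \<le> real ((n + 1) ^ (CARD('a) ^ k))" by linarith
    then show "real (card (\<tau> ` words n)) \<le> (real n + 1) ^ (CARD('a) ^ k)"
      by (simp add: add.commute)
  qed auto
  also have "\<dots> \<le> (real n + 1) ^ (CARD('a) ^ k) * real CARD('a) ^ k"
    by (intro mult_left_mono power_increasing) (auto simp: k Suc_le_eq)
  finally have "ln (\<Sum>w\<in>(words n :: 'a list set). exp (- real n * cyclic_h k w))
      \<le> ln ((real n + 1) ^ (CARD('a) ^ k) * real CARD('a) ^ k)"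
    by (intro ln_mono) (auto intro!: sum_pos)
  also have "\<dots> = real (CARD('a) ^ k) * ln (real n + 1) + real k * ln (real CARD('a))"
    by (simp add: ln_mult ln_realpow)
  finally show ?thesis by (simp add: kraft_cost_def)
qed

section \<open>Cylinders, continuity and invariant measures\<close>

lemma initial_eq_iff: "initial n x = initial n y \<longleftrightarrow> (\<forall>i<n. x i = y i)"
  by (auto simp: initial_def)

lemma mem_cylinder: "x \<in> cylinder a \<longleftrightarrow> initial (length a) x = a"
  by (simp add: cylinder_def)

lemma nth_initial [simp]: "i < n \<Longrightarrow> initial n x ! i = x i"
  by (simp add: initial_def)

lemma mem_cylinder_iff: "x \<in> cylinder a \<longleftrightarrow> (\<forall>i<length a. x i = a ! i)"
  using list_eq_iff_nth_eq[of "initial (length a) x" a] by (simp add: mem_cylinder)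

lemma cylinder_disjoint: "length a = length b \<Longrightarrow> a \<noteq> b \<Longrightarrow> cylinder a \<inter> cylinder b = {}"
  unfolding cylinder_def by fastforce

lemma cylinder_eq: "cylinder a = (\<Inter>i<length a. (\<lambda>x. x i) -` {a ! i})"
  by (auto simp: mem_cylinder_iff)

lemma cylinder_Nil [simp]: "cylinder [] = UNIV"
  by (auto simp: mem_cylinder)

lemma periodic_extension_in_cylinder: "periodic_extension w \<in> cylinder w"
  by (simp add: mem_cylinder initial_periodic_extension)

lemma open_cylinder: "open (cylinder (a :: 'a::{finite,discrete_topology} list))"
  unfolding cylinder_eq
  by (intro open_INT ballI open_vimage continuous_on_product_coordinates discrete_topology_class.open_discrete) auto

lemma cylinder_neighbourhood:
  assumes "open U" "x \<in> (U :: (nat \<Rightarrow> 'a::{finite,discrete_topology}) set)"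
  shows "\<exists>n. cylinder (initial n x) \<subseteq> U"
proof -
  have "openin (product_topology (\<lambda>i. euclidean) UNIV) U"
    using assms(1) by (simp add: open_fun_def)
  from product_topology_open_contains_basis[OF this assms(2)]
  obtain X where X: "x \<in> (\<Pi>\<^sub>E i\<in>UNIV. X i)" "finite {i. X i \<noteq> (UNIV :: 'a set)}" "(\<Pi>\<^sub>E i\<in>UNIV. X i) \<subseteq> U"
    by auto
  obtain n where n: "\<And>i. X i \<noteq> UNIV \<Longrightarrow> i < n"
    using finite_nat_set_iff_bounded X(2) by auto
  have "cylinder (initial n x) \<subseteq> (\<Pi>\<^sub>E i\<in>UNIV. X i)"
  proof
    fix y assume "y \<in> cylinder (initial n x)"
    then have y: "\<And>i. i < n \<Longrightarrow> y i = x i" by (auto simp: mem_cylinder initial_eq_iff)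
    have "y i \<in> X i" for i
    proof (cases "X i = UNIV")
      case False
      then show ?thesis using X(1) y[OF n] by (auto simp: PiE_iff)
    qed simp
    then show "y \<in> (\<Pi>\<^sub>E i\<in>UNIV. X i)" by (auto simp: PiE_iff)
  qed
  then show ?thesis using X(3) by blast
qed

text \<open>
There are only countably many cylinders, so every open set is a countable union of cylinders.
\<close>

lemma sets_borel_cylinders:
  "sets (borel :: (nat \<Rightarrow> 'a::{finite,discrete_topology}) measure) = sigma_sets UNIV (range cylinder)"
proof (rule antisym)
  have "U \<in> sigma_sets UNIV (range cylinder)" if U: "open (U :: (nat \<Rightarrow> 'a) set)" for U
  proof -
    have "U = (\<Union>a\<in>{a. cylinder a \<subseteq> U}. cylinder a)"
    proof (intro antisym subsetI)
      fix x assume "x \<in> U"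
      then obtain n where "cylinder (initial n x) \<subseteq> U" using cylinder_neighbourhood[OF U] by blast
      then show "x \<in> (\<Union>a\<in>{a. cylinder a \<subseteq> U}. cylinder a)"
        by (intro UN_I[of "initial n x"]) (auto simp: mem_cylinder)
    qed auto
    also have "\<dots> \<in> sigma_sets UNIV (range cylinder)"
      by (rule sigma_sets_UNION) (auto intro: sigma_sets.Basic)
    finally show ?thesis .
  qed
  then show "sets (borel :: 'a process) \<subseteq> sigma_sets UNIV (range cylinder)"
    unfolding borel_def by (auto intro!: sigma_sets_mono)
  show "sigma_sets UNIV (range cylinder) \<subseteq> sets (borel :: 'a process)"
    using sets.sigma_sets_subset[of "range cylinder" "borel :: 'a process"]
    by (simp add: image_subset_iff borel_open open_cylinder)
qed

lemma cylinder_borel [measurable, simp]: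
  "cylinder (a :: 'a::{finite,discrete_topology} list) \<in> sets borel"
  by (intro borel_open open_cylinder)

lemma cylinder_disjoint_or_nested:
  "cylinder a \<inter> cylinder b \<in> {{}, cylinder a, cylinder b}"
proof -
  have *: "cylinder b \<subseteq> cylinder a \<or> cylinder a \<inter> cylinder b = {}" if le: "length a \<le> length b" for a b :: "'a list"
  proof (rule disjCI)
    assume "cylinder a \<inter> cylinder b \<noteq> {}"
    then obtain x where x: "\<forall>i<length a. x i = a ! i" "\<forall>i<length b. x i = b ! i"
      by (auto simp: mem_cylinder_iff)
    have "a ! i = b ! i" if "i < length a" for i using x that le by (metis less_le_trans)
    then show "cylinder b \<subseteq> cylinder a" using le by (auto simp: mem_cylinder_iff)
  qed
  show ?thesis using *[of a b] *[of b a] by (cases "length a \<le> length b") auto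
qed

lemma measure_eqI_cylinders:
  fixes M N :: "'a::{finite,discrete_topology} process"
  assumes "prob_space M" "prob_space N" "sets M = sets borel" "sets N = sets borel"
    and "\<And>a. measure M (cylinder a) = measure N (cylinder a)"
  shows "M = N"
proof -
  interpret M: prob_space M by fact
  interpret N: prob_space N by fact
  show ?thesis
  proof (rule measure_eqI_generator_eq[where E = "insert {} (range cylinder)" and \<Omega> = UNIV and A = "\<lambda>_. UNIV"])
    show "Int_stable (insert {} (range cylinder :: (nat \<Rightarrow> 'a) set set))"
      unfolding Int_stable_def using cylinder_disjoint_or_nested by fastforce
    have "sigma_sets UNIV (insert {} (range cylinder)) = sigma_sets UNIV (range cylinder :: (nat \<Rightarrow> 'a) set set)"
      by (intro antisym sigma_sets_mono sigma_sets_mono') (auto intro: sigma_sets.Basic sigma_sets.Empty)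
    then show "sets M = sigma_sets UNIV (insert {} (range cylinder))" "sets N = sigma_sets UNIV (insert {} (range cylinder))"
      using assms sets_borel_cylinders by auto
    show "range (\<lambda>_ :: nat. UNIV) \<subseteq> insert {} (range (cylinder :: 'a list \<Rightarrow> _))"
      using cylinder_Nil by blast
    show "emeasure M X = emeasure N X" if "X \<in> insert {} (range cylinder)" for X
      using that assms(5) by (auto simp: M.emeasure_eq_measure N.emeasure_eq_measure)
  qed auto
qed

lemma measurable_shift [measurable]:
  "shift_map \<in> borel_measurable (borel :: (nat \<Rightarrow> 'a::{finite,discrete_topology}) measure)"
  unfolding shift_map_def
  by (intro borel_measurable_continuous_onI continuous_on_coordinatewise_then_product
      continuous_on_product_coordinates)

abbreviation \<M> :: "'a::{finite,discrete_topology} process set" where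
  "\<M> \<equiv> invariant_measures"

abbreviation mean :: "'b measure \<Rightarrow> ('b \<Rightarrow> real) \<Rightarrow> real" where
  "mean \<equiv> integral\<^sup>L"

lemma invariantD:
  assumes "\<nu> \<in> \<M>"
  shows "prob_space \<nu>" "sets \<nu> = sets borel" "distr \<nu> borel shift_map = \<nu>" "space \<nu> = UNIV"
  using assms sets_eq_imp_space_eq[of \<nu> borel] by (auto simp: invariant_measures_def)

abbreviation weights :: "'a process \<Rightarrow> 'a list \<Rightarrow> real" where
  "weights \<nu> a \<equiv> measure \<nu> (cylinder a)"

lemma weights_snoc:
  fixes \<nu> :: "'a::{finite,discrete_topology} process"
  assumes "prob_space \<nu>" "sets \<nu> = sets borel"
  shows "(\<Sum>b\<in>UNIV. weights \<nu> (a @ [b])) = weights \<nu> a"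
proof -
  interpret prob_space \<nu> by fact
  have "cylinder a = (\<Union>b\<in>UNIV. cylinder (a @ [b]))" by (auto simp: mem_cylinder_iff nth_append less_Suc_eq)
  moreover have "measure \<nu> (\<Union>b\<in>UNIV. cylinder (a @ [b])) = (\<Sum>b\<in>UNIV. weights \<nu> (a @ [b]))"
    using assms(2) by (intro finite_measure_finite_Union) (simp_all add: disjoint_family_on_def cylinder_disjoint image_subset_iff)
  ultimately show ?thesis by simp
qed

lemma measure_shift_vimage:
  fixes \<nu> :: "'a::{finite,discrete_topology} process"
  assumes "prob_space \<nu>" "sets \<nu> = sets borel"
  shows "measure \<nu> (shift_map -` cylinder a) = (\<Sum>b\<in>UNIV. weights \<nu> (b # a))"
proof -
  interpret prob_space \<nu> by fact
  have "shift_map -` cylinder a = (\<Union>b\<in>UNIV. cylinder (b # a))"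
    by (simp add: set_eq_iff mem_cylinder initial_Cons)
  moreover have "measure \<nu> (\<Union>b\<in>UNIV. cylinder (b # a)) = (\<Sum>b\<in>UNIV. weights \<nu> (b # a))"
    using assms(2) by (intro finite_measure_finite_Union) (simp_all add: disjoint_family_on_def cylinder_disjoint image_subset_iff)
  ultimately show ?thesis by simp
qed

lemma measure_distr_shift:
  fixes \<nu> :: "'a::{finite,discrete_topology} process"
  assumes "sets \<nu> = sets borel" "B \<in> sets borel"
  shows "measure (distr \<nu> borel shift_map) B = measure \<nu> (shift_map -` B)"
  using assms sets_eq_imp_space_eq[OF assms(1)] measurable_cong_sets[OF assms(1) refl]
  by (subst measure_distr) auto

lemma stationary_weights:
  assumes "\<nu> \<in> \<M>"
  shows "stationary (weights \<nu>)"
proof -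
  note * = invariantD[OF assms]
  interpret prob_space \<nu> by (rule *(1))
  have "(\<Sum>b\<in>UNIV. weights \<nu> (b # a)) = weights \<nu> a" for a
    using measure_shift_vimage[OF *(1,2), of a] measure_distr_shift[OF *(2), of "cylinder a"] *(3) by simp
  then show ?thesis
    unfolding stationary_def using weights_snoc[OF *(1,2)] prob_space *(4) by simp
qed

lemma invariantI:
  fixes \<nu> :: "'a::{finite,discrete_topology} process"
  assumes "prob_space \<nu>" "sets \<nu> = sets borel" "stationary (weights \<nu>)"
  shows "\<nu> \<in> \<M>"
proof -
  have "distr \<nu> borel shift_map = \<nu>"
  proof (rule measure_eqI_cylinders)
    show "prob_space (distr \<nu> borel shift_map)"
      using assms(1,2) by (intro prob_space.prob_space_distr) (simp_all cong: measurable_cong_sets)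
    show "measure (distr \<nu> borel shift_map) (cylinder a) = weights \<nu> a" for a
      using assms stationaryD(4)[OF assms(3), of a] by (simp add: measure_distr_shift measure_shift_vimage)
  qed (use assms in auto)
  then show ?thesis using assms by (simp add: invariant_measures_def)
qed

text \<open>
A random rule \<open>\<omega>\<close> that names the next letter after each finite history determines a sequence;
\<open>prefix_of\<close> lists its initial words.
\<close>

primrec prefix_of :: "('a list \<Rightarrow> 'a) \<Rightarrow> nat \<Rightarrow> 'a list" where
  "prefix_of \<omega> 0 = []"
| "prefix_of \<omega> (Suc n) = prefix_of \<omega> n @ [\<omega> (prefix_of \<omega> n)]"

lemma initial_prefix_of: "initial n (\<lambda>i. \<omega> (prefix_of \<omega> i)) = prefix_of \<omega> n"
  by (induction n) (auto simp: initial_snoc)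

lemma prefix_of_eq_iff:
  "length a = n \<Longrightarrow> prefix_of \<omega> n = a \<longleftrightarrow> (\<forall>i<n. \<omega> (take i a) = a ! i)"
proof (induction n arbitrary: a)
  case (Suc n)
  then obtain a' b where a: "a = a' @ [b]" "length a' = n" by (metis length_Suc_conv_rev)
  show ?case using Suc.IH[OF a(2)] a by (auto simp: less_Suc_eq nth_append)
qed auto

text \<open>
Kolmogorov extension. Choose independently for each finite history \<open>w\<close> the
letter that follows it, with the conditional probabilities \<open>p (w @ [b]) / p w\<close>, and read off the
sequence that these choices generate. It lies in the cylinder of \<open>a\<close> exactly if the choices at the
prefixes of \<open>a\<close> are the letters of \<open>a\<close>; these are finitely many independent events, whose
probabilities multiply to \<open>p a\<close>.
\<close>

theorem invariant_measure_exists: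
  fixes p :: "'a::{finite,discrete_topology} list \<Rightarrow> real"
  assumes "stationary p"
  shows "\<exists>\<nu>\<in>\<M>. \<forall>a. measure \<nu> (cylinder a) = p a"
proof -
  \<comment> \<open>At histories of probability 0 any distribution will do.\<close>
  define r where "r w b = (if p w = 0 then of_bool (b = undefined) else p (w @ [b]) / p w)" for w b
  have r: "0 \<le> r w b" "(\<Sum>b\<in>UNIV. r w b) = 1" for w b
    using stationaryD[OF assms] by (cases "p w = 0"; auto simp: r_def sum_divide_distrib[symmetric])+
  define q where "q w = embed_pmf (r w)" for w
  have q: "pmf (q w) b = r w b" for w b
    unfolding q_def using r by (intro pmf_embed_pmf) (auto simp: nn_integral_count_space_finite sum_ennreal)
  interpret P: product_prob_space "\<lambda>w :: 'a list. measure_pmf (q w)" UNIV ..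
  let ?P = "Pi\<^sub>M UNIV (\<lambda>w :: 'a list. measure_pmf (q w))"
  define path where "path \<omega> = (\<lambda>i. \<omega> (prefix_of \<omega> i))" for \<omega> :: "'a list \<Rightarrow> 'a"
  define J where "J a = (\<lambda>i. take i a) ` {..<length a}" for a :: "'a list"
  have vim: "path -` cylinder a = prod_emb UNIV (\<lambda>w. measure_pmf (q w)) (J a) (\<Pi>\<^sub>E w\<in>J a. {a ! length w})" for a
    using prefix_of_eq_iff[of a "length a"]
    by (auto simp: mem_cylinder path_def initial_prefix_of prod_emb_def J_def PiE_iff space_PiM)
  have path_measurable: "path \<in> measurable ?P borel"
    unfolding borel_def[where 'a = "nat \<Rightarrow> 'a"]
  proof (subst measurable_cong_sets[OF refl, where N' = "sigma UNIV (range cylinder)"])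
    show "sets (sigma UNIV {S. open S}) = sets (sigma UNIV (range (cylinder :: 'a list \<Rightarrow> _)))"
      using sets_borel_cylinders[where 'a = 'a] by (simp add: borel_def)
    show "path \<in> measurable ?P (sigma UNIV (range cylinder))"
    proof (rule measurable_measure_of)
      show "path -` y \<inter> space ?P \<in> sets ?P" if "y \<in> range cylinder" for y
        using that vim by (auto simp: space_PiM J_def intro!: sets_PiM_I)
    qed auto
  qed
  define \<nu> where "\<nu> = distr ?P borel path"
  have prob: "prob_space \<nu>" unfolding \<nu>_def using path_measurable by (rule P.prob_space_distr)
  have "measure \<nu> (cylinder a) = p a" for a
  proof -
    have "measure \<nu> (cylinder a) = measure ?P (path -` cylinder a)"
      unfolding \<nu>_def by (subst measure_distr[OF path_measurable]) (auto simp: space_PiM)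
    also have "\<dots> = (\<Prod>w\<in>J a. measure (measure_pmf (q w)) {a ! length w})"
      unfolding vim by (rule P.measure_PiM_emb) (auto simp: J_def)
    also have "\<dots> = (\<Prod>i<length a. r (take i a) (a ! i))"
    proof -
      have "inj_on (\<lambda>i. take i a) {..<length a}"
        by (rule inj_on_inverseI[of _ length]) auto
      then show ?thesis unfolding J_def by (subst prod.reindex) (auto simp: measure_pmf_single q intro!: prod.cong)
    qed
    also have "\<dots> = p a"
    proof -
      have "n \<le> length a \<Longrightarrow> (\<Prod>i<n. r (take i a) (a ! i)) = p (take n a)" for n
      proof (induction n)
        case (Suc n)
        then have "take (Suc n) a = take n a @ [a ! n]" by (simp add: take_Suc_conv_app_nth)
        moreover have "p (take n a @ [a ! n]) = 0" if "p (take n a) = 0"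
          using stationary_snoc_le[OF assms, of "take n a" "a ! n"] stationaryD(1)[OF assms, of "take n a @ [a ! n]"] that
          by linarith
        ultimately show ?case using Suc by (auto simp: r_def)
      qed (simp add: stationaryD[OF assms])
      then show ?thesis by fastforce
    qed
    finally show ?thesis .
  qed
  moreover from this have "\<nu> \<in> \<M>"
    using prob assms by (intro invariantI) (auto simp: \<nu>_def)
  ultimately show ?thesis by blast
qed

section \<open>Periodic orbits\<close>

definition periodic_measure :: "'a::{finite,discrete_topology} list \<Rightarrow> 'a process" where
  "periodic_measure w = distr (measure_pmf (pmf_of_set {..<length w})) borel
     (cyclic_orbit w)"

lemma measure_periodic_measure:
  assumes "w \<noteq> []" "B \<in> sets borel"
  shows "measure (periodic_measure w) B
     = card {i. i < length w \<and> cyclic_orbit w i \<in> B} / length w"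
proof -
  have "measure (periodic_measure w) B
     = measure (measure_pmf (pmf_of_set {..<length w})) {i. cyclic_orbit w i \<in> B}"
    unfolding periodic_measure_def using assms(2) by (subst measure_distr) (auto simp: vimage_def)
  also have "\<dots> = card ({..<length w} \<inter> {i. cyclic_orbit w i \<in> B}) / length w"
    using assms(1) by (subst measure_pmf_of_set) (auto simp: lessThan_empty_iff)
  also have "{..<length w} \<inter> {i. cyclic_orbit w i \<in> B}
     = {i. i < length w \<and> cyclic_orbit w i \<in> B}" by auto
  finally show ?thesis .
qed

lemma weights_periodic_measure:
  "w \<noteq> [] \<Longrightarrow> weights (periodic_measure w) a = empirical_weights w a"
  by (simp add: measure_periodic_measure empirical_weights_def empirical_def mem_cylinder)

lemma periodic_measure_invariant:
  assumes "w \<noteq> []"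
  shows "periodic_measure w \<in> \<M>"
proof (rule invariantI)
  show "prob_space (periodic_measure w)"
    unfolding periodic_measure_def by (intro prob_space.prob_space_distr) (auto intro: measure_pmf.prob_space_axioms)
  show "sets (periodic_measure w) = sets borel" by (simp add: periodic_measure_def)
  show "stationary (weights (periodic_measure w))"
    using assms by (simp add: weights_periodic_measure stationary_empirical)
qed

text \<open>
An invariant set contains either the whole orbit or none of it.
\<close>

lemma periodic_measure_ergodic:
  assumes "w \<noteq> []"
  shows "periodic_measure w \<in> ergodic_measures"
  unfolding ergodic_measures_def
proof (intro CollectI conjI ballI impI periodic_measure_invariant assms)
  fix B :: "(nat \<Rightarrow> 'a) set" assume B: "B \<in> sets borel" "shift_map -` B = B"
  have "(shift_map ^^ i) x \<in> B \<longleftrightarrow> x \<in> B" for i x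
    using B(2) by (induction i) auto
  then show "measure (periodic_measure w) B = 0 \<or> measure (periodic_measure w) B = 1"
    using assms by (cases "periodic_extension w \<in> B") (auto simp: measure_periodic_measure[OF assms B(1)])
qed

lemma integral_periodic_measure:
  fixes f :: "'a::{finite,discrete_topology} observable"
  assumes "w \<noteq> []" "f \<in> borel_measurable borel"
  shows "integral\<^sup>L (periodic_measure w) f = (\<Sum>i<length w. f (cyclic_orbit w i)) / length w"
  unfolding periodic_measure_def using assms
  by (subst integral_distr) (auto simp: integral_pmf_of_set lessThan_empty_iff)

section \<open>Oscillation and distortion\<close>

lemma compact_sequence_space: "compact (UNIV :: (nat \<Rightarrow> 'a::{finite,discrete_topology}) set)"
proof -
  have "compact_space (euclidean :: 'a topology)"
    by (simp add: compact_space_def finite_imp_compact)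
  then have "compact_space (product_topology (\<lambda>i :: nat. euclidean :: 'a topology) UNIV)"
    by (simp add: compact_space_product_topology)
  then show ?thesis by (simp add: euclidean_product_topology compact_space_def)
qed

lemma continuous_bounded:
  fixes \<psi> :: "'a::{finite,discrete_topology} observable"
  assumes "continuous_on UNIV \<psi>"
  obtains B where "\<And>x. \<bar>\<psi> x\<bar> \<le> B" "0 \<le> B"
proof -
  have "bounded (range \<psi>)"
    using compact_continuous_image[OF assms compact_sequence_space] compact_imp_bounded by blast
  then obtain B where "\<And>x. \<bar>\<psi> x\<bar> \<le> B" by (auto simp: bounded_iff)
  moreover from this[of undefined] have "0 \<le> B" by linarith
  ultimately show ?thesis using that by blast
qed

definition oscillation :: "'a observable \<Rightarrow> nat \<Rightarrow> real" where
  "oscillation \<psi> n = (SUP (x, y)\<in>{(x, y). initial n x = initial n y}. \<bar>\<psi> x - \<psi> y\<bar>)"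

lemma oscillation:
  fixes \<psi> :: "'a::{finite,discrete_topology} observable"
  assumes "continuous_on UNIV \<psi>"
  shows "initial n x = initial n y \<Longrightarrow> \<bar>\<psi> x - \<psi> y\<bar> \<le> oscillation \<psi> n"
    and "0 \<le> oscillation \<psi> n" and "oscillation \<psi> \<longlonglongrightarrow> 0"
proof -
  obtain B where B: "\<And>x. \<bar>\<psi> x\<bar> \<le> B" using continuous_bounded[OF assms] by blast
  have le2: "\<bar>\<psi> x - \<psi> y\<bar> \<le> 2 * B" for x y using B[of x] B[of y] by linarith
  have bdd: "bdd_above ((\<lambda>(x, y). \<bar>\<psi> x - \<psi> y\<bar>) ` {(x, y). initial n x = initial n y})" for n
    using le2 by (intro bdd_aboveI2[of _ _ "2 * B"]) auto
  show *: "\<bar>\<psi> x - \<psi> y\<bar> \<le> oscillation \<psi> n" if "initial n x = initial n y" for n x y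
    using cSUP_upper[OF _ bdd[of n], of "(x, y)"] that by (simp add: oscillation_def)
  show nonneg: "0 \<le> oscillation \<psi> n" for n
    using *[of n undefined undefined] by simp
  show "oscillation \<psi> \<longlonglongrightarrow> 0"
  proof (rule LIMSEQ_I)
    fix e :: real assume e: "0 < e"
    have "\<exists>n. \<forall>y\<in>cylinder (initial n x). \<bar>\<psi> y - \<psi> x\<bar> < e / 4" for x
    proof -
      have "open (\<psi> -` ball (\<psi> x) (e / 4))" using assms by (intro open_vimage) auto
      moreover have "x \<in> \<psi> -` ball (\<psi> x) (e / 4)" using e by simp
      ultimately obtain n where "cylinder (initial n x) \<subseteq> \<psi> -` ball (\<psi> x) (e / 4)"
        using cylinder_neighbourhood by blast
      then show ?thesis by (intro exI[of _ n]) (auto simp: dist_real_def abs_minus_commute subset_iff)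
    qed
    then obtain m where m: "\<And>x y. y \<in> cylinder (initial (m x) x) \<Longrightarrow> \<bar>\<psi> y - \<psi> x\<bar> < e / 4" by metis
    \<comment> \<open>Finitely many of these cylinders cover the space, and the longest of them gives the threshold.\<close>
    obtain C where C: "finite C" "UNIV \<subseteq> (\<Union>x\<in>C. cylinder (initial (m x) x))"
    proof (rule compactE_image[OF compact_sequence_space, of UNIV "\<lambda>x. cylinder (initial (m x) x)"])
      show "UNIV \<subseteq> (\<Union>x\<in>UNIV. cylinder (initial (m x) x))" by (auto simp: mem_cylinder)
    qed (auto simp: open_cylinder)
    obtain N where N: "\<And>x. x \<in> C \<Longrightarrow> m x \<le> N"
      using finite_nat_set_iff_bounded_le[of "m ` C"] C(1) by auto
    have "oscillation \<psi> n \<le> e / 2" if n: "N \<le> n" for n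
      unfolding oscillation_def
    proof (rule cSUP_least, safe)
      fix x y :: "nat \<Rightarrow> 'a" assume xy: "initial n x = initial n y"
      obtain c where c: "c \<in> C" "x \<in> cylinder (initial (m c) c)" using C(2) by blast
      then have "y \<in> cylinder (initial (m c) c)"
        using xy N[OF c(1)] n by (auto simp: mem_cylinder initial_eq_iff)
      then show "\<bar>\<psi> x - \<psi> y\<bar> \<le> e / 2" using m[OF c(2)] m[of y c] by linarith
    qed auto
    then show "\<exists>N. \<forall>n\<ge>N. norm (oscillation \<psi> n - 0) < e" using nonneg e by (intro exI[of _ N]) fastforce
  qed
qed

definition birkhoff :: "'a observable \<Rightarrow> nat \<Rightarrow> (nat \<Rightarrow> 'a) \<Rightarrow> real" where
  "birkhoff \<psi> n x = (\<Sum>j<n. \<psi> ((shift_map ^^ j) x))"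

abbreviation cyclic_sum :: "'a observable \<Rightarrow> nat \<Rightarrow> 'a list \<Rightarrow> real" where
  "cyclic_sum \<psi> n w \<equiv> birkhoff \<psi> n (periodic_extension w)"

text \<open>
After \<open>j\<close> shifts, two sequences with \<open>n\<close> common initial letters still have \<open>n - j\<close> of them in common;
summing the oscillations gives a bound for the difference of their Birkhoff sums.
\<close>

definition distortion :: "'a observable \<Rightarrow> nat \<Rightarrow> real" where
  "distortion \<psi> n = (\<Sum>j<n. oscillation \<psi> (Suc j))"

lemma birkhoff_distortion:
  fixes \<psi> :: "'a::{finite,discrete_topology} observable"
  assumes "continuous_on UNIV \<psi>" "initial n x = initial n y"
  shows "\<bar>birkhoff \<psi> n x - birkhoff \<psi> n y\<bar> \<le> distortion \<psi> n"
proof -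
  have "\<bar>birkhoff \<psi> n x - birkhoff \<psi> n y\<bar> \<le> (\<Sum>j<n. \<bar>\<psi> ((shift_map ^^ j) x) - \<psi> ((shift_map ^^ j) y)\<bar>)"
    unfolding birkhoff_def sum_subtractf[symmetric] by (rule sum_abs)
  also have "\<dots> \<le> (\<Sum>j<n. oscillation \<psi> (Suc (n - Suc j)))"
    using assms(2) by (intro sum_mono oscillation(1)[OF assms(1)]) (auto simp: initial_eq_iff funpow_shift)
  also have "\<dots> = distortion \<psi> n"
    unfolding distortion_def by (rule sum.nat_diff_reindex)
  finally show ?thesis .
qed

lemma distortion_tendsto:
  fixes \<psi> :: "'a::{finite,discrete_topology} observable"
  assumes "continuous_on UNIV \<psi>"
  shows "(\<lambda>n. distortion \<psi> n / real n) \<longlonglongrightarrow> 0"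
  unfolding distortion_def by (intro Cesaro_mean LIMSEQ_Suc oscillation(3) assms)

section \<open>Integrals\<close>

lemma integrable_continuous:
  fixes \<psi> :: "'a::{finite,discrete_topology} observable"
  assumes "continuous_on UNIV \<psi>" "prob_space \<nu>" "sets \<nu> = sets borel"
  shows "integrable \<nu> \<psi>"
proof -
  interpret prob_space \<nu> by fact
  obtain B where B: "\<And>x. \<bar>\<psi> x\<bar> \<le> B" using continuous_bounded[OF assms(1)] by blast
  show ?thesis
    using B borel_measurable_continuous_onI[OF assms(1)] assms(3)
    by (intro integrable_const_bound[of _ B]) (auto cong: measurable_cong_sets)
qed

lemma integral_initial:
  fixes \<nu> :: "'a::{finite,discrete_topology} process" and c :: "'a list \<Rightarrow> real"
  assumes "prob_space \<nu>" "sets \<nu> = sets borel"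
  shows "integrable \<nu> (\<lambda>x. c (initial k x))"
    and "(\<integral>x. c (initial k x) \<partial>\<nu>) = (\<Sum>a\<in>words k. weights \<nu> a * c a)"
proof -
  interpret prob_space \<nu> by fact
  have sp: "space \<nu> = UNIV" using sets_eq_imp_space_eq[OF assms(2)] by simp
  have eq: "c (initial k x) = (\<Sum>a\<in>words k. indicator (cylinder a) x * c a)" for x
  proof -
    have "(\<Sum>a\<in>words k. indicator (cylinder a) x * c a) = (\<Sum>a\<in>words k. if a = initial k x then c a else 0)"
      by (intro sum.cong refl) (auto simp: mem_cylinder words_def indicator_def)
    then show ?thesis by simp
  qed
  have int: "integrable \<nu> (\<lambda>x. indicator (cylinder a) x * c a)" for a
    using assms(2) by (intro integrable_mult_left integrable_real_indicator) (auto simp: emeasure_eq_measure)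
  show "integrable \<nu> (\<lambda>x. c (initial k x))" unfolding eq by (intro Bochner_Integration.integrable_sum int)
  show "(\<integral>x. c (initial k x) \<partial>\<nu>) = (\<Sum>a\<in>words k. weights \<nu> a * c a)"
    unfolding eq by (subst Bochner_Integration.integral_sum[OF int]) (simp add: sp)
qed

lemma integral_cylinder_approximation:
  fixes \<nu> :: "'a::{finite,discrete_topology} process"
  assumes "prob_space \<nu>" "sets \<nu> = sets borel" "integrable \<nu> f"
    and "\<And>x. \<bar>f x - c (initial k x)\<bar> \<le> d"
  shows "\<bar>(\<integral>x. f x \<partial>\<nu>) - (\<Sum>a\<in>words k. weights \<nu> a * c a)\<bar> \<le> d"
proof -
  interpret prob_space \<nu> by fact
  note i = integral_initial[OF assms(1,2), of c k]
  have "\<bar>(\<integral>x. f x \<partial>\<nu>) - (\<Sum>a\<in>words k. weights \<nu> a * c a)\<bar> = \<bar>\<integral>x. f x - c (initial k x) \<partial>\<nu>\<bar>"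
    using i assms(3) by simp
  also have "\<dots> \<le> (\<integral>x. \<bar>f x - c (initial k x)\<bar> \<partial>\<nu>)" by (rule integral_abs_bound)
  also have "\<dots> \<le> (\<integral>x. d \<partial>\<nu>)"
    using i(1) assms(3,4) by (intro integral_mono) auto
  also have "\<dots> = d" by (simp add: prob_space)
  finally show ?thesis .
qed

lemma continuous_shift_funpow:
  fixes \<psi> :: "'a::{finite,discrete_topology} observable"
  assumes "continuous_on UNIV \<psi>"
  shows "continuous_on UNIV (\<lambda>x. \<psi> ((shift_map ^^ j) x))"
proof -
  have "continuous_on UNIV (\<lambda>x :: nat \<Rightarrow> 'a. (shift_map ^^ j) x)"
    unfolding funpow_shift
    by (intro continuous_on_coordinatewise_then_product continuous_on_product_coordinates)
  then show ?thesis using assms continuous_on_compose2 by blast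
qed

lemma integral_shift:
  fixes \<psi> :: "'a::{finite,discrete_topology} observable"
  assumes "\<nu> \<in> \<M>" "continuous_on UNIV \<psi>"
  shows "(\<integral>x. \<psi> ((shift_map ^^ j) x) \<partial>\<nu>) = mean \<nu> \<psi>"
proof (induction j)
  case (Suc j)
  note * = invariantD[OF assms(1)]
  have "(\<integral>x. \<psi> ((shift_map ^^ j) x) \<partial>\<nu>) = (\<integral>x. \<psi> ((shift_map ^^ j) x) \<partial>distr \<nu> borel shift_map)"
    by (simp add: *(3))
  also have "\<dots> = (\<integral>x. \<psi> ((shift_map ^^ j) (shift_map x)) \<partial>\<nu>)"
    using borel_measurable_continuous_onI[OF continuous_shift_funpow[OF assms(2)]] *(2)
    by (intro integral_distr) (auto cong: measurable_cong_sets)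
  finally show ?case using Suc by (simp add: funpow_swap1)
qed simp

lemma continuous_birkhoff:
  fixes \<psi> :: "'a::{finite,discrete_topology} observable"
  assumes "continuous_on UNIV \<psi>"
  shows "continuous_on UNIV (birkhoff \<psi> n)"
  unfolding birkhoff_def by (intro continuous_on_sum continuous_shift_funpow assms)

lemma integral_birkhoff:
  fixes \<psi> :: "'a::{finite,discrete_topology} observable"
  assumes "\<nu> \<in> \<M>" "continuous_on UNIV \<psi>"
  shows "(\<integral>x. birkhoff \<psi> n x \<partial>\<nu>) = real n * mean \<nu> \<psi>"
  unfolding birkhoff_def
  using invariantD[OF assms(1)] assms
  by (subst Bochner_Integration.integral_sum)
     (auto intro!: integrable_continuous continuous_shift_funpow simp: integral_shift)

section \<open>The variational principle\<close>

abbreviation h :: "'a::{finite,discrete_topology} process \<Rightarrow> real" where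
  "h \<equiv> ks_entropy"

lemma ks_entropy_eq: "h \<nu> = entropy_rate (weights \<nu>)"
  by (simp add: ks_entropy_def entropy_rate_def)

definition cylinder_sup :: "'a observable \<Rightarrow> nat \<Rightarrow> 'a list \<Rightarrow> real" where
  "cylinder_sup \<psi> n a = (SUP b\<in>cylinder a. birkhoff \<psi> n b)"

definition partition_sum :: "((nat \<Rightarrow> 'a::finite) \<Rightarrow> real) \<Rightarrow> nat \<Rightarrow> real" where
  "partition_sum \<psi> n = (\<Sum>a\<in>words n. exp (cylinder_sup \<psi> n a))"

lemma top_pressure_eq: "top_pressure \<psi> = lim (\<lambda>n. ln (partition_sum \<psi> n) / real n)"
  by (simp add: top_pressure_def partition_sum_def cylinder_sup_def birkhoff_def)

lemma partition_sum_pos: "0 < partition_sum \<psi> n"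
  unfolding partition_sum_def by (intro sum_pos) auto

definition periodic_sum :: "((nat \<Rightarrow> 'a::finite) \<Rightarrow> real) \<Rightarrow> nat \<Rightarrow> real" where
  "periodic_sum \<psi> n = (\<Sum>w\<in>words n. exp (cyclic_sum \<psi> n w))"

lemma periodic_sum_pos: "0 < periodic_sum \<psi> n"
  unfolding periodic_sum_def by (intro sum_pos) auto

lemma initial_periodic_initial [simp]: "initial k (periodic_extension (initial k x)) = initial k x"
  using initial_periodic_extension[of "initial k x"] by simp

lemma integral_words_approximation:
  assumes "continuous_on UNIV \<psi>" "\<nu> \<in> \<M>"
  shows "\<bar>mean \<nu> \<psi> - (\<Sum>a\<in>words k. weights \<nu> a * \<psi> (periodic_extension a))\<bar> \<le> oscillation \<psi> k"
  using invariantD[OF assms(2)]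
  by (intro integral_cylinder_approximation integrable_continuous oscillation(1) assms(1)) auto

text \<open>
The cylinder probabilities live in a compact product of unit intervals, and pointwise limits of
stationary families are stationary; the limit is the family of an invariant measure by
\<open>invariant_measure_exists\<close>.
\<close>

lemma invariant_measures_compact:
  fixes \<nu> :: "nat \<Rightarrow> 'a::{finite,discrete_topology} process"
  assumes "\<And>n. \<nu> n \<in> \<M>"
  shows "\<exists>r \<mu>. strict_mono (r :: nat \<Rightarrow> nat) \<and> \<mu> \<in> \<M> \<and>
    (\<forall>a. (\<lambda>n. weights (\<nu> (r n)) a) \<longlonglongrightarrow> weights \<mu> a) \<and>
    (\<forall>\<psi> :: (nat \<Rightarrow> 'a) \<Rightarrow> real. continuous_on UNIV \<psi> \<longrightarrow>
       (\<lambda>n. mean (\<nu> (r n)) \<psi>) \<longlonglongrightarrow> mean \<mu> \<psi>)"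
proof -
  have "compact (PiE UNIV (\<lambda>_ :: 'a list. {0..1 :: real}))"
    using compactin_PiE[of "\<lambda>_. euclidean" UNIV "\<lambda>_ :: 'a list. {0..1 :: real}"]
    by (simp add: euclidean_product_topology)
  then have "seq_compact (PiE UNIV (\<lambda>_ :: 'a list. {0..1 :: real}))"
    by (rule compact_imp_seq_compact)
  moreover have "weights (\<nu> n) \<in> PiE UNIV (\<lambda>_. {0..1})" for n
    using stationaryD(1)[OF stationary_weights[OF assms]] stationary_le_1[OF stationary_weights[OF assms]] by auto
  ultimately obtain p r where r: "strict_mono (r :: nat \<Rightarrow> nat)" "(\<lambda>n. weights (\<nu> (r n))) \<longlonglongrightarrow> p"
    unfolding seq_compact_def comp_def by meson
  have lim: "(\<lambda>n. weights (\<nu> (r n)) a) \<longlonglongrightarrow> p a" for a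
    using continuous_on_tendsto_compose[OF continuous_on_product_coordinates r(2), of a] by simp
  note st = stationary_weights[OF assms]
  have "stationary p"
    unfolding stationary_def
  proof (intro conjI allI)
    show "0 \<le> p a" for a by (rule LIMSEQ_le_const[OF lim]) auto
    show "p [] = 1" using LIMSEQ_unique[OF lim[of "[]"], of 1] by (simp add: stationaryD(2)[OF st] del: cylinder_Nil)
    have "(\<lambda>n. \<Sum>b\<in>UNIV. weights (\<nu> (r n)) (a @ [b])) \<longlonglongrightarrow> (\<Sum>b\<in>UNIV. p (a @ [b]))" for a
      by (intro tendsto_sum lim)
    then show "(\<Sum>b\<in>UNIV. p (a @ [b])) = p a" for a
      unfolding stationaryD(3)[OF st] using lim[of a] LIMSEQ_unique by blast
    have "(\<lambda>n. \<Sum>b\<in>UNIV. weights (\<nu> (r n)) (b # a)) \<longlonglongrightarrow> (\<Sum>b\<in>UNIV. p (b # a))" for a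
      by (intro tendsto_sum lim)
    then show "(\<Sum>b\<in>UNIV. p (b # a)) = p a" for a
      unfolding stationaryD(4)[OF st] using lim[of a] LIMSEQ_unique by blast
  qed
  then obtain \<mu> where \<mu>: "\<mu> \<in> \<M>" "\<And>a. weights \<mu> a = p a"
    using invariant_measure_exists[of p] by auto
  have "(\<lambda>n. mean (\<nu> (r n)) \<psi>) \<longlonglongrightarrow> mean \<mu> \<psi>" if \<psi>: "continuous_on UNIV \<psi>"
    for \<psi> :: "'a observable"
  proof (rule LIMSEQ_I)
    fix e :: real assume e: "0 < e"
    obtain k where "norm (oscillation \<psi> k - 0) < e / 4"
      using LIMSEQ_D[OF oscillation(3)[OF \<psi>], of "e / 4"] e by auto
    then have k: "oscillation \<psi> k < e / 4" by simp
    let ?s = "\<lambda>\<nu>. \<Sum>a\<in>words k. weights \<nu> a * \<psi> (periodic_extension a)"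
    note approx = integral_words_approximation[OF \<psi>]
    have s: "(\<lambda>n. ?s (\<nu> (r n))) \<longlonglongrightarrow> ?s \<mu>"
      unfolding \<mu>(2) by (intro tendsto_intros lim)
    then obtain N where N: "\<And>n. n \<ge> N \<Longrightarrow> \<bar>?s (\<nu> (r n)) - ?s \<mu>\<bar> < e / 4"
      using LIMSEQ_D[OF s, of "e / 4"] e by auto
    show "\<exists>N. \<forall>n\<ge>N. norm (mean (\<nu> (r n)) \<psi> - mean \<mu> \<psi>) < e"
    proof (intro exI allI impI)
      fix n assume "N \<le> n"
      show "norm (mean (\<nu> (r n)) \<psi> - mean \<mu> \<psi>) < e"
        using N[OF \<open>N \<le> n\<close>] approx[OF assms, of "r n" k] approx[OF \<mu>(1), of k] k
        unfolding real_norm_def by linarith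
    qed
  qed
  then show ?thesis using r(1) \<mu> lim by (intro exI[of _ r] exI[of _ \<mu>]) simp
qed

lemma block_entropy_tendsto:
  assumes "\<And>a. (\<lambda>n. p n a) \<longlonglongrightarrow> q a" "\<And>n a. 0 \<le> p n a"
  shows "(\<lambda>n. H k (p n)) \<longlonglongrightarrow> H k q"
proof -
  have "continuous_on {0..} (\<lambda>x :: real. x * ln x)"
  proof (rule continuous_on_eq_continuous_within[THEN iffD2], rule ballI)
    fix x :: real assume "x \<in> {0..}"
    show "continuous (at x within {0..}) (\<lambda>x. x * ln x)"
    proof (cases "x = 0")
      case True
      have "((\<lambda>x :: real. x * ln x) \<longlongrightarrow> 0) (at_right 0)" by real_asymp
      moreover have "at (0::real) within {0..} = at_right 0"
        by (simp add: at_within_Ici_at_right)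
      ultimately show ?thesis using True by (simp add: continuous_within)
    next
      case False
      then show ?thesis by (intro continuous_intros) auto
    qed
  qed
  then have "(\<lambda>n. p n a * ln (p n a)) \<longlonglongrightarrow> q a * ln (q a)" for a
    using assms LIMSEQ_le_const[OF assms(1), of 0 a]
    by (intro continuous_on_tendsto_compose[of "{0..}" "\<lambda>x. x * ln x", OF _ assms(1)]) auto
  then show ?thesis unfolding block_entropy_def by (intro tendsto_minus tendsto_sum)
qed

lemma kraft_cost_fixed: "(\<lambda>n. kraft_cost TYPE('a::finite) n k / real n) \<longlonglongrightarrow> 0"
  unfolding kraft_cost_def by real_asymp

context
  fixes \<psi> :: "'a::{finite,discrete_topology} observable"
  assumes cont: "continuous_on UNIV \<psi>"
begin

text \<open>
On a cylinder the supremum may be replaced by the value at any of its points, at the cost of the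
distortion, which is \<open>o(n)\<close>.
\<close>

lemma cylinder_sup_bounds:
  assumes "a \<in> words n" "x \<in> cylinder a"
  shows "birkhoff \<psi> n x \<le> cylinder_sup \<psi> n a" "cylinder_sup \<psi> n a \<le> birkhoff \<psi> n x + distortion \<psi> n"
proof -
  have d: "birkhoff \<psi> n y \<le> birkhoff \<psi> n x + distortion \<psi> n" if "y \<in> cylinder a" for y
    using birkhoff_distortion[OF cont, of n x y] assms that by (auto simp: mem_cylinder words_def)
  then have "bdd_above (birkhoff \<psi> n ` cylinder a)" by (intro bdd_aboveI2)
  then show "birkhoff \<psi> n x \<le> cylinder_sup \<psi> n a"
    unfolding cylinder_sup_def using assms(2) by (intro cSUP_upper)
  show "cylinder_sup \<psi> n a \<le> birkhoff \<psi> n x + distortion \<psi> n"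
    unfolding cylinder_sup_def using assms(2) d by (intro cSUP_least) auto
qed

lemma periodic_sum_bounds:
  shows "ln (periodic_sum \<psi> n) \<le> ln (partition_sum \<psi> n)"
    and "ln (partition_sum \<psi> n) \<le> ln (periodic_sum \<psi> n) + distortion \<psi> n"
proof -
  have "periodic_sum \<psi> n \<le> partition_sum \<psi> n"
    unfolding periodic_sum_def partition_sum_def
    by (intro sum_mono) (simp add: cylinder_sup_bounds(1) periodic_extension_in_cylinder)
  then show "ln (periodic_sum \<psi> n) \<le> ln (partition_sum \<psi> n)"
    using periodic_sum_pos by (intro ln_mono) auto
  have "partition_sum \<psi> n \<le> exp (distortion \<psi> n) * periodic_sum \<psi> n"
    unfolding periodic_sum_def partition_sum_def sum_distrib_left exp_add[symmetric]
    using cylinder_sup_bounds(2)[OF _ periodic_extension_in_cylinder]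
    by (intro sum_mono) (simp add: add.commute)
  then have "ln (partition_sum \<psi> n) \<le> ln (exp (distortion \<psi> n) * periodic_sum \<psi> n)"
    using partition_sum_pos by (intro ln_mono) auto
  also have "\<dots> = ln (periodic_sum \<psi> n) + distortion \<psi> n"
    using periodic_sum_pos[of \<psi> n] by (simp add: ln_mult)
  finally show "ln (partition_sum \<psi> n) \<le> ln (periodic_sum \<psi> n) + distortion \<psi> n" .
qed

text \<open>
Gibbs' inequality on words of length \<open>k\<close>, after replacing \<open>k \<integral>\<psi> d\<nu> = \<integral>S\<^sub>k \<psi> d\<nu>\<close> by the suprema over
cylinders. Letting \<open>k\<close> tend to infinity this is the upper bound in the variational principle; for
periodic orbit measures it is the upper bound for the empirical entropy of a single word.
\<close>

lemma block_entropy_plus_integral_le: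
  assumes "\<nu> \<in> \<M>" "1 \<le> k"
  shows "H k (weights \<nu>) / real k + mean \<nu> \<psi> \<le> ln (partition_sum \<psi> k) / real k"
proof -
  note inv = invariantD[OF assms(1)]
  interpret prob_space \<nu> by (rule inv(1))
  have "real k * mean \<nu> \<psi> = (\<integral>x. birkhoff \<psi> k x \<partial>\<nu>)"
    by (simp add: integral_birkhoff[OF assms(1) cont])
  also have "\<dots> \<le> (\<integral>x. cylinder_sup \<psi> k (initial k x) \<partial>\<nu>)"
    using integral_initial(1)[OF inv(1,2)] integrable_continuous[OF continuous_birkhoff[OF cont] inv(1,2)]
    by (intro integral_mono cylinder_sup_bounds(1)) (auto simp: mem_cylinder)
  also have "\<dots> = (\<Sum>a\<in>words k. weights \<nu> a * cylinder_sup \<psi> k a)"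
    by (rule integral_initial(2)[OF inv(1,2)])
  finally have "H k (weights \<nu>) + real k * mean \<nu> \<psi>
      \<le> (\<Sum>a\<in>words k. weights \<nu> a * (cylinder_sup \<psi> k a - ln (weights \<nu> a)))"
    by (simp add: block_entropy_def right_diff_distrib sum_subtractf)
  also have "\<dots> \<le> ln (partition_sum \<psi> k)"
    unfolding partition_sum_def using stationary_sum_words[OF stationary_weights[OF assms(1)]]
    by (intro variational_log_sum_exp) auto
  finally have "(H k (weights \<nu>) + real k * mean \<nu> \<psi>) / real k \<le> ln (partition_sum \<psi> k) / real k"
    by (rule divide_right_mono) simp
  then show ?thesis using assms(2) by (simp add: add_divide_distrib)
qed

text \<open>
Integrals of continuous functions are limits of linear expressions in the cylinder probabilities, so
that it is enough to know the mixture on cylinders.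
\<close>

lemma integral_mixture:
  assumes "\<mu> \<in> \<M>" "finite I"
    and "\<And>i. i \<in> I \<Longrightarrow> \<nu> i \<in> \<M>" "\<And>i. i \<in> I \<Longrightarrow> 0 \<le> c i" "sum c I = 1"
    and "\<And>a. weights \<mu> a = (\<Sum>i\<in>I. c i * weights (\<nu> i) a)"
  shows "mean \<mu> \<psi> = (\<Sum>i\<in>I. c i * mean (\<nu> i) \<psi>)"
proof -
  note approx = integral_words_approximation[OF cont]
  have "\<bar>mean \<mu> \<psi> - (\<Sum>i\<in>I. c i * mean (\<nu> i) \<psi>)\<bar> \<le> 2 * oscillation \<psi> k" for k
  proof -
    let ?s = "\<lambda>\<nu>. \<Sum>a\<in>words k. weights \<nu> a * \<psi> (periodic_extension a)"
    have "?s \<mu> = (\<Sum>a\<in>words k. \<Sum>i\<in>I. c i * (weights (\<nu> i) a * \<psi> (periodic_extension a)))"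
      by (simp add: assms(6) sum_distrib_right mult.assoc)
    also have "\<dots> = (\<Sum>i\<in>I. c i * ?s (\<nu> i))"
      by (subst sum.swap) (simp add: sum_distrib_left)
    finally have "\<bar>?s \<mu> - (\<Sum>i\<in>I. c i * mean (\<nu> i) \<psi>)\<bar> = \<bar>\<Sum>i\<in>I. c i * (?s (\<nu> i) - mean (\<nu> i) \<psi>)\<bar>"
      by (simp add: right_diff_distrib sum_subtractf)
    also have "\<dots> \<le> (\<Sum>i\<in>I. c i * oscillation \<psi> k)"
      using assms(3,4) approx[of "\<nu> _"]
      by (intro order_trans[OF sum_abs] sum_mono) (auto simp: abs_mult abs_minus_commute intro!: mult_left_mono)
    also have "\<dots> = oscillation \<psi> k" using assms(5) by (simp flip: sum_distrib_right)
    finally show ?thesis using approx[OF assms(1), of k] by linarith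
  qed
  then have "\<bar>mean \<mu> \<psi> - (\<Sum>i\<in>I. c i * mean (\<nu> i) \<psi>)\<bar> \<le> 2 * 0"
    by (intro LIMSEQ_le_const[OF tendsto_mult_left[OF oscillation(3)[OF cont]]]) auto
  then show ?thesis by simp
qed

text \<open>
The mixture of periodic orbit measures with the Gibbs weights \<open>q\<close> of their Birkhoff sums. The
logarithm of \<open>periodic_sum\<close> is \<open>H(q)\<close> plus the \<open>q\<close>-mean of \<open>S\<^sub>n \<psi>\<close>. Although each periodic orbit has
zero entropy, the Kraft inequality shows that on average its empirical conditional entropies are
at least \<open>H(q) / n\<close> up to \<open>o(1)\<close>, and by concavity so are the block entropies of the mixture.
\<close>

lemma periodic_mixture:
  assumes n1: "1 \<le> n"
  shows "\<exists>\<nu>\<in>\<M>. \<forall>k\<ge>1. ln (periodic_sum \<psi> n) / real n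
     \<le> mean \<nu> \<psi> + H k (weights \<nu>) / real k + kraft_cost TYPE('a) n k / real n"
proof -
  let ?K = "kraft_cost TYPE('a) n"
  define S where "S w = cyclic_sum \<psi> n w" for w :: "'a list"
  define q where "q = (\<lambda>w. exp (S w) / (\<Sum>w\<in>words n. exp (S w)))"
  note q = log_sum_exp_attained[OF finite_words words_nonempty q_def]
  have ne: "w \<noteq> []" "length w = n" if "w \<in> words n" for w :: "'a list"
    using that n1 by (auto simp: words_def)
  have st: "stationary (empirical_weights w)" if "w \<in> words n" for w :: "'a list"
    using stationary_empirical ne that by blast
  obtain \<nu> where \<nu>: "\<nu> \<in> \<M>" "\<And>a. weights \<nu> a = (\<Sum>w\<in>words n. q w * empirical_weights w a)"
    using invariant_measure_exists[OF stationary_mixture[of "words n" q empirical_weights]] q(1,2) st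
    by (auto intro: less_imp_le)
  have mix: "weights \<nu> a = (\<Sum>w\<in>words n. q w * weights (periodic_measure w) a)" for a
    unfolding \<nu>(2) using ne by (intro sum.cong refl) (simp add: weights_periodic_measure)
  have int: "mean \<nu> \<psi> = (\<Sum>w\<in>words n. q w * (S w / real n))"
  proof -
    have "mean \<nu> \<psi> = (\<Sum>w\<in>words n. q w * mean (periodic_measure w) \<psi>)"
      using ne q(1,2)
      by (intro integral_mixture \<nu>(1) mix) (auto intro: less_imp_le periodic_measure_invariant)
    also have "\<dots> = (\<Sum>w\<in>words n. q w * (S w / real n))"
      using ne borel_measurable_continuous_onI[OF cont]
      by (intro sum.cong refl) (simp add: integral_periodic_measure S_def birkhoff_def)
    finally show ?thesis .
  qed
  have "ln (periodic_sum \<psi> n) / real n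
      \<le> mean \<nu> \<psi> + H k (weights \<nu>) / real k + ?K k / real n"
    if k: "1 \<le> k" for k
  proof -
    let ?h = "\<lambda>w :: 'a list. cyclic_h k w"
    have n: "0 < real n" using n1 by simp
    have "(\<Sum>w\<in>words n. q w * ?h w) \<le> (\<Sum>w\<in>words n. q w * (cyclic_H k w / real k))"
      using q(1) st k by (intro sum_mono mult_left_mono conditional_entropy_le) (auto intro: less_imp_le)
    also have "\<dots> = (\<Sum>w\<in>words n. q w * cyclic_H k w) / real k"
      by (simp add: sum_divide_distrib)
    also have "\<dots> \<le> H k (\<lambda>a. \<Sum>w\<in>words n. q w * empirical_weights w a) / real k"
      using q(1,2) st by (intro divide_right_mono block_entropy_concave) (auto intro: less_imp_le)
    also have "\<dots> = H k (weights \<nu>) / real k"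
      using \<nu>(2) by presburger
    finally have ent: "(\<Sum>w\<in>words n. q w * ?h w) \<le> H k (weights \<nu>) / real k" .
    have "(\<Sum>w\<in>words n. q w * (- real n * ?h w - ln (q w))) \<le> ln (\<Sum>w\<in>words n. exp (- real n * ?h w))"
      using q(1,2) by (intro variational_log_sum_exp) (auto intro: less_imp_le)
    also have "\<dots> \<le> ?K k"
      by (rule kraft_empirical[OF n1 k])
    finally have "- (\<Sum>w\<in>words n. q w * ln (q w)) \<le> real n * (\<Sum>w\<in>words n. q w * ?h w) + ?K k"
      by (simp add: right_diff_distrib sum_subtractf sum_distrib_left sum_negf mult.left_commute)
    also have "\<dots> \<le> real n * (H k (weights \<nu>) / real k) + ?K k"
      using ent n by (intro add_right_mono mult_left_mono) auto
    finally have ent2: "- (\<Sum>w\<in>words n. q w * ln (q w))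
        \<le> real n * (H k (weights \<nu>) / real k) + ?K k" .
    have "ln (periodic_sum \<psi> n) = (\<Sum>w\<in>words n. q w * (S w - ln (q w)))"
      using q(3) by (simp add: periodic_sum_def S_def)
    also have "\<dots> = real n * mean \<nu> \<psi> - (\<Sum>w\<in>words n. q w * ln (q w))"
      using n by (simp add: int right_diff_distrib sum_subtractf sum_distrib_left)
    also have "\<dots> \<le> real n * (mean \<nu> \<psi> + H k (weights \<nu>) / real k) + ?K k"
      using ent2 by (simp add: distrib_left)
    finally have "ln (periodic_sum \<psi> n) / real n \<le>
       (real n * (mean \<nu> \<psi> + H k (weights \<nu>) / real k) + ?K k) / real n"
      by (rule divide_right_mono) simp
    then show ?thesis using n by (simp add: add_divide_distrib)
  qed
  then show ?thesis using \<nu>(1) by blast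
qed

text \<open>
A cluster point of the measures from \<open>periodic_mixture\<close>: for each fixed \<open>k\<close> the inequality there
passes to the limit, and then \<open>k\<close> tends to infinity.
\<close>

lemma equilibrium_along_subsequence:
  fixes r :: "nat \<Rightarrow> nat"
  assumes "strict_mono r" "\<And>j. c \<le> ln (partition_sum \<psi> (r j)) / real (r j)"
  shows "\<exists>\<mu>\<in>\<M>. c \<le> h \<mu> + mean \<mu> \<psi>"
proof -
  \<comment> \<open>Skipping \<open>r 0\<close> keeps the word lengths positive.\<close>
  define m where "m j = r (Suc j)" for j
  have m1: "1 \<le> m j" for j
    using strict_monoD[OF assms(1), of 0 "Suc j"] by (simp add: m_def)
  have m: "strict_mono m" using assms(1) by (auto simp: m_def strict_mono_def)
  obtain \<nu> where \<nu>: "\<And>j. \<nu> j \<in> \<M>"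
    "\<And>j k. 1 \<le> k \<Longrightarrow> ln (periodic_sum \<psi> (m j)) / real (m j)
       \<le> mean (\<nu> j) \<psi> + H k (weights (\<nu> j)) / real k + kraft_cost TYPE('a) (m j) k / real (m j)"
    using periodic_mixture[OF m1] by metis
  obtain s \<mu> where s: "strict_mono s" and \<mu>: "\<mu> \<in> \<M>"
    and w: "\<And>a. (\<lambda>n. weights (\<nu> (s n)) a) \<longlonglongrightarrow> weights \<mu> a"
    and i: "(\<lambda>n. mean (\<nu> (s n)) \<psi>) \<longlonglongrightarrow> mean \<mu> \<psi>"
    using invariant_measures_compact[of \<nu>, OF \<nu>(1)] cont by blast
  have ms: "filterlim (\<lambda>j. m (s j)) at_top sequentially"
    using filterlim_compose[OF filterlim_subseq[OF m] filterlim_subseq[OF s]] .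
  have "c \<le> mean \<mu> \<psi> + H k (weights \<mu>) / real k" if k: "1 \<le> k" for k
  proof -
    let ?m = "\<lambda>j. m (s j)"
    have lim: "(\<lambda>j. mean (\<nu> (s j)) \<psi> + H k (weights (\<nu> (s j))) / real k
        + kraft_cost TYPE('a) (?m j) k / real (?m j) + distortion \<psi> (?m j) / real (?m j))
      \<longlonglongrightarrow> mean \<mu> \<psi> + H k (weights \<mu>) / real k + 0 + 0"
    proof (intro tendsto_add i)
      show "(\<lambda>j. H k (weights (\<nu> (s j))) / real k) \<longlonglongrightarrow> H k (weights \<mu>) / real k"
        using k by (intro tendsto_divide tendsto_const block_entropy_tendsto w) auto
      show "(\<lambda>j. kraft_cost TYPE('a) (?m j) k / real (?m j)) \<longlonglongrightarrow> 0"
        by (rule filterlim_compose[OF kraft_cost_fixed ms])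
      show "(\<lambda>j. distortion \<psi> (?m j) / real (?m j)) \<longlonglongrightarrow> 0"
        by (rule filterlim_compose[OF distortion_tendsto[OF cont] ms])
    qed
    have "c \<le> mean (\<nu> (s j)) \<psi> + H k (weights (\<nu> (s j))) / real k
        + kraft_cost TYPE('a) (?m j) k / real (?m j) + distortion \<psi> (?m j) / real (?m j)" for j
    proof -
      have "c \<le> ln (partition_sum \<psi> (?m j)) / real (?m j)" unfolding m_def by (rule assms(2))
      also have "\<dots> \<le> (ln (periodic_sum \<psi> (?m j)) + distortion \<psi> (?m j)) / real (?m j)"
        by (intro divide_right_mono periodic_sum_bounds) auto
      finally show ?thesis using \<nu>(2)[OF k, of "s j"] by (simp add: add_divide_distrib)
    qed
    then show ?thesis using LIMSEQ_le_const[OF lim] by auto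
  qed
  then have "c \<le> mean \<mu> \<psi> + entropy_rate (weights \<mu>)"
    by (intro LIMSEQ_le_const[OF tendsto_add[OF tendsto_const
          entropy_increments_tendsto(2)[OF stationary_weights[OF \<mu>]]]]) auto
  then show ?thesis using \<mu> by (auto simp: ks_entropy_eq add.commute)
qed

text \<open>
The normalised partition sums are bounded below by the supremum \<open>P\<close>. If they exceeded
\<open>P + e\<close> infinitely often, \<open>equilibrium_along_subsequence\<close> would produce a measure that beats \<open>P\<close>. In this
way existence of the limit, its value and the existence of an equilibrium state come together.
\<close>

theorem variational_principle:
  shows "(\<lambda>n. ln (partition_sum \<psi> n) / real n) \<longlonglongrightarrow> top_pressure \<psi>"
    and "\<And>\<nu>. \<nu> \<in> \<M> \<Longrightarrow> h \<nu> + mean \<nu> \<psi> \<le> top_pressure \<psi>"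
    and "\<exists>\<mu>\<in>\<M>. h \<mu> + mean \<mu> \<psi> = top_pressure \<psi>"
proof -
  let ?b = "\<lambda>n. ln (partition_sum \<psi> n) / real n"
  let ?v = "\<lambda>\<nu>. h \<nu> + mean \<nu> \<psi>"
  define P where "P = (SUP \<nu>\<in>\<M>. ?v \<nu>)"
  have le: "?v \<nu> \<le> ?b n" if "\<nu> \<in> \<M>" "1 \<le> n" for \<nu> n
    using block_entropy_plus_integral_le[OF that]
      entropy_rate_le[OF stationary_weights[OF that(1)] that(2)] by (simp add: ks_entropy_eq)
  have bdd: "bdd_above (?v ` \<M>)"
    using le[of _ 1] by (intro bdd_aboveI2) auto
  have ne: "\<M> \<noteq> ({} :: 'a process set)"
    using periodic_measure_invariant[of "[undefined]"] by blast
  have Pge: "?v \<nu> \<le> P" if "\<nu> \<in> \<M>" for \<nu>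
    unfolding P_def by (rule cSUP_upper[OF that bdd])
  have Ple: "P \<le> ?b n" if "1 \<le> n" for n
    unfolding P_def using le that by (intro cSUP_least ne) auto
  have lim: "?b \<longlonglongrightarrow> P"
  proof (rule LIMSEQ_I, rule ccontr)
    fix e :: real assume e: "0 < e" and no: "\<not> (\<exists>N. \<forall>n\<ge>N. norm (?b n - P) < e)"
    have "\<exists>n>m. P + e \<le> ?b n" for m
    proof -
      obtain n where "n \<ge> Suc m" "\<not> norm (?b n - P) < e" using no by blast
      then show ?thesis using Ple[of n] by (intro exI[of _ n]) auto
    qed
    then have "infinite {n. P + e \<le> ?b n}" unfolding infinite_nat_iff_unbounded by auto
    then obtain r :: "nat \<Rightarrow> nat" where "strict_mono r" "\<And>j. r j \<in> {n. P + e \<le> ?b n}"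
      using infinite_enumerate by metis
    then obtain \<mu> where "\<mu> \<in> \<M>" "P + e \<le> ?v \<mu>"
      using equilibrium_along_subsequence[of r "P + e"] by auto
    then show False using Pge e by fastforce
  qed
  then have top: "top_pressure \<psi> = P" unfolding top_pressure_eq by (rule limI)
  show "?b \<longlonglongrightarrow> top_pressure \<psi>" "\<And>\<nu>. \<nu> \<in> \<M> \<Longrightarrow> ?v \<nu> \<le> top_pressure \<psi>"
    using lim Pge top by auto
  have "\<exists>\<mu>\<in>\<M>. P \<le> ?v \<mu>"
    by (rule equilibrium_along_subsequence[of Suc])
       (auto simp: strict_mono_Suc_iff Ple simp del: of_nat_Suc)
  then obtain \<mu> where "\<mu> \<in> \<M>" "P \<le> ?v \<mu>" by blast
  then show "\<exists>\<mu>\<in>\<M>. ?v \<mu> = top_pressure \<psi>"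
    using Pge top by (intro bexI[of _ \<mu>]) (auto intro: antisym)
qed

end

section \<open>The Gibbs property of a \<open>g\<close>-measure\<close>

text \<open>
A weak form of Pinsker's inequality: relative entropy dominates the squared Hellinger distance, and
that dominates the squared total variation by the Cauchy-Schwarz inequality.
\<close>

lemma total_variation_le_relative_entropy:
  fixes p q :: "'b \<Rightarrow> real"
  assumes "\<And>x. x \<in> S \<Longrightarrow> 0 \<le> p x" "\<And>x. x \<in> S \<Longrightarrow> 0 \<le> q x"
    and "\<And>x. x \<in> S \<Longrightarrow> q x = 0 \<Longrightarrow> p x = 0" and "sum p S = 1" "sum q S = 1"
  shows "(\<Sum>x\<in>S. \<bar>p x - q x\<bar>) \<le> 2 * sqrt (\<Sum>x\<in>S. p x * (ln (p x) - ln (q x)))"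
proof -
  let ?D = "\<Sum>x\<in>S. p x * (ln (p x) - ln (q x))"
  let ?V = "\<Sum>x\<in>S. \<bar>p x - q x\<bar>"
  have "(sqrt (p x) - sqrt (q x))\<^sup>2 \<le> p x * (ln (p x) - ln (q x)) + (q x - p x)" if x: "x \<in> S" for x
  proof (cases "p x = 0")
    case True
    then show ?thesis using assms(2)[OF x] by simp
  next
    case False
    then have pq: "0 < p x" "0 < q x" using assms(1-3)[OF x] by (auto simp: less_le)
    then have L: "ln (sqrt (p x * q x)) = (ln (p x) + ln (q x)) / 2" by (simp add: ln_sqrt ln_mult)
    have "p x * (ln (sqrt (p x * q x)) - ln (p x)) \<le> sqrt (p x * q x) - p x"
      using pq by (intro gibbs_pointwise) auto
    then have "p x * (ln (q x) - ln (p x)) \<le> 2 * (sqrt (p x * q x) - p x)"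
      unfolding L by (simp add: field_simps)
    moreover have "(sqrt (p x) - sqrt (q x))\<^sup>2 = p x + q x - 2 * sqrt (p x * q x)"
      using pq by (simp add: power2_diff real_sqrt_mult)
    ultimately show ?thesis by (simp add: right_diff_distrib)
  qed
  then have "(\<Sum>x\<in>S. (sqrt (p x) - sqrt (q x))\<^sup>2) \<le> (\<Sum>x\<in>S. p x * (ln (p x) - ln (q x)) + (q x - p x))"
    by (rule sum_mono)
  also have "\<dots> = ?D"
    by (simp add: sum.distrib sum_subtractf assms(4,5))
  finally have hell: "(\<Sum>x\<in>S. (sqrt (p x) - sqrt (q x))\<^sup>2) \<le> ?D" .
  have "(sqrt (p x) + sqrt (q x))\<^sup>2 \<le> 2 * p x + 2 * q x" if x: "x \<in> S" for x
    using assms(1,2)[OF x] zero_le_power2[of "sqrt (p x) - sqrt (q x)"] by (simp add: power2_diff power2_sum)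
  then have "(\<Sum>x\<in>S. (sqrt (p x) + sqrt (q x))\<^sup>2) \<le> (\<Sum>x\<in>S. 2 * p x + 2 * q x)" by (rule sum_mono)
  also have "\<dots> = 4" using assms(4,5) by (simp add: sum.distrib flip: sum_distrib_left)
  finally have plus: "(\<Sum>x\<in>S. (sqrt (p x) + sqrt (q x))\<^sup>2) \<le> 4" .
  have "?V = (\<Sum>x\<in>S. \<bar>sqrt (p x) - sqrt (q x)\<bar> * (sqrt (p x) + sqrt (q x)))"
  proof (intro sum.cong refl)
    fix x assume x: "x \<in> S"
    have "p x - q x = (sqrt (p x) - sqrt (q x)) * (sqrt (p x) + sqrt (q x))"
      using assms(1,2)[OF x] by (simp add: algebra_simps)
    then show "\<bar>p x - q x\<bar> = \<bar>sqrt (p x) - sqrt (q x)\<bar> * (sqrt (p x) + sqrt (q x))"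
      using assms(1,2)[OF x] by (simp add: abs_mult)
  qed
  then have "?V\<^sup>2
      \<le> (\<Sum>x\<in>S. \<bar>sqrt (p x) - sqrt (q x)\<bar>\<^sup>2) * (\<Sum>x\<in>S. (sqrt (p x) + sqrt (q x))\<^sup>2)"
    by (simp only: Cauchy_Schwarz_ineq_sum)
  also have "\<dots> \<le> ?D * 4"
    using hell plus order_trans[OF sum_nonneg hell] by (intro mult_mono) (simp_all add: sum_nonneg)
  finally have "sqrt (?V\<^sup>2) \<le> sqrt (?D * 4)"
    by (rule real_sqrt_le_mono)
  then show ?thesis by (simp add: real_sqrt_mult sum_nonneg)
qed

definition prepend :: "'a list \<Rightarrow> (nat \<Rightarrow> 'a) \<Rightarrow> nat \<Rightarrow> 'a" where
  "prepend a x = foldr case_nat a x"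

lemma prepend_simps [simp]: "prepend [] x = x" "prepend (c # a) x = case_nat c (prepend a x)"
  by (auto simp: prepend_def)

lemma shift_case_nat [simp]: "shift_map (case_nat c x) = x"
  by (simp add: shift_map_def)

lemma initial_prepend [simp]: "initial (length a) (prepend a x) = a"
  by (induction a) (auto simp: initial_Cons)

lemma prepend_in_cylinder: "prepend (a @ u) x \<in> cylinder a"
proof -
  have "prepend (a @ u) x = prepend a (prepend u x)" by (simp add: prepend_def)
  then show ?thesis by (simp add: mem_cylinder)
qed

lemma birkhoff_Suc: "birkhoff \<psi> (Suc n) x = \<psi> x + birkhoff \<psi> n (shift_map x)"
  by (simp add: birkhoff_def sum.lessThan_Suc_shift funpow_swap1 del: sum.lessThan_Suc)

lemma g_functionD:
  assumes "g_function g"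
  shows "0 < g x" "continuous_on UNIV (\<lambda>x. ln (g x))" "(\<Sum>c\<in>UNIV. g (case_nat c x)) = 1"
proof -
  show pos: "0 < g x" for x using assms by (simp add: g_function_def)
  then have "g x \<noteq> 0" for x by (metis less_irrefl)
  then show "continuous_on UNIV (\<lambda>x. ln (g x))"
    using assms pos by (intro continuous_on_ln) (auto simp: g_function_def)
  have "{b. shift_map b = x} = range (\<lambda>c. case_nat c x)"
  proof (intro set_eqI iffI)
    fix b assume "b \<in> {b. shift_map b = x}"
    then have "b = case_nat (b 0) x" by (auto simp: shift_map_def fun_eq_iff split: nat.split)
    then show "b \<in> range (\<lambda>c. case_nat c x)" by blast
  qed auto
  moreover have "inj (\<lambda>c. case_nat c x)" by (rule inj_on_inverseI[of _ "\<lambda>b. b 0"]) simp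
  ultimately have "(\<Sum>b\<in>{b. shift_map b = x}. g b) = (\<Sum>c\<in>UNIV. g (case_nat c x))"
    by (simp add: sum.reindex)
  then show "(\<Sum>c\<in>UNIV. g (case_nat c x)) = 1" using assms by (simp add: g_function_def)
qed

text \<open>
The transfer operator of \<open>ln g\<close> fixes the constant 1; here it is iterated \<open>n\<close> times.
\<close>

lemma g_function_words_sum:
  assumes "g_function g"
  shows "(\<Sum>a\<in>words n. exp (birkhoff (\<lambda>x. ln (g x)) n (prepend a z))) = 1"
proof (induction n)
  case (Suc n)
  have "(\<Sum>a\<in>words (Suc n). exp (birkhoff (\<lambda>x. ln (g x)) (Suc n) (prepend a z)))
    = (\<Sum>a\<in>words n. (\<Sum>c\<in>UNIV. g (case_nat c (prepend a z))) * exp (birkhoff (\<lambda>x. ln (g x)) n (prepend a z)))"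
    using g_functionD(1)[OF assms]
    by (simp add: sum_words_Cons birkhoff_Suc exp_add sum_distrib_right)
  then show ?case using Suc by (simp add: g_functionD(3)[OF assms])
qed (simp add: words_0 birkhoff_def)

lemma g_function_pressure:
  fixes g :: "'a::{finite,discrete_topology} observable"
  assumes "g_function g"
  shows "top_pressure (\<lambda>x. ln (g x)) = 0"
proof -
  let ?\<phi> = "\<lambda>x. ln (g x)"
  note cont = g_functionD(2)[OF assms]
  have cyl: "prepend a undefined \<in> cylinder a" for a :: "'a list" using prepend_in_cylinder[of a "[]"] by simp
  have lower: "0 \<le> ln (partition_sum ?\<phi> n) / real n" for n
  proof -
    have "1 \<le> partition_sum ?\<phi> n"
      unfolding partition_sum_def g_function_words_sum[OF assms, of n undefined, symmetric]
      using cylinder_sup_bounds(1)[OF cont _ cyl] by (intro sum_mono) auto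
    then show ?thesis by simp
  qed
  have upper: "ln (partition_sum ?\<phi> n) / real n \<le> distortion ?\<phi> n / real n" for n
  proof -
    have "partition_sum ?\<phi> n \<le> (\<Sum>a\<in>words n. exp (birkhoff ?\<phi> n (prepend a undefined)) * exp (distortion ?\<phi> n))"
      unfolding partition_sum_def exp_add[symmetric]
      using cylinder_sup_bounds(2)[OF cont _ cyl] by (intro sum_mono) auto
    also have "\<dots> = exp (distortion ?\<phi> n)"
      by (simp add: g_function_words_sum[OF assms] flip: sum_distrib_right)
    finally have "ln (partition_sum ?\<phi> n) \<le> ln (exp (distortion ?\<phi> n))"
      using partition_sum_pos by (intro ln_mono) auto
    then show ?thesis by (intro divide_right_mono) auto
  qed
  have "(\<lambda>n. ln (partition_sum ?\<phi> n) / real n) \<longlonglongrightarrow> 0"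
    using lower upper
    by (intro tendsto_sandwich[OF _ _ tendsto_const distortion_tendsto[OF cont]]) (auto intro: always_eventually)
  then show ?thesis using variational_principle(1)[OF cont] LIMSEQ_unique by blast
qed

lemma stationary_sum_extensions:
  assumes "stationary p"
  shows "(\<Sum>u\<in>words j. p (a @ u)) = p a"
proof (induction j)
  case (Suc j)
  then show ?case
    using stationaryD(3)[OF assms, of "a @ _"] by (simp add: sum_words_snoc)
qed (simp add: words_0)

context
  fixes g :: "'a::{finite,discrete_topology} observable" and \<rho>
  assumes gm: "g_measure g \<rho>"
begin

private lemma g: "g_function g"
  using gm by (simp add: g_measure_def)

private lemmas g_pos = g_functionD(1)[OF g] and cont = g_functionD(2)[OF g]

lemma g_measure_invariant: "\<rho> \<in> \<M>"
  using gm by (simp add: g_measure_def equilibrium_state_def is_arg_max_def)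

private lemmas st = stationary_weights[OF g_measure_invariant]

lemma g_measure_entropy: "h \<rho> + (\<integral>x. ln (g x) \<partial>\<rho>) = 0"
proof -
  note vp = variational_principle[OF cont]
  have max: "\<not> (\<integral>x. ln (g x) \<partial>\<rho>) + h \<rho> < (\<integral>x. ln (g x) \<partial>\<mu>) + h \<mu>" if "\<mu> \<in> \<M>" for \<mu>
    using gm that by (auto simp: g_measure_def equilibrium_state_def is_arg_max_def)
  obtain \<mu> where \<mu>: "\<mu> \<in> \<M>" "h \<mu> + (\<integral>x. ln (g x) \<partial>\<mu>) = 0"
    using vp(3) g_function_pressure[OF g] by auto
  show ?thesis
    using max[OF \<mu>(1)] \<mu>(2) vp(2)[OF g_measure_invariant] g_function_pressure[OF g] by linarith
qed

text \<open>
Compare the law of the first \<open>k + 1\<close> letters under \<open>\<rho>\<close> with the law \<open>q\<close> that draws the last \<open>k\<close> letters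
from \<open>\<rho>\<close> and the first letter from \<open>g\<close> (with an arbitrary continuation \<open>z\<close>). Their relative entropy is
\<open>D k = - (H\<^sub>k\<^sub>+\<^sub>1 - H\<^sub>k) - E ln g\<close>, which tends to \<open>- h(\<rho>) - \<integral>ln g d\<rho> = 0\<close>; then so does the total variation
distance.
\<close>

lemma g_measure_conditional:
  "(\<lambda>k. \<Sum>a\<in>words (Suc k). \<bar>weights \<rho> a - g (prepend a z) * weights \<rho> (tl a)\<bar>) \<longlonglongrightarrow> 0"
proof -
  let ?L = "\<lambda>k. \<Sum>a\<in>words (Suc k). weights \<rho> a * ln (g (prepend a z))"  let ?\<phi> = "\<lambda>x. ln (g x)"
  define q where "q a = g (prepend a z) * weights \<rho> (tl a)" for a
  define D where "D k = (\<Sum>a\<in>words (Suc k). weights \<rho> a * (ln (weights \<rho> a) - ln (q a)))" for k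
  have q_sum: "sum q (words (Suc k)) = 1" for k
    using stationary_sum_words[OF st, of k]
    by (simp add: sum_words_Cons q_def g_functionD(3)[OF g] flip: sum_distrib_right)
  have q_zero: "weights \<rho> a = 0" if qa: "q a = 0" and aw: "a \<in> words (Suc k)" for a k
  proof -
    obtain c b where a: "a = c # b" using aw by (cases a) (auto simp: words_def)
    have "weights \<rho> b = 0" using qa g_pos[of "prepend a z"] by (auto simp: q_def a)
    then show ?thesis using stationary_Cons_le[OF st, of c b] stationaryD(1)[OF st, of a] unfolding a by linarith
  qed
  have bound: "(\<Sum>a\<in>words (Suc k). \<bar>weights \<rho> a - q a\<bar>) \<le> 2 * sqrt (D k)" for k
    unfolding D_def using q_sum q_zero stationary_sum_words[OF st] g_pos
    by (intro total_variation_le_relative_entropy) (auto simp: q_def intro!: mult_nonneg_nonneg less_imp_le[OF g_pos])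
  have D_eq: "D k = - (H (Suc k) (weights \<rho>) - H k (weights \<rho>))
      - ?L k" for k
  proof -
    have "weights \<rho> a * (ln (weights \<rho> a) - ln (q a)) = weights \<rho> a * ln (weights \<rho> a)
        - weights \<rho> a * ln (weights \<rho> (tl a)) - weights \<rho> a * ln (g (prepend a z))"
      if "a \<in> words (Suc k)" for a
    proof (cases "weights \<rho> a = 0")
      case False
      then have "q a \<noteq> 0" using q_zero that by blast
      then have "weights \<rho> (tl a) \<noteq> 0" by (auto simp: q_def)
      then have "ln (q a) = ln (g (prepend a z)) + ln (weights \<rho> (tl a))"
        using g_pos[of "prepend a z"] stationaryD(1)[OF st, of "tl a"] unfolding q_def
        by (intro ln_mult_pos) (auto simp: less_le)
      then show ?thesis by (simp add: algebra_simps)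
    qed simp
    then show ?thesis unfolding D_def
      by (simp add: sum_subtractf block_entropy_eq_Cons[OF st, of k] block_entropy_def[of "Suc k"])
  qed
  have "(\<lambda>k. \<Sum>a\<in>words (Suc k). weights \<rho> a * ln (g (prepend a z))) \<longlonglongrightarrow> mean \<rho> ?\<phi>"
  proof (rule LIM_zero_cancel, rule Lim_null_comparison)
    show "\<forall>\<^sub>F k in sequentially. norm (?L k - mean \<rho> ?\<phi>)
        \<le> oscillation ?\<phi> (Suc k)"
    proof (intro always_eventually allI)
      fix k
      have "initial (Suc k) (prepend (initial (Suc k) x) z) = initial (Suc k) x" for x
        using initial_prepend[of "initial (Suc k) x" z] by simp
      then have "\<bar>mean \<rho> ?\<phi> - ?L k\<bar> \<le> oscillation ?\<phi> (Suc k)"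
        using invariantD[OF g_measure_invariant]
        by (intro integral_cylinder_approximation integrable_continuous oscillation(1) cont) auto
      then show "norm (?L k - mean \<rho> ?\<phi>)
        \<le> oscillation ?\<phi> (Suc k)" by (simp add: abs_minus_commute)
    qed
    show "(\<lambda>k. oscillation ?\<phi> (Suc k)) \<longlonglongrightarrow> 0" by (intro LIMSEQ_Suc oscillation(3) cont)
  qed
  then have "D \<longlonglongrightarrow> - entropy_rate (weights \<rho>) - mean \<rho> ?\<phi>"
    unfolding D_eq[abs_def] by (intro tendsto_intros entropy_increments_tendsto(1)[OF st])
  moreover have "- entropy_rate (weights \<rho>) - mean \<rho> ?\<phi> = 0"
    using g_measure_entropy by (simp add: ks_entropy_eq)
  ultimately have "D \<longlonglongrightarrow> 0" by simp
  then have "(\<lambda>k. 2 * sqrt (D k)) \<longlonglongrightarrow> 2 * sqrt 0" by (intro tendsto_intros)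
  then have lim: "(\<lambda>k. 2 * sqrt (D k)) \<longlonglongrightarrow> 0" by simp
  have "norm (\<Sum>a\<in>words (Suc k). \<bar>weights \<rho> a - g (prepend a z) * weights \<rho> (tl a)\<bar>) \<le> 2 * sqrt (D k)" for k
    using bound[of k] by (simp add: q_def sum_nonneg)
  then show ?thesis by (intro Lim_null_comparison[OF always_eventually lim] allI)
qed

text \<open>
Sum \<open>g_measure_conditional\<close> over the extensions of \<open>c # b\<close> to longer words. On all of them \<open>g\<close> is
comparable to \<open>g x\<close>, and the error vanishes as the extensions become longer.
\<close>

lemma g_measure_one_step:
  assumes x: "x \<in> cylinder (c # b)"
  defines "d \<equiv> oscillation (\<lambda>x. ln (g x)) (Suc (length b))"
  shows "g x * exp (- d) * weights \<rho> b \<le> weights \<rho> (c # b)" "weights \<rho> (c # b) \<le> g x * exp d * weights \<rho> b"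
proof -
  fix z :: "nat \<Rightarrow> 'a"
  define E where "E k = (\<Sum>a\<in>words (Suc k). \<bar>weights \<rho> a - g (prepend a z) * weights \<rho> (tl a)\<bar>)" for k
  define G where "G j = (\<Sum>u\<in>words j. g (prepend (c # b @ u) z) * weights \<rho> (b @ u))" for j
  have near: "\<bar>weights \<rho> (c # b) - G j\<bar> \<le> E (length b + j)" for j
  proof -
    have "\<bar>weights \<rho> (c # b) - G j\<bar> = \<bar>\<Sum>u\<in>words j. weights \<rho> (c # b @ u) - g (prepend (c # b @ u) z) * weights \<rho> (b @ u)\<bar>"
      using stationary_sum_extensions[OF st, of "c # b" j] by (simp add: G_def sum_subtractf)
    also have "\<dots> \<le> (\<Sum>u\<in>words j. \<bar>weights \<rho> (c # b @ u) - g (prepend (c # b @ u) z) * weights \<rho> (b @ u)\<bar>)"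
      by (rule sum_abs)
    also have "\<dots> = (\<Sum>a\<in>(\<lambda>u. c # b @ u) ` words j. \<bar>weights \<rho> a - g (prepend a z) * weights \<rho> (tl a)\<bar>)"
      by (subst sum.reindex) (auto simp: inj_on_def)
    also have "\<dots> \<le> E (length b + j)"
      unfolding E_def by (intro sum_mono2 finite_words) (auto simp: words_def)
    finally show ?thesis .
  qed
  have lim: "(\<lambda>j. E (length b + j)) \<longlonglongrightarrow> 0"
    using LIMSEQ_ignore_initial_segment[OF g_measure_conditional[of z], of "length b"]
    by (simp add: E_def add.commute)
  have "\<bar>ln (g (prepend (c # b @ u) z)) - ln (g x)\<bar> \<le> d" for u
    unfolding d_def using prepend_in_cylinder[of "c # b" u z] x
    by (intro oscillation(1)[OF cont]) (simp add: mem_cylinder)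
  then have "ln (g x) - d \<le> ln (g (prepend (c # b @ u) z))" "ln (g (prepend (c # b @ u) z)) \<le> ln (g x) + d" for u
    by (smt (verit))+
  then have "exp (ln (g x) - d) \<le> g (prepend (c # b @ u) z)" "g (prepend (c # b @ u) z) \<le> exp (ln (g x) + d)" for u
    using g_pos by (metis exp_le_cancel_iff exp_ln)+
  then have gx: "g x * exp (- d) \<le> g (prepend (c # b @ u) z)" "g (prepend (c # b @ u) z) \<le> g x * exp d" for u
    using g_pos[of x] by (auto simp: exp_add exp_diff exp_minus field_simps)
  have G1: "g x * exp (- d) * weights \<rho> b \<le> G j" for j
    unfolding G_def stationary_sum_extensions[OF st, of b j, symmetric] sum_distrib_left
    using gx(1) by (intro sum_mono mult_right_mono) auto
  have G2: "G j \<le> g x * exp d * weights \<rho> b" for j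
    unfolding G_def stationary_sum_extensions[OF st, of b j, symmetric] sum_distrib_left
    using gx(2) by (intro sum_mono mult_right_mono) auto
  have "g x * exp (- d) * weights \<rho> b - weights \<rho> (c # b) \<le> E (length b + j)" for j
    using near[of j] G1[of j] by linarith
  then have "g x * exp (- d) * weights \<rho> b - weights \<rho> (c # b) \<le> 0"
    by (intro LIMSEQ_le_const[OF lim]) auto
  then show "g x * exp (- d) * weights \<rho> b \<le> weights \<rho> (c # b)" by simp
  have "weights \<rho> (c # b) - g x * exp d * weights \<rho> b \<le> E (length b + j)" for j
    using near[of j] G2[of j] by linarith
  then have "weights \<rho> (c # b) - g x * exp d * weights \<rho> b \<le> 0"
    by (intro LIMSEQ_le_const[OF lim]) auto
  then show "weights \<rho> (c # b) \<le> g x * exp d * weights \<rho> b" by simp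
qed

lemma g_measure_gibbs:
  "x \<in> cylinder a \<Longrightarrow>
     exp (birkhoff (\<lambda>x. ln (g x)) (length a) x - distortion (\<lambda>x. ln (g x)) (length a)) \<le> weights \<rho> a \<and>
     weights \<rho> a \<le> exp (birkhoff (\<lambda>x. ln (g x)) (length a) x + distortion (\<lambda>x. ln (g x)) (length a))"
proof (induction a arbitrary: x)
  case Nil
  show ?case using stationaryD(2)[OF st]
    by (simp add: birkhoff_def distortion_def del: cylinder_Nil)
next
  case (Cons c b)
  let ?\<phi> = "\<lambda>x. ln (g x)"
  let ?d = "oscillation ?\<phi> (Suc (length b))"
  have x: "shift_map x \<in> cylinder b" using Cons.prems by (simp add: mem_cylinder initial_Cons)
  note IH = Cons.IH[OF x] and step = g_measure_one_step[OF Cons.prems]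
  have gx: "g x = exp (?\<phi> x)" using g_pos by simp
  have "exp (birkhoff ?\<phi> (length (c # b)) x - distortion ?\<phi> (length (c # b)))
     = g x * exp (- ?d) * exp (birkhoff ?\<phi> (length b) (shift_map x) - distortion ?\<phi> (length b))"
    by (subst gx) (simp add: birkhoff_Suc distortion_def del: exp_ln flip: exp_add)
  also have "\<dots> \<le> g x * exp (- ?d) * weights \<rho> b"
    using IH g_functionD(1)[OF g, of x] by (intro mult_left_mono) auto
  also have "\<dots> \<le> weights \<rho> (c # b)" by (rule step(1))
  finally have 1: "exp (birkhoff ?\<phi> (length (c # b)) x - distortion ?\<phi> (length (c # b))) \<le> weights \<rho> (c # b)" .
  have "weights \<rho> (c # b) \<le> g x * exp ?d * weights \<rho> b" by (rule step(2))
  also have "\<dots> \<le> g x * exp ?d * exp (birkhoff ?\<phi> (length b) (shift_map x) + distortion ?\<phi> (length b))"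
    using IH g_functionD(1)[OF g, of x] by (intro mult_left_mono) auto
  also have "\<dots> = exp (birkhoff ?\<phi> (length (c # b)) x + distortion ?\<phi> (length (c # b)))"
    by (subst gx) (simp add: birkhoff_Suc distortion_def add_ac del: exp_ln flip: exp_add)
  finally show ?case using 1 by blast
qed

lemma relative_entropy_g_measure:
  assumes \<nu>: "\<nu> \<in> \<M>"
  shows "relative_entropy \<nu> \<rho> = - h \<nu> - (\<integral>x. ln (g x) \<partial>\<nu>)"
proof -
  let ?\<phi> = "\<lambda>x. ln (g x)"
  note inv = invariantD[OF \<nu>] and st = stationary_weights[OF \<nu>]
  interpret prob_space \<nu> by (rule inv(1))
  have gibbs: "0 < weights \<rho> a \<and> \<bar>birkhoff ?\<phi> (length a) x - ln (weights \<rho> a)\<bar> \<le> distortion ?\<phi> (length a)"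
    if x: "x \<in> cylinder a" for x a
  proof -
    note G = g_measure_gibbs[OF x]
    have pos: "0 < weights \<rho> a" using G exp_gt_zero less_le_trans by blast
    have "birkhoff ?\<phi> (length a) x - distortion ?\<phi> (length a) \<le> ln (weights \<rho> a)"
      using G pos by (simp add: ln_ge_iff)
    moreover have "ln (weights \<rho> a) \<le> birkhoff ?\<phi> (length a) x + distortion ?\<phi> (length a)"
      using G pos by (metis ln_exp ln_mono)
    ultimately show ?thesis using pos by linarith
  qed
  define X where "X k = (\<Sum>a\<in>words k. weights \<nu> a * ln (weights \<rho> a))" for k
  have X: "\<bar>real k * mean \<nu> ?\<phi> - X k\<bar> \<le> distortion ?\<phi> k" for k
    unfolding integral_birkhoff[OF \<nu> cont, symmetric] X_def
    using gibbs[of _ "initial k _"]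
    by (intro integral_cylinder_approximation integrable_continuous[OF continuous_birkhoff[OF cont]] inv)
       (auto simp: mem_cylinder)
  have X_lim: "(\<lambda>k. X k / real k) \<longlonglongrightarrow> mean \<nu> ?\<phi>"
  proof (rule LIM_zero_cancel, rule Lim_null_comparison[OF _ distortion_tendsto[OF cont]])
    show "\<forall>\<^sub>F k in sequentially. norm (X k / real k - mean \<nu> ?\<phi>) \<le> distortion ?\<phi> k / real k"
      using eventually_gt_at_top[of 0]
    proof eventually_elim
      case (elim k)
      then have "X k / real k - mean \<nu> ?\<phi> = - (real k * mean \<nu> ?\<phi> - X k) / real k"
        by (simp add: field_simps)
      then have "norm (X k / real k - mean \<nu> ?\<phi>) = \<bar>real k * mean \<nu> ?\<phi> - X k\<bar> / real k"
        by (simp add: abs_divide abs_minus_commute)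
      then show ?case using X[of k] elim by (simp add: divide_right_mono)
    qed
  qed
  have "(\<Sum>a\<in>words k. weights \<nu> a * ln (weights \<nu> a / weights \<rho> a)) / real k
      = - (H k (weights \<nu>) / real k) - X k / real k" for k
  proof -
    have "weights \<nu> a * ln (weights \<nu> a / weights \<rho> a) = weights \<nu> a * ln (weights \<nu> a) - weights \<nu> a * ln (weights \<rho> a)" for a
      using gibbs[OF periodic_extension_in_cylinder, of a] stationaryD(1)[OF st, of a]
      by (cases "weights \<nu> a = 0") (auto simp: ln_div right_diff_distrib)
    then show ?thesis by (simp add: X_def block_entropy_def sum_subtractf diff_divide_distrib)
  qed
  moreover have "(\<lambda>k. - (H k (weights \<nu>) / real k) - X k / real k) \<longlonglongrightarrow> - h \<nu> - mean \<nu> ?\<phi>"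
    unfolding ks_entropy_eq by (intro tendsto_intros X_lim entropy_increments_tendsto(2)[OF st])
  ultimately show ?thesis unfolding relative_entropy_def by (simp add: limI)
qed

end

section \<open>Exponential moments of the empirical entropies\<close>

lemma birkhoff_add: "birkhoff \<psi> (m + n) x = birkhoff \<psi> m x + birkhoff \<psi> n ((shift_map ^^ m) x)"
  unfolding birkhoff_def
  by (induction n) (simp_all add: funpow_shift add.assoc)

text \<open>
The deviation of \<open>S\<^sub>n\<close> from its linear part is a periodic function of \<open>n\<close>, so it is bounded.
\<close>

lemma birkhoff_periodic:
  assumes "w \<noteq> []"
  shows "(\<lambda>n. cyclic_sum \<psi> n w / real n)
     \<longlonglongrightarrow> cyclic_sum \<psi> (length w) w / real (length w)"
proof -
  let ?x = "periodic_extension w" and ?p = "length w"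
  define c where "c = birkhoff \<psi> ?p ?x / real ?p"
  define f where "f n = birkhoff \<psi> n ?x - real n * c" for n
  have p: "0 < ?p" using assms by simp
  have f_add: "f (?p + n) = f n" for n
    using p unfolding f_def birkhoff_add periodic_shift by (simp add: c_def field_simps)
  have f_mult: "f (m * ?p + n) = f n" for m n
    by (induction m) (simp_all add: f_add add.assoc)
  have "\<bar>f n\<bar> \<le> (\<Sum>r<?p. \<bar>f r\<bar>)" for n
  proof -
    have "f n = f (n mod ?p)" using f_mult[of "n div ?p" "n mod ?p"] by simp
    then show ?thesis using member_le_sum[of "n mod ?p" "{..<?p}" "\<lambda>r. \<bar>f r\<bar>"] p by simp
  qed
  then have "(\<lambda>n. f n / real n) \<longlonglongrightarrow> 0"
    by (intro Lim_null_comparison[OF _ lim_const_over_n[of "\<Sum>r<?p. \<bar>f r\<bar>"]] always_eventually allI)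
       (simp add: abs_divide divide_right_mono)
  moreover have "\<forall>\<^sub>F n in sequentially. f n / real n = birkhoff \<psi> n ?x / real n - c"
    using eventually_gt_at_top[of 0] by eventually_elim (simp add: f_def diff_divide_distrib)
  ultimately have "(\<lambda>n. birkhoff \<psi> n ?x / real n - c) \<longlonglongrightarrow> 0"
    by (rule Lim_transform_eventually)
  then show ?thesis unfolding c_def by (rule LIM_zero_cancel)
qed

lemma integral_periodic_birkhoff:
  fixes \<psi> :: "'a::{finite,discrete_topology} observable"
  assumes "w \<noteq> []" "continuous_on UNIV \<psi>"
  shows "mean (periodic_measure w) \<psi> = cyclic_sum \<psi> (length w) w / real (length w)"
  using integral_periodic_measure[OF assms(1) borel_measurable_continuous_onI[OF assms(2)]]
  by (simp add: birkhoff_def)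

text \<open>
A truncated periodic word, closed up cyclically, contains only few distinct \<open>k\<close>-blocks: at most
one for each phase of the period, and \<open>k\<close> more that overlap the seam.
\<close>

lemma block_entropy_periodic_le:
  fixes v :: "'a::finite list"
  assumes "v \<noteq> []" "1 \<le> n"
  shows "H k (empirical_weights (initial n (periodic_extension v))) \<le> ln (real (length v) + real k)"
proof -
  define w where "w = initial n (periodic_extension v)"
  let ?p = "length v"
  have len: "length w = n" by (simp add: w_def)
  then have w: "w \<noteq> []" using assms(2) by auto
  let ?x = "\<lambda>i. cyclic_orbit w i"
  define S where "S = (\<lambda>i. initial k ((shift_map ^^ i) (periodic_extension v))) ` {..<?p}
      \<union> (\<lambda>i. initial k (?x i)) ` {n - k..<n}"
  have mem: "initial k (?x i) \<in> S" if i: "i < n" for i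
  proof (cases "i + k \<le> n")
    case True
    have p: "0 < ?p" using assms(1) by simp
    have "initial k (?x i) = initial k ((shift_map ^^ (i mod ?p)) (periodic_extension v))"
      unfolding initial_eq_iff
    proof (intro allI impI)
      fix j assume j: "j < k"
      have "(?x i) j = w ! (i + j)" using True j len by (simp add: funpow_shift periodic_extension_def)
      also have "\<dots> = v ! ((i + j) mod ?p)" using True j by (simp add: w_def periodic_extension_def)
      also have "\<dots> = ((shift_map ^^ (i mod ?p)) (periodic_extension v)) j"
        by (simp add: funpow_shift periodic_extension_def mod_add_left_eq)
      finally show "(?x i) j = ((shift_map ^^ (i mod ?p)) (periodic_extension v)) j" .
    qed
    then show ?thesis using p by (auto simp: S_def)
  next
    case False
    then show ?thesis using i by (auto simp: S_def)
  qed
  have "card S \<le> card {..<?p} + card {n - k..<n}"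
    unfolding S_def by (intro order_trans[OF card_Un_le] add_mono card_image_le) auto
  then have card: "card S \<le> ?p + k" by simp
  have "S \<noteq> {}" using mem[of 0] assms(2) by auto
  moreover have "finite S" by (simp add: S_def)
  ultimately have pos: "0 < card S" by (simp add: card_gt_0_iff)
  have "cyclic_H k w \<le> ln (card S)"
  proof (rule block_entropy_le_log_card[OF stationary_empirical[OF w]])
    show "S \<subseteq> words k" by (auto simp: S_def)
    show "a \<in> S" if a: "a \<in> words k" "empirical_weights w a \<noteq> 0" for a
    proof -
      have "card {i. i < n \<and> initial k (?x i) = a} \<noteq> 0"
        using a len by (auto simp: empirical_weights_def empirical_def words_def)
      then have "{i. i < n \<and> initial k (?x i) = a} \<noteq> {}" by (metis card.empty)
      then show ?thesis using mem by auto
    qed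
    show "S \<noteq> {}" by fact
  qed
  also have "\<dots> \<le> ln (real (?p + k))" using card pos by (intro ln_mono) auto
  finally show ?thesis by (simp add: w_def)
qed

text \<open>
Periodic orbits come arbitrarily close to the supremum of \<open>\<integral>\<phi> d\<nu>\<close> over all invariant measures:
\<open>n \<integral>\<phi> d\<nu>\<close> is at most the largest value of \<open>S\<^sub>n \<phi>\<close>, which is up to the distortion attained at
an \<open>n\<close>-periodic point. As periodic orbit measures are ergodic, the supremum over ergodic measures is the
same.
\<close>

lemma ergodic_supremum:
  fixes \<phi> :: "'a::{finite,discrete_topology} observable"
  assumes "continuous_on UNIV \<phi>"
  defines "M \<equiv> (SUP \<eta>\<in>ergodic_measures. mean \<eta> \<phi>)"
  shows "\<And>\<nu>. \<nu> \<in> \<M> \<Longrightarrow> mean \<nu> \<phi> \<le> M"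
    and "\<And>e. 0 < e \<Longrightarrow> \<exists>v. v \<noteq> [] \<and> M - e < mean (periodic_measure v) \<phi>"
proof -
  obtain B where B: "\<And>x. \<bar>\<phi> x\<bar> \<le> B" using continuous_bounded[OF assms(1)] by blast
  have le_B: "mean \<nu> \<phi> \<le> B" if "\<nu> \<in> \<M>" for \<nu>
  proof -
    interpret prob_space \<nu> using invariantD[OF that] by simp
    have "mean \<nu> \<phi> \<le> (\<integral>x. B \<partial>\<nu>)"
      using invariantD[OF that] B by (intro integral_mono integrable_continuous[OF assms(1)]) (auto simp: abs_le_iff)
    then show ?thesis by (simp add: prob_space)
  qed
  let ?A = "{v :: 'a list. v \<noteq> []}"
  let ?e = "\<lambda>v. mean (periodic_measure v) \<phi>"
  define M' where "M' = (SUP v\<in>?A. ?e v)"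
  have bdd': "bdd_above (?e ` ?A)"
    using le_B periodic_measure_invariant by (intro bdd_aboveI2) auto
  have bdd: "bdd_above ((\<lambda>\<eta>. mean \<eta> \<phi>) ` ergodic_measures)"
    using le_B by (intro bdd_aboveI2) (auto simp: ergodic_measures_def)
  have le_M': "mean \<nu> \<phi> \<le> M'" if \<nu>: "\<nu> \<in> \<M>" for \<nu>
  proof -
    interpret prob_space \<nu> using invariantD[OF \<nu>] by simp
    have "mean \<nu> \<phi> \<le> M' + distortion \<phi> n / real n" if n: "1 \<le> n" for n
    proof -
      have "birkhoff \<phi> n x \<le> real n * M' + distortion \<phi> n" for x
      proof -
        let ?w = "initial n x"
        have w: "?w \<in> ?A" using n by (auto simp flip: length_greater_0_conv)
        have "cyclic_sum \<phi> n ?w / real n \<le> M'"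
          using integral_periodic_birkhoff[of ?w \<phi>] w assms(1) cSUP_upper[OF w bdd'] by (simp add: M'_def)
        then have "cyclic_sum \<phi> n ?w \<le> real n * M'"
          using n by (simp add: field_simps)
        moreover have "\<bar>birkhoff \<phi> n x - cyclic_sum \<phi> n ?w\<bar> \<le> distortion \<phi> n"
          by (rule birkhoff_distortion[OF assms(1)]) simp
        ultimately show ?thesis by linarith
      qed
      then have "(\<integral>x. birkhoff \<phi> n x \<partial>\<nu>) \<le> (\<integral>x. real n * M' + distortion \<phi> n \<partial>\<nu>)"
        using invariantD[OF \<nu>] by (intro integral_mono integrable_continuous continuous_birkhoff assms(1)) auto
      then show ?thesis
        using n by (simp add: integral_birkhoff[OF \<nu> assms(1)] prob_space field_simps)
    qed
    moreover have "(\<lambda>n. M' + distortion \<phi> n / real n) \<longlonglongrightarrow> M' + 0"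
      by (intro tendsto_intros distortion_tendsto assms(1))
    ultimately show ?thesis
      using LIMSEQ_le_const[of "\<lambda>n. M' + distortion \<phi> n / real n" "M' + 0" "mean \<nu> \<phi>"] by auto
  qed
  have "[undefined] \<in> ?A" by simp
  then have "periodic_measure [undefined :: 'a] \<in> ergodic_measures" by (intro periodic_measure_ergodic) auto
  then have "M \<le> M'"
    unfolding M_def using le_M' by (intro cSUP_least) (auto simp: ergodic_measures_def)
  moreover have "M' \<le> M"
    unfolding M'_def M_def
    by (intro cSUP_least cSUP_upper[OF periodic_measure_ergodic bdd]) auto
  ultimately have M: "M = M'" by simp
  show "mean \<nu> \<phi> \<le> M" if "\<nu> \<in> \<M>" for \<nu> using le_M'[OF that] M by simp
  show "\<exists>v. v \<noteq> [] \<and> M - e < ?e v" if "0 < e" for e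
  proof -
    have "M' - e < M'" using that by simp
    then have "\<exists>v\<in>?A. M' - e < ?e v"
      unfolding M'_def using bdd' by (subst (asm) less_cSUP_iff) auto
    then show ?thesis using M by auto
  qed
qed

lemma kraft_cost_log:
  fixes k :: "nat \<Rightarrow> nat"
  assumes "2 \<le> CARD('a::finite)" "0 < \<epsilon>" "\<epsilon> < 1"
    and "\<forall>\<^sub>F n in sequentially. real (k n) \<le> (1 - \<epsilon>) / ln (real CARD('a)) * ln (real n)"
  shows "(\<lambda>n. kraft_cost TYPE('a) n (k n) / real n) \<longlonglongrightarrow> 0"
proof (rule Lim_null_comparison)
  show "\<forall>\<^sub>F n in sequentially. norm (kraft_cost TYPE('a) n (k n) / real n)
     \<le> (real n powr (1 - \<epsilon>) * ln (real n + 1) + (1 - \<epsilon>) * ln (real n)) / real n"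
    using assms(4) eventually_gt_at_top[of 0]
  proof eventually_elim
    case (elim n)
    have L: "0 < ln (real CARD('a))" using assms(1) by simp
    have k: "real (k n) * ln (real CARD('a)) \<le> (1 - \<epsilon>) * ln (real n)"
      using elim(1) L by (simp add: field_simps)
    have "real (CARD('a) ^ k n) = exp (real (k n) * ln (real CARD('a)))"
      by (simp add: exp_of_nat_mult)
    also have "\<dots> \<le> real n powr (1 - \<epsilon>)" using k elim(2) by (simp add: powr_def)
    finally have "real (CARD('a) ^ k n) * ln (real n + 1) \<le> real n powr (1 - \<epsilon>) * ln (real n + 1)"
      by (intro mult_right_mono) auto
    then have "kraft_cost TYPE('a) n (k n) \<le> real n powr (1 - \<epsilon>) * ln (real n + 1) + (1 - \<epsilon>) * ln (real n)"
      using k by (simp add: kraft_cost_def)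
    moreover have "0 \<le> kraft_cost TYPE('a) n (k n)" using L by (simp add: kraft_cost_def)
    ultimately show ?case by (simp add: divide_right_mono)
  qed
  show "(\<lambda>n. (real n powr (1 - \<epsilon>) * ln (real n + 1) + (1 - \<epsilon>) * ln (real n)) / real n) \<longlonglongrightarrow> 0"
    using assms(2,3) by real_asymp
qed

lemma g_function_card:
  fixes g :: "'a::{finite,discrete_topology} observable"
  assumes "g_function g"
  shows "2 \<le> CARD('a)"
proof (rule ccontr)
  assume "\<not> ?thesis"
  moreover have "0 < CARD('a)" by simp
  ultimately have "CARD('a) = 1" by linarith
  then obtain c :: 'a where c: "UNIV = {c}" by (auto simp: card_1_singleton_iff)
  have "(\<Sum>b\<in>UNIV. g (case_nat b undefined)) = (\<Sum>b\<in>{c}. g (case_nat b undefined))"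
    by (rule sum.cong[OF c refl])
  then have "g (case_nat c undefined) = 1" using g_functionD(3)[OF assms, of undefined] by simp
  then show False using assms by (auto simp: g_function_def dest!: spec[of _ "case_nat c undefined"])
qed

definition moment_sum :: "((nat \<Rightarrow> 'a::finite) \<Rightarrow> real) \<Rightarrow> real \<Rightarrow> ('a list \<Rightarrow> real) \<Rightarrow> nat \<Rightarrow> real" where
  "moment_sum \<phi> t f n = (\<Sum>w\<in>words n. exp (cyclic_sum \<phi> n w + real n * t * f w))"

lemma moment_sum_pos: "0 < moment_sum \<phi> t f n"
  unfolding moment_sum_def by (intro sum_pos) auto

lemma g_measure_moment:
  fixes g :: "'a::{finite,discrete_topology} observable"
  assumes "g_measure g \<rho>"
  shows "\<bar>ln (\<integral>x. exp (real n * t * f (initial n x)) \<partial>\<rho>) - ln (moment_sum (\<lambda>x. ln (g x)) t f n)\<bar>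
    \<le> distortion (\<lambda>x. ln (g x)) n"
proof -
  let ?\<phi> = "\<lambda>x. ln (g x)"
  let ?S = "cyclic_sum ?\<phi> n" and ?E = "\<lambda>w. exp (real n * t * f w)"
  let ?D = "distortion ?\<phi> n" and ?B = "moment_sum ?\<phi> t f n"
  note inv = invariantD[OF g_measure_invariant[OF assms]]
  define A where "A = (\<integral>x. exp (real n * t * f (initial n x)) \<partial>\<rho>)"
  have A: "A = (\<Sum>w\<in>words n. weights \<rho> w * ?E w)"
    unfolding A_def using integral_initial(2)[OF inv(1,2)] .
  have G: "exp (?S w - ?D) \<le> weights \<rho> w"
    "weights \<rho> w \<le> exp (?S w + ?D)" if "w \<in> words n" for w
    using g_measure_gibbs[OF assms periodic_extension_in_cylinder[of w]] that by (auto simp: words_def)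
  have B: "0 < ?B" by (rule moment_sum_pos)
  have lower: "exp (- ?D) * ?B \<le> A"
    unfolding A moment_sum_def sum_distrib_left
  proof (rule sum_mono)
    fix w :: "'a list" assume "w \<in> words n"
    from G(1)[OF this] have "exp (?S w - ?D) * ?E w
       \<le> weights \<rho> w * ?E w" by (intro mult_right_mono) auto
    then show "exp (- ?D) * exp (?S w + real n * t * f w)
       \<le> weights \<rho> w * ?E w" by (simp add: exp_add exp_diff exp_minus field_simps)
  qed
  have upper: "A \<le> exp ?D * ?B"
    unfolding A moment_sum_def sum_distrib_left
  proof (rule sum_mono)
    fix w :: "'a list" assume "w \<in> words n"
    from G(2)[OF this] have "weights \<rho> w * ?E w
       \<le> exp (?S w + ?D) * ?E w" by (intro mult_right_mono) auto
    then show "weights \<rho> w * ?E w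
       \<le> exp ?D * exp (?S w + real n * t * f w)"
      by (simp add: exp_add mult_ac)
  qed
  have "0 < exp (- ?D) * ?B" using B by simp
  then have "0 < A" using lower by linarith
  then have "ln (exp (- ?D) * ?B) \<le> ln A" "ln A \<le> ln (exp ?D * ?B)"
    using lower upper B by (auto intro!: ln_mono simp del: exp_minus)
  then have "- ?D + ln ?B \<le> ln A" "ln A \<le> ?D + ln ?B"
    using B by (simp_all add: ln_mult)
  then show ?thesis unfolding A_def[symmetric] by linarith
qed

lemma tendsto_between:
  fixes u v w :: "nat \<Rightarrow> real"
  assumes "u \<longlonglongrightarrow> l" "w \<longlonglongrightarrow> l" "\<forall>\<^sub>F n in sequentially. u n \<le> v n \<and> v n \<le> w n \<or> w n \<le> v n \<and> v n \<le> u n"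
  shows "v \<longlonglongrightarrow> l"
proof (rule tendsto_sandwich)
  show "(\<lambda>n. min (u n) (w n)) \<longlonglongrightarrow> l" using tendsto_min[OF assms(1,2)] by simp
  show "(\<lambda>n. max (u n) (w n)) \<longlonglongrightarrow> l" using tendsto_max[OF assms(1,2)] by simp
  show "\<forall>\<^sub>F n in sequentially. min (u n) (w n) \<le> v n" "\<forall>\<^sub>F n in sequentially. v n \<le> max (u n) (w n)"
    using assms(3) by (auto elim!: eventually_mono)
qed

text \<open>
Both empirical entropies lie between \<open>cyclic_h\<close> and \<open>cyclic_H / k\<close>, and every
functional \<open>F\<close> between these two has the same exponential moments.
\<close>

context
  fixes \<phi> :: "'a::{finite,discrete_topology} observable" and k :: "nat \<Rightarrow> nat"
    and F :: "nat \<Rightarrow> 'a list \<Rightarrow> real"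
  assumes cont: "continuous_on UNIV \<phi>"
    and k1: "\<And>n. 1 \<le> n \<Longrightarrow> 1 \<le> k n" and k: "filterlim k at_top sequentially"
    and kraft: "(\<lambda>n. kraft_cost TYPE('a) n (k n) / real n) \<longlonglongrightarrow> 0"
    and F1: "\<And>n w. 1 \<le> n \<Longrightarrow> w \<in> words n \<Longrightarrow> cyclic_h (k n) w \<le> F n w"
    and F2: "\<And>n w. 1 \<le> n \<Longrightarrow> w \<in> words n \<Longrightarrow> F n w \<le> cyclic_H (k n) w / real (k n)"
begin

text \<open>
With \<open>\<psi> = \<phi> / (t + 1)\<close> the moment sum lies between \<open>exp (u n)\<close> and \<open>exp (v n)\<close>, in an order that depends on
the sign of \<open>t\<close>. The bound \<open>u\<close> comes from \<open>F \<le> P\<^sub>k(\<psi>) - S\<^sub>n \<psi> / n\<close>, the bound \<open>v\<close> from the Kraft inequality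
and \<open>log_sum_exp_convex\<close>: for \<open>t \<ge> 0\<close> the exponent \<open>S\<^sub>n \<psi>\<close> is a convex combination of the exponent of the
moment sum and of \<open>- n h\<^sub>k\<close>, and for \<open>t < 0\<close> the exponent of the moment sum is bounded by a convex
combination of \<open>S\<^sub>n \<psi>\<close> and \<open>- n h\<^sub>k\<close>. Both bounds have rate \<open>(t + 1) P(\<psi>)\<close>.
\<close>

lemma moment_sum_rate_supercritical:
  assumes t: "-1 < t"
  shows "(\<lambda>n. ln (moment_sum \<phi> t (F n) n) / real n) \<longlonglongrightarrow> (t + 1) * top_pressure (\<lambda>x. \<phi> x / (t + 1))"
proof -
  let ?K = "\<lambda>n. kraft_cost TYPE('a) n (k n)"
  define \<psi> where "\<psi> = (\<lambda>x. \<phi> x / (t + 1))"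
  define P where "P = top_pressure \<psi>"
  have s: "0 < t + 1" using t by simp
  have cont': "continuous_on UNIV \<psi>" unfolding \<psi>_def using s by (intro continuous_intros cont) auto
  have b\<phi>: "birkhoff \<phi> n x = (t + 1) * birkhoff \<psi> n x" for n x
    using s by (simp add: birkhoff_def \<psi>_def sum_distrib_left)
  let ?S = "\<lambda>n w. cyclic_sum \<psi> n w"
  let ?h = "\<lambda>n w :: 'a list. cyclic_h (k n) w"
  define b where "b n = ln (partition_sum \<psi> n) / real n" for n
  define z where "z n = ln (periodic_sum \<psi> n)" for n
  have b_lim: "b \<longlonglongrightarrow> P" unfolding b_def P_def by (rule variational_principle(1)[OF cont'])
  have bk_lim: "(\<lambda>n. b (k n)) \<longlonglongrightarrow> P" by (rule filterlim_compose[OF b_lim k])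
  have z_lim: "(\<lambda>n. z n / real n) \<longlonglongrightarrow> P"
  proof (rule tendsto_sandwich)
    show "\<forall>\<^sub>F n in sequentially. z n / real n \<le> b n"
      using periodic_sum_bounds(1)[OF cont'] by (auto simp: z_def b_def intro!: always_eventually divide_right_mono)
    have "ln (partition_sum \<psi> n) - distortion \<psi> n \<le> z n" for n
      using periodic_sum_bounds(2)[OF cont', of n] by (simp add: z_def)
    then show "\<forall>\<^sub>F n in sequentially. b n - distortion \<psi> n / real n \<le> z n / real n"
      by (auto simp: b_def intro!: always_eventually divide_right_mono simp flip: diff_divide_distrib)
    show "b \<longlonglongrightarrow> P" by (rule b_lim)
    have "(\<lambda>n. b n - distortion \<psi> n / real n) \<longlonglongrightarrow> P - 0"
      by (intro tendsto_diff b_lim distortion_tendsto[OF cont'])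
    then show "(\<lambda>n. b n - distortion \<psi> n / real n) \<longlonglongrightarrow> P" by simp
  qed
  have F_le: "real n * F n w \<le> real n * b (k n) - ?S n w" if n: "1 \<le> n" and w: "w \<in> words n" for n w
  proof -
    have w': "w \<noteq> []" "length w = n" using n w by (auto simp: words_def)
    have "F n w \<le> b (k n) - ?S n w / real n"
      using block_entropy_plus_integral_le[OF cont' periodic_measure_invariant[OF w'(1)] k1[OF n]] F2[OF n w] w'
      by (simp add: weights_periodic_measure integral_periodic_birkhoff[OF _ cont'] b_def)
    then have "real n * F n w \<le> real n * (b (k n) - ?S n w / real n)" by (intro mult_left_mono) auto
    then show ?thesis using n by (simp add: right_diff_distrib)
  qed
  have kraft': "ln (\<Sum>w\<in>words n. exp (- real n * ?h n w)) \<le> ?K n" if "1 \<le> n" for n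
    by (rule kraft_empirical[OF that k1[OF that]])
  let ?B = "\<lambda>n. moment_sum \<phi> t (F n) n"
  define u where "u n = real n * t * b (k n) + z n" for n
  define v where "v n = (t + 1) * z n - t * ?K n" for n
  have sum_eq: "ln (\<Sum>w\<in>words n. exp (?S n w + real n * t * b (k n))) = u n" for n
    using periodic_sum_pos[of \<psi> n]
    by (simp add: exp_add u_def z_def ln_mult flip: periodic_sum_def sum_distrib_right)
  have pos: "0 < (\<Sum>w\<in>(words n :: 'a list set). exp (f w))" for n and f :: "'a list \<Rightarrow> real"
    by (intro sum_pos) auto
  have between: "u n \<le> ln (?B n) \<and> ln (?B n) \<le> v n \<or> v n \<le> ln (?B n) \<and> ln (?B n) \<le> u n" if n: "1 \<le> n" for n
  proof (cases "0 \<le> t")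
    case True
    have "cyclic_sum \<phi> n w + real n * t * F n w \<le> ?S n w + real n * t * b (k n)"
      if w: "w \<in> words n" for w
      using mult_left_mono[OF F_le[OF n w] True] by (simp add: b\<phi> algebra_simps)
    then have "?B n \<le> (\<Sum>w\<in>words n. exp (?S n w + real n * t * b (k n)))"
      unfolding moment_sum_def by (intro sum_mono) auto
    then have upper: "ln (?B n) \<le> u n"
      unfolding sum_eq[symmetric] using moment_sum_pos by (intro ln_mono) auto
    let ?a = "\<lambda>w. cyclic_sum \<phi> n w + real n * t * ?h n w"
    let ?c = "\<lambda>w. 1 / (t + 1) * ?a w + t / (t + 1) * (- real n * ?h n w)"
    have "?c w = ?S n w" for w
    proof -
      have "?c w
          = (?a w + t * (- real n * ?h n w)) / (t + 1)"
        by (simp only: add_divide_distrib times_divide_eq_left mult_1)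
      also have "?a w + t * (- real n * ?h n w) = (t + 1) * ?S n w"
        by (simp add: b\<phi> mult_ac)
      finally show ?thesis using s by simp
    qed
    then have "z n = ln (\<Sum>w\<in>words n. exp (?c w))"
      by (simp only: z_def periodic_sum_def)
    also have "\<dots> \<le> 1 / (t + 1) * ln (\<Sum>w\<in>words n. exp (?a w)) + t / (t + 1) * ln (\<Sum>w\<in>words n. exp (- real n * ?h n w))"
      using True s by (intro log_sum_exp_convex) (auto simp flip: add_divide_distrib)
    also have "\<dots> \<le> 1 / (t + 1) * ln (?B n) + t / (t + 1) * ?K n"
    proof (intro add_mono mult_left_mono kraft'[OF n] ln_mono pos)
      show "(\<Sum>w\<in>words n. exp (?a w)) \<le> ?B n"
        unfolding moment_sum_def using F1[OF n] True by (intro sum_mono) (auto intro!: mult_left_mono)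
    qed (use True s in auto)
    finally have "(t + 1) * z n \<le> (t + 1) * (1 / (t + 1) * ln (?B n) + t / (t + 1) * ?K n)"
      using s by (intro mult_left_mono) auto
    also have "\<dots> = ln (?B n) + t * ?K n" using s by (simp add: distrib_left)
    finally have "v n \<le> ln (?B n)" by (simp add: v_def)
    then show ?thesis using upper by simp
  next
    case False
    then have t0: "t \<le> 0" by simp
    have "?S n w + real n * t * b (k n) \<le> cyclic_sum \<phi> n w + real n * t * F n w"
      if w: "w \<in> words n" for w
      using mult_left_mono_neg[OF F_le[OF n w] t0] by (simp add: b\<phi> algebra_simps)
    then have "(\<Sum>w\<in>words n. exp (?S n w + real n * t * b (k n))) \<le> ?B n"
      unfolding moment_sum_def by (intro sum_mono) auto
    then have lower: "u n \<le> ln (?B n)"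
      unfolding sum_eq[symmetric] using pos by (intro ln_mono) auto
    let ?G = "\<lambda>w. exp ((t + 1) * ?S n w + (- t) * (- real n * ?h n w))"
    have "?B n \<le> (\<Sum>w\<in>words n. ?G w)"
      unfolding moment_sum_def
    proof (rule sum_mono)
      fix w :: "'a list" assume w: "w \<in> words n"
      have "real n * t * F n w \<le> real n * t * ?h n w"
        using F1[OF n w] t0 by (intro mult_left_mono_neg) (auto simp: mult_nonneg_nonpos)
      then show "exp (cyclic_sum \<phi> n w + real n * t * F n w)
          \<le> ?G w" by (simp add: b\<phi> mult_ac)
    qed
    then have "ln (?B n) \<le> ln (\<Sum>w\<in>words n. ?G w)"
      using moment_sum_pos by (intro ln_mono) auto
    also have "\<dots> \<le> (t + 1) * ln (\<Sum>w\<in>words n. exp (?S n w)) + (- t) * ln (\<Sum>w\<in>words n. exp (- real n * ?h n w))"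
      using t0 s by (intro log_sum_exp_convex) auto
    also have "\<dots> \<le> (t + 1) * z n + (- t) * ?K n"
      using t0 s kraft'[OF n] by (intro add_mono mult_left_mono) (auto simp: z_def periodic_sum_def)
    finally have "ln (?B n) \<le> v n" by (simp add: v_def)
    then show ?thesis using lower by simp
  qed
  have "(\<lambda>n. t * b (k n) + z n / real n) \<longlonglongrightarrow> t * P + P"
    by (intro tendsto_intros bk_lim z_lim)
  moreover have "\<forall>\<^sub>F n in sequentially. t * b (k n) + z n / real n = u n / real n"
    using eventually_gt_at_top[of 0] by eventually_elim (simp add: u_def add_divide_distrib)
  ultimately have "(\<lambda>n. u n / real n) \<longlonglongrightarrow> t * P + P" by (rule Lim_transform_eventually)
  then have u_lim: "(\<lambda>n. u n / real n) \<longlonglongrightarrow> (t + 1) * P" by (simp add: distrib_right)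
  have "(\<lambda>n. (t + 1) * (z n / real n) - t * (?K n / real n)) \<longlonglongrightarrow> (t + 1) * P - t * 0"
    by (intro tendsto_intros z_lim kraft)
  then have v_lim: "(\<lambda>n. v n / real n) \<longlonglongrightarrow> (t + 1) * P" by (simp add: v_def diff_divide_distrib)
  have "(\<lambda>n. ln (?B n) / real n) \<longlonglongrightarrow> (t + 1) * P"
  proof (rule tendsto_between[OF u_lim v_lim])
    show "\<forall>\<^sub>F n in sequentially. u n / real n \<le> ln (?B n) / real n \<and> ln (?B n) / real n \<le> v n / real n \<or>
       v n / real n \<le> ln (?B n) / real n \<and> ln (?B n) / real n \<le> u n / real n"
      using eventually_ge_at_top[of 1]
    proof eventually_elim
      case (elim n)
      then show ?case using between[OF elim] by (auto intro!: divide_right_mono)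
    qed
  qed
  then show ?thesis by (simp add: P_def \<psi>_def)
qed

text \<open>
For \<open>t \<le> -1\<close> and \<open>F \<ge> h\<^sub>k \<ge> 0\<close> the factor \<open>exp (n t F)\<close> is at most \<open>exp (- n h\<^sub>k)\<close>, and the Kraft inequality
gives the upper bound. The lower bound keeps one summand only, a truncated periodic word whose
orbit nearly maximises the average of \<open>\<phi>\<close> and for which \<open>F\<close> is at most of order \<open>ln k / k\<close>.
\<close>

lemma moment_sum_rate_subcritical:
  assumes t: "t \<le> -1"
  shows "(\<lambda>n. ln (moment_sum \<phi> t (F n) n) / real n) \<longlonglongrightarrow> (SUP \<eta>\<in>ergodic_measures. mean \<eta> \<phi>)"
proof -
  let ?E = "\<lambda>n w. cyclic_sum \<phi> n w + real n * t * F n w"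
  let ?K = "\<lambda>n. kraft_cost TYPE('a) n (k n)"
  define M where "M = (SUP \<eta>\<in>ergodic_measures. mean \<eta> \<phi>)"
  note sup = ergodic_supremum[OF cont, folded M_def]
  let ?B = "\<lambda>n. moment_sum \<phi> t (F n) n"
  let ?h = "\<lambda>n w :: 'a list. cyclic_h (k n) w"
  have upper: "ln (?B n) / real n \<le> M + ?K n / real n" if n: "1 \<le> n" for n
  proof -
    have "?E n w \<le> real n * M + - real n * ?h n w"
      if w: "w \<in> words n" for w
    proof -
      have w': "w \<noteq> []" "length w = n" using n w by (auto simp: words_def)
      have "cyclic_sum \<phi> n w / real n \<le> M"
        using sup(1)[OF periodic_measure_invariant[OF w'(1)]] integral_periodic_birkhoff[OF w'(1) cont] w' by simp
      then have S: "cyclic_sum \<phi> n w \<le> real n * M" using n by (simp add: field_simps)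
      obtain m where m: "k n = Suc m" using k1[OF n] by (cases "k n") auto
      have "0 \<le> ?h n w" using conditional_entropy_nonneg[OF stationary_empirical[OF w'(1)]] m by simp
      then have "0 \<le> F n w" using F1[OF n w] by linarith
      then have "t * F n w \<le> - 1 * F n w" using t by (intro mult_right_mono) auto
      also have "\<dots> \<le> - ?h n w" using F1[OF n w] by simp
      finally have "real n * (t * F n w) \<le> real n * (- ?h n w)" by (intro mult_left_mono) auto
      then show ?thesis using S by (simp add: mult.assoc)
    qed
    then have "?B n \<le> (\<Sum>w\<in>words n. exp (real n * M + - real n * ?h n w))"
      unfolding moment_sum_def by (intro sum_mono) auto
    also have "\<dots> = exp (real n * M) * (\<Sum>w\<in>words n. exp (- real n * ?h n w))"
      by (simp only: exp_add sum_distrib_left)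
    finally have "ln (?B n) \<le> ln (exp (real n * M) * (\<Sum>w\<in>words n. exp (- real n * ?h n w)))"
      using moment_sum_pos by (intro ln_mono) auto
    also have "\<dots> = real n * M + ln (\<Sum>w\<in>words n. exp (- real n * ?h n w))"
      by (subst ln_mult_pos) (auto intro!: sum_pos)
    also have "\<dots> \<le> real n * M + ?K n"
      using kraft_empirical[OF n k1[OF n], where 'a = 'a] by simp
    finally have "ln (?B n) / real n \<le> (real n * M + ?K n) / real n"
      by (rule divide_right_mono) simp
    then show ?thesis using n by (simp add: add_divide_distrib)
  qed
  have lower: "\<forall>\<^sub>F n in sequentially. M - e < ln (?B n) / real n" if e: "0 < e" for e
  proof -
    obtain v where v: "v \<noteq> []" "M - e < mean (periodic_measure v) \<phi>" using sup(2)[OF e] by blast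
    let ?c = "mean (periodic_measure v) \<phi>"
    let ?x = "periodic_extension v"
    let ?l = "\<lambda>n. ln (real (length v) + real (k n)) / real (k n)"
    define l where "l n = birkhoff \<phi> n ?x / real n - distortion \<phi> n / real n
        + t * (?l n)" for n
    have "(\<lambda>m. ln (real (length v) + real m) / real m) \<longlonglongrightarrow> 0" by real_asymp
    from filterlim_compose[OF this k]
    have "(\<lambda>n. ?l n) \<longlonglongrightarrow> 0" .
    then have "l \<longlonglongrightarrow> ?c - 0 + t * 0"
      unfolding l_def integral_periodic_birkhoff[OF v(1) cont]
      by (intro tendsto_intros birkhoff_periodic[OF v(1)] distortion_tendsto[OF cont])
    then have "\<forall>\<^sub>F n in sequentially. M - e < l n" using v(2) by (intro order_tendstoD(1)) auto
    then show ?thesis using eventually_ge_at_top[of 1]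
    proof eventually_elim
      case (elim n)
      then have n: "1 \<le> n" by simp
      define w where "w = initial n ?x"
      have w: "w \<in> words n" by (simp add: w_def)
      have "\<bar>cyclic_sum \<phi> n w - birkhoff \<phi> n ?x\<bar> \<le> distortion \<phi> n"
        by (rule birkhoff_distortion[OF cont]) (simp add: w_def)
      then have S: "birkhoff \<phi> n ?x - distortion \<phi> n \<le> cyclic_sum \<phi> n w" by linarith
      have "F n w \<le> ?l n"
        using block_entropy_periodic_le[OF v(1) n, of "k n"]
        by (intro order_trans[OF F2[OF n w]] divide_right_mono) (simp_all add: w_def)
      then have "real n * t * (?l n) \<le> real n * t * F n w"
        using t by (intro mult_left_mono_neg) (auto simp: mult_nonneg_nonpos)
      moreover have "real n * l n = birkhoff \<phi> n ?x - distortion \<phi> n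
          + real n * t * (?l n)"
        using n by (simp add: l_def distrib_left right_diff_distrib)
      ultimately have "real n * l n \<le> ?E n w"
        using S by linarith
      also have "\<dots> = ln (exp (?E n w))" by simp
      also have "\<dots> \<le> ln (?B n)"
      proof (rule ln_mono)
        show "exp (?E n w) \<le> ?B n"
          unfolding moment_sum_def
          using member_le_sum[OF w, of "\<lambda>w. exp (?E n w)"] by simp
      qed auto
      finally have "l n \<le> ln (?B n) / real n" using n by (simp add: field_simps)
      then show ?case using elim by linarith
    qed
  qed
  have up_lim: "(\<lambda>n. M + ?K n / real n) \<longlonglongrightarrow> M + 0"
    by (intro tendsto_intros kraft)
  have "(\<lambda>n. ln (?B n) / real n) \<longlonglongrightarrow> M"
  proof (rule order_tendstoI)
    fix a assume "a < M"
    then show "\<forall>\<^sub>F n in sequentially. a < ln (?B n) / real n" using lower[of "M - a"] by simp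
  next
    fix a assume "M < a"
    then have "\<forall>\<^sub>F n in sequentially. M + ?K n / real n < a"
      using up_lim by (intro order_tendstoD(2)) auto
    then show "\<forall>\<^sub>F n in sequentially. ln (?B n) / real n < a"
      using eventually_ge_at_top[of 1]
    proof eventually_elim
      case (elim n)
      then show ?case using upper[of n] by linarith
    qed
  qed
  then show ?thesis by (simp add: M_def)
qed

lemma g_measure_moment_limit:
  assumes "g_measure g \<rho>" "\<phi> = (\<lambda>x. ln (g x))"
  shows "(\<lambda>n. 1 / real n * ln (\<integral>x. exp (real n * t * F n (initial n x)) \<partial>\<rho>)) \<longlonglongrightarrow> pressure_R \<phi> t"
proof -
  have B: "(\<lambda>n. ln (moment_sum \<phi> t (F n) n) / real n) \<longlonglongrightarrow> pressure_R \<phi> t"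
    using moment_sum_rate_supercritical[of t] moment_sum_rate_subcritical[of t]
    by (auto simp: pressure_R_def)
  have "(\<lambda>n. ln (\<integral>x. exp (real n * t * F n (initial n x)) \<partial>\<rho>) / real n - ln (moment_sum \<phi> t (F n) n) / real n) \<longlonglongrightarrow> 0"
    using g_measure_moment[OF assms(1)]
    by (intro Lim_null_comparison[OF _ distortion_tendsto[OF cont]] always_eventually allI)
       (simp add: assms(2) divide_right_mono abs_divide flip: diff_divide_distrib)
  from tendsto_add[OF this B] show ?thesis by simp
qed

end

section \<open>Duality\<close>

lemma periodic_measure_entropy:
  fixes v :: "'a::{finite,discrete_topology} list"
  assumes "v \<noteq> []"
  shows "h (periodic_measure v) = 0"
proof -
  note st = stationary_weights[OF periodic_measure_invariant[OF assms]]
  have "H k (weights (periodic_measure v)) / real k \<le> ln (real (length v) + real k) / real k" for k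
    using block_entropy_periodic_le[OF assms, of "length v" k] assms
    by (intro divide_right_mono) (simp_all add: weights_periodic_measure[OF assms] initial_periodic_extension Suc_le_eq)
  moreover have "(\<lambda>k. ln (real (length v) + real k) / real k) \<longlonglongrightarrow> 0" by real_asymp
  ultimately have "entropy_rate (weights (periodic_measure v)) \<le> 0"
    by (intro LIMSEQ_le[OF entropy_increments_tendsto(2)[OF st]]) auto
  then show ?thesis using entropy_rate_bounds(1)[OF st] by (simp add: ks_entropy_eq)
qed

lemma uniform_measure_exists:
  "\<exists>\<nu>\<in>(\<M> :: 'a::{finite,discrete_topology} process set). h \<nu> = ln (real CARD('a))"
proof -
  define p where "p a = 1 / real CARD('a) ^ length a" for a :: "'a list"
  have st: "stationary p" by (simp add: stationary_def p_def)
  then obtain \<nu> where \<nu>: "\<nu> \<in> \<M>" "\<And>a. weights \<nu> a = p a"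
    using invariant_measure_exists by blast
  have "H k p = real k * ln (real CARD('a))" for k
  proof -
    have "H k p = - (\<Sum>a\<in>(words k :: 'a list set). 1 / real CARD('a) ^ k * ln (1 / real CARD('a) ^ k))"
      unfolding block_entropy_def by (intro arg_cong[of _ _ uminus] sum.cong) (auto simp: p_def words_def)
    then show ?thesis by (simp add: card_words ln_div ln_realpow)
  qed
  then have "(\<lambda>k. H k p / real k) = (\<lambda>k. if k = 0 then 0 else ln (real CARD('a)))"
    by (auto simp: fun_eq_iff)
  moreover have "(\<lambda>k. if k = 0 then 0 else ln (real CARD('a))) \<longlonglongrightarrow> ln (real CARD('a))"
  proof (rule Lim_transform_eventually[OF tendsto_const])
    show "\<forall>\<^sub>F k in sequentially. ln (real CARD('a)) = (if k = 0 then 0 else ln (real CARD('a)))"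
      using eventually_gt_at_top[of 0] by eventually_elim simp
  qed
  ultimately have "entropy_rate p = ln (real CARD('a))"
    using entropy_increments_tendsto(2)[OF st] LIMSEQ_unique by metis
  then show ?thesis using \<nu> by (intro bexI[of _ \<nu>]) (simp_all add: ks_entropy_eq)
qed

lemma invariant_measures_convex:
  fixes \<phi> :: "'a::{finite,discrete_topology} observable"
  assumes "continuous_on UNIV \<phi>" "\<nu>\<^sub>1 \<in> \<M>" "\<nu>\<^sub>2 \<in> \<M>" "0 < s" "s < 1"
  shows "\<exists>\<nu>\<in>\<M>. h \<nu> = s * h \<nu>\<^sub>1 + (1 - s) * h \<nu>\<^sub>2 \<and>
     mean \<nu> \<phi> = s * mean (\<nu>\<^sub>1) \<phi> + (1 - s) * mean (\<nu>\<^sub>2) \<phi>"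
proof -
  note st = stationary_weights[OF assms(2)] stationary_weights[OF assms(3)]
  obtain \<nu> where \<nu>: "\<nu> \<in> \<M>" "\<And>a. weights \<nu> a = s * weights \<nu>\<^sub>1 a + (1 - s) * weights \<nu>\<^sub>2 a"
    using invariant_measure_exists[OF stationary_convex[OF st, of s]] assms(4,5) by auto
  have "h \<nu> = s * h \<nu>\<^sub>1 + (1 - s) * h \<nu>\<^sub>2"
    unfolding ks_entropy_eq \<nu>(2) by (rule entropy_rate_affine[OF st assms(4,5)])
  moreover have "mean \<nu> \<phi> = (\<Sum>b\<in>UNIV. (if b then s else 1 - s) * (\<integral>x. \<phi> x \<partial>(if b then \<nu>\<^sub>1 else \<nu>\<^sub>2)))"
    using assms \<nu> by (intro integral_mixture) (auto simp: UNIV_bool)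
  ultimately show ?thesis using \<nu>(1) by (intro bexI[of _ \<nu>]) (auto simp: UNIV_bool)
qed

lemma entropy_values:
  assumes "0 \<le> u" "u \<le> ln (real CARD('a::{finite,discrete_topology}))"
  shows "\<exists>\<nu>\<in>(\<M> :: 'a process set). h \<nu> = u"
proof -
  let ?L = "ln (real CARD('a))"
  obtain \<mu> :: "'a process" where \<mu>: "\<mu> \<in> \<M>" "h \<mu> = ?L"
    using uniform_measure_exists by blast
  let ?\<pi> = "periodic_measure [undefined] :: 'a process"
  have \<pi>: "?\<pi> \<in> \<M>" "h ?\<pi> = 0"
    by (simp_all add: periodic_measure_invariant periodic_measure_entropy)
  consider "u = 0" | "u = ?L" | "0 < u" "u < ?L" using assms by linarith
  then show ?thesis
  proof cases
    case 3
    then have "0 < ?L" by linarith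
    then have "0 < u / ?L" "u / ?L < 1" using 3 by (simp_all add: divide_less_eq del: ln_gt_zero_iff)
    from invariant_measures_convex[OF continuous_on_const[of _ 0] \<mu>(1) \<pi>(1) this]
    obtain \<nu> :: "'a process" where "\<nu> \<in> \<M>" "h \<nu> = u / ?L * ?L"
      using \<mu>(2) \<pi>(2) by auto
    then show ?thesis using 3 by (intro bexI[of _ \<nu>]) auto
  qed (use \<mu> \<pi> in blast)+
qed

lemma ks_entropy_bounds:
  fixes \<nu> :: "'a::{finite,discrete_topology} process"
  assumes "\<nu> \<in> \<M>"
  shows "0 \<le> h \<nu>" "h \<nu> \<le> ln (real CARD('a))"
  using entropy_rate_bounds[OF stationary_weights[OF assms]] by (simp_all add: ks_entropy_eq)

text \<open>
A single formula for both branches of \<open>pressure_R\<close>. For \<open>t \<le> -1\<close> the coefficient of the entropy is not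
positive, so the zero-entropy measures on periodic orbits are optimal up to arbitrarily small errors.
\<close>

lemma pressure_R_supremum:
  fixes \<phi> :: "'a::{finite,discrete_topology} observable"
  assumes "continuous_on UNIV \<phi>"
  shows "\<And>\<nu>. \<nu> \<in> \<M> \<Longrightarrow> (t + 1) * h \<nu> + mean \<nu> \<phi> \<le> pressure_R \<phi> t"
    and "\<And>e. 0 < e \<Longrightarrow> \<exists>\<nu>\<in>\<M>. pressure_R \<phi> t - e < (t + 1) * h \<nu> + mean \<nu> \<phi>"
proof -
  let ?v = "\<lambda>\<nu>. (t + 1) * h \<nu> + mean \<nu> \<phi>"
  have "(\<forall>\<nu>\<in>\<M>. ?v \<nu> \<le> pressure_R \<phi> t) \<and>
    (\<forall>e>0. \<exists>\<nu>\<in>\<M>. pressure_R \<phi> t - e < ?v \<nu>)"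
  proof (cases "-1 < t")
    case True
    then have s: "0 < t + 1" by simp
    have "continuous_on UNIV (\<lambda>x. \<phi> x / (t + 1))" using s by (intro continuous_intros assms) auto
    note vp = variational_principle[OF this]
    have eq: "?v \<nu> = (t + 1) * (h \<nu> + (\<integral>x. \<phi> x / (t + 1) \<partial>\<nu>))" for \<nu>
      using s by (simp add: distrib_left)
    obtain \<mu> where \<mu>: "\<mu> \<in> \<M>" "(t + 1) * h \<mu> + mean \<mu> \<phi> = pressure_R \<phi> t"
      using vp(3) True unfolding eq by (auto simp: pressure_R_def)
    have "?v \<nu> \<le> pressure_R \<phi> t" if "\<nu> \<in> \<M>" for \<nu>
      unfolding eq using True vp(2)[OF that] by (simp add: pressure_R_def)
    then show ?thesis using \<mu> by (auto intro!: bexI[of _ \<mu>])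
  next
    case False
    note sup = ergodic_supremum[OF assms]
    have R: "pressure_R \<phi> t = (SUP \<eta>\<in>ergodic_measures. mean \<eta> \<phi>)" using False by (simp add: pressure_R_def)
    have "?v \<nu> \<le> pressure_R \<phi> t" if "\<nu> \<in> \<M>" for \<nu>
      using sup(1)[OF that] mult_nonpos_nonneg[of "t + 1" "h \<nu>"] ks_entropy_bounds(1)[OF that] False
      unfolding R by linarith
    moreover have "\<exists>\<nu>\<in>\<M>. pressure_R \<phi> t - e < ?v \<nu>" if e: "0 < e" for e
    proof -
      obtain v where "v \<noteq> []" "pressure_R \<phi> t - e < mean (periodic_measure v) \<phi>"
        using sup(2)[OF e] unfolding R by blast
      then show ?thesis
        by (intro bexI[of _ "periodic_measure v"]) (simp_all add: periodic_measure_entropy periodic_measure_invariant)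
    qed
    ultimately show ?thesis by blast
  qed
  then show "\<And>\<nu>. \<nu> \<in> \<M> \<Longrightarrow> ?v \<nu> \<le> pressure_R \<phi> t"
    and "\<And>e. 0 < e \<Longrightarrow> \<exists>\<nu>\<in>\<M>. pressure_R \<phi> t - e < ?v \<nu>"
    by blast+
qed

lemma pressure_R_convex:
  fixes \<phi> :: "'a::{finite,discrete_topology} observable"
  assumes "continuous_on UNIV \<phi>"
  shows "convex_on UNIV (pressure_R \<phi>)"
proof (rule convex_onI)
  fix s x y :: real assume s: "0 < s" "s < 1"
  let ?R = "pressure_R \<phi>"
  note R = pressure_R_supremum[OF assms]
  show "?R ((1 - s) *\<^sub>R x + s *\<^sub>R y) \<le> (1 - s) * ?R x + s * ?R y"
  proof (rule field_le_epsilon)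
    fix e :: real assume "0 < e"
    then obtain \<nu> where \<nu>: "\<nu> \<in> \<M>"
      "?R ((1 - s) *\<^sub>R x + s *\<^sub>R y) - e < ((1 - s) *\<^sub>R x + s *\<^sub>R y + 1) * h \<nu> + mean \<nu> \<phi>"
      using R(2) by blast
    have "((1 - s) *\<^sub>R x + s *\<^sub>R y + 1) * h \<nu> + mean \<nu> \<phi>
       = (1 - s) * ((x + 1) * h \<nu> + mean \<nu> \<phi>) + s * ((y + 1) * h \<nu> + mean \<nu> \<phi>)"
      by (simp add: algebra_simps)
    also have "\<dots> \<le> (1 - s) * ?R x + s * ?R y"
      using s by (intro add_mono mult_left_mono R(1) \<nu>(1)) auto
    finally show "?R ((1 - s) *\<^sub>R x + s *\<^sub>R y) \<le> (1 - s) * ?R x + s * ?R y + e" using \<nu>(2) by linarith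
  qed
qed auto

text \<open>
A supporting line, above the level \<open>u\<close> in the interior of the range of \<open>h\<close>, of the set of points
\<open>(h x, e x)\<close>. By mixing, the slopes of the chords from \<open>(u, G)\<close> to the points on the right are at most
those to the points on the left, and the supremum of the former serves as the slope.
\<close>

lemma supporting_slope:
  fixes h e :: "'m \<Rightarrow> real"
  assumes mix: "\<And>x y s. x \<in> S \<Longrightarrow> y \<in> S \<Longrightarrow> 0 < s \<Longrightarrow> s < 1 \<Longrightarrow>
      \<exists>z\<in>S. h z = s * h x + (1 - s) * h y \<and> e z = s * e x + (1 - s) * e y"
    and "x\<^sub>1 \<in> S" "h x\<^sub>1 < u" "x\<^sub>2 \<in> S" "u < h x\<^sub>2"
    and G: "\<And>x. x \<in> S \<Longrightarrow> h x = u \<Longrightarrow> e x \<le> G"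
  shows "\<exists>s. \<forall>x\<in>S. e x + s * (h x - u) \<le> G"
proof -
  have slopes: "(e y - G) / (h y - u) \<le> (G - e x) / (u - h x)"
    if x: "x \<in> S" "h x < u" and y: "y \<in> S" "u < h y" for x y
  proof -
    define s where "s = (h y - u) / (h y - h x)"
    have s: "0 < s" "s < 1" using x y by (auto simp: s_def)
    have d: "0 < h y - h x" using x y by simp
    have s1: "1 - s = (u - h x) / (h y - h x)" using d by (simp add: s_def field_simps)
    obtain z where z: "z \<in> S" "h z = s * h x + (1 - s) * h y" "e z = s * e x + (1 - s) * e y"
      using mix[OF x(1) y(1) s] by blast
    have "h z = ((h y - u) * h x + (u - h x) * h y) / (h y - h x)"
      unfolding z(2) s1 by (simp add: s_def add_divide_distrib)
    also have "(h y - u) * h x + (u - h x) * h y = u * (h y - h x)" by (simp add: algebra_simps)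
    finally have "h z = u" using d by simp
    then have "e z \<le> G" using G z(1) by blast
    moreover have "e z = ((h y - u) * e x + (u - h x) * e y) / (h y - h x)"
      unfolding z(3) s1 by (simp add: s_def add_divide_distrib)
    ultimately have "(h y - u) * e x + (u - h x) * e y \<le> G * (h y - h x)"
      using d by (simp add: divide_le_eq)
    then have "(e y - G) * (u - h x) \<le> (G - e x) * (h y - u)" by (simp add: algebra_simps)
    then show ?thesis using x y by (simp add: divide_le_eq le_divide_eq mult.commute)
  qed
  let ?Y = "{y \<in> S. u < h y}" and ?f = "\<lambda>y. (e y - G) / (h y - u)"
  define \<sigma> where "\<sigma> = (SUP y\<in>?Y. ?f y)"
  have bdd: "bdd_above (?f ` ?Y)" using slopes[OF assms(2,3)] by (intro bdd_aboveI2) auto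
  have "e x + (- \<sigma>) * (h x - u) \<le> G" if x: "x \<in> S" for x
  proof -
    consider "h x = u" | "u < h x" | "h x < u" by linarith
    then show ?thesis
    proof cases
      case 1
      then show ?thesis using G x by simp
    next
      case 2
      then have "?f x \<le> \<sigma>" unfolding \<sigma>_def using x by (intro cSUP_upper bdd) auto
      then show ?thesis using 2 by (simp add: divide_le_eq)
    next
      case 3
      have "\<sigma> \<le> (G - e x) / (u - h x)"
        unfolding \<sigma>_def using slopes[OF x 3] assms(4,5) by (intro cSUP_least) auto
      then have "\<sigma> * (u - h x) \<le> G - e x" using 3 by (simp add: le_divide_eq)
      then show ?thesis by (simp add: algebra_simps)
    qed
  qed
  then show ?thesis by blast
qed

text \<open>
At entropy 0 a horizontal line works, because periodic orbit measures have zero entropy. At the maximal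
entropy steeper and steeper lines are tried: measures violating all of them would have a cluster
point with maximal entropy and too large an integral.
\<close>

lemma supporting_line:
  fixes \<phi> :: "'a::{finite,discrete_topology} observable"
  assumes cont: "continuous_on UNIV \<phi>" and u: "0 \<le> u" "u \<le> ln (real CARD('a))" and d: "0 < d"
    and G: "\<And>\<nu>. \<nu> \<in> \<M> \<Longrightarrow> h \<nu> = u \<Longrightarrow> mean \<nu> \<phi> \<le> G"
  shows "\<exists>s. \<forall>\<nu>\<in>\<M>. mean \<nu> \<phi> + s * (h \<nu> - u) \<le> G + d"
proof -
  let ?L = "ln (real CARD('a))"
  let ?e = "\<lambda>\<nu>. mean \<nu> \<phi>"
  note sup = ergodic_supremum[OF cont]
  define M where "M = (SUP \<eta>\<in>ergodic_measures. mean \<eta> \<phi>)"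
  consider "u = 0" | "0 < u" "u < ?L" | "u = ?L" "0 < u" using u by linarith
  then show ?thesis
  proof cases
    case 1
    obtain v where v: "v \<noteq> []" "M - d < ?e (periodic_measure v)" using sup(2)[OF d] unfolding M_def by blast
    then have "?e (periodic_measure v) \<le> G"
      using G[OF periodic_measure_invariant] 1 by (simp add: periodic_measure_entropy)
    then have "?e \<nu> \<le> G + d" if "\<nu> \<in> \<M>" for \<nu>
      using sup(1)[OF that] v(2) unfolding M_def by linarith
    then show ?thesis by (intro exI[of _ 0]) auto
  next
    case 2
    obtain \<mu> :: "'a process" where \<mu>: "\<mu> \<in> \<M>" "h \<mu> = ?L"
      using entropy_values[of ?L] u by force
    obtain \<pi> :: "'a process" where \<pi>: "\<pi> \<in> \<M>" "h \<pi> = 0"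
      using entropy_values[of 0] u by force
    have "\<exists>s. \<forall>\<nu>\<in>\<M>. ?e \<nu> + s * (h \<nu> - u) \<le> G"
      by (rule supporting_slope[where x\<^sub>1 = \<pi> and x\<^sub>2 = \<mu>])
         (use invariant_measures_convex[OF cont] \<mu> \<pi> 2 G in auto)
    then obtain s where s: "\<And>\<nu>. \<nu> \<in> \<M> \<Longrightarrow> ?e \<nu> + s * (h \<nu> - u) \<le> G" by blast
    show ?thesis
    proof (intro exI[of _ s] ballI)
      fix \<nu> :: "'a process" assume "\<nu> \<in> \<M>"
      then show "?e \<nu> + s * (h \<nu> - u) \<le> G + d" using s[of \<nu>] d by linarith
    qed
  next
    case 3
    show ?thesis
    proof (rule ccontr)
      assume no: "\<not> ?thesis"
      \<comment> \<open>The lines with slopes \<open>0, -1, -2, ...\<close> all fail.\<close>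
      have "\<exists>\<nu>\<in>\<M>. G + d < ?e \<nu> + real n * (h \<nu> - u)" for n
        using no by (meson not_le)
      then obtain \<nu> where \<nu>: "\<And>n. \<nu> n \<in> \<M>"
        "\<And>n. G + d < ?e (\<nu> n) + real n * (h (\<nu> n) - u)" by metis
      have e_gt: "G + d < ?e (\<nu> n)" for n
        using \<nu>(2)[of n] mult_nonneg_nonpos[of "real n" "h (\<nu> n) - u"] ks_entropy_bounds(2)[OF \<nu>(1)] 3
        by auto
      \<comment> \<open>As the integrals are bounded, a steep slope forces the entropy to be nearly maximal.\<close>
      have h_gt: "u - (M - G) / real n \<le> h (\<nu> n)" if n: "1 \<le> n" for n
      proof -
        have "real n * (u - h (\<nu> n)) \<le> M - G"
          using \<nu>(2)[of n] sup(1)[OF \<nu>(1), of n] d unfolding M_def right_diff_distrib by linarith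
        then show ?thesis using n by (simp add: field_simps)
      qed
      obtain r \<mu> where r: "strict_mono (r :: nat \<Rightarrow> nat)" and \<mu>: "\<mu> \<in> \<M>"
        and w: "\<And>a. (\<lambda>n. weights (\<nu> (r n)) a) \<longlonglongrightarrow> weights \<mu> a"
        and i: "(\<lambda>n. ?e (\<nu> (r n))) \<longlonglongrightarrow> ?e \<mu>"
        using invariant_measures_compact[of \<nu>, OF \<nu>(1)] cont by blast
      have "u \<le> H k (weights \<mu>) / real k" if k: "1 \<le> k" for k
      proof (rule LIMSEQ_le)
        have "(\<lambda>n. (M - G) / real (r n)) \<longlonglongrightarrow> 0"
          by (rule filterlim_compose[OF lim_const_over_n filterlim_subseq[OF r]])
        from tendsto_diff[OF tendsto_const[of u] this]
        show "(\<lambda>n. u - (M - G) / real (r n)) \<longlonglongrightarrow> u" by simp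
        show "(\<lambda>n. H k (weights (\<nu> (r n))) / real k) \<longlonglongrightarrow> H k (weights \<mu>) / real k"
          using k by (intro tendsto_divide tendsto_const block_entropy_tendsto w) auto
        show "\<exists>N. \<forall>n\<ge>N. u - (M - G) / real (r n) \<le> H k (weights (\<nu> (r n))) / real k"
        proof (intro exI[of _ 1] allI impI)
          fix n :: nat assume "1 \<le> n"
          then have "1 \<le> r n" using seq_suble[OF r, of n] by simp
          from h_gt[OF this] show "u - (M - G) / real (r n) \<le> H k (weights (\<nu> (r n))) / real k"
            using entropy_rate_le[OF stationary_weights[OF \<nu>(1)[of "r n"]] k] by (simp add: ks_entropy_eq)
        qed
      qed
      then have "u \<le> h \<mu>"
        unfolding ks_entropy_eq
        by (intro LIMSEQ_le_const[OF entropy_increments_tendsto(2)[OF stationary_weights[OF \<mu>]]]) auto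
      then have "h \<mu> = u" using ks_entropy_bounds(2)[OF \<mu>] 3 by simp
      moreover have "G + d \<le> ?e \<mu>" using e_gt by (intro LIMSEQ_le_const[OF i]) (auto intro: less_imp_le)
      ultimately show False using G[OF \<mu>] d by simp
    qed
  qed
qed

text \<open>
That \<open>R\<close> is the conjugate of \<open>I\<close> restates \<open>pressure_R_supremum\<close>, with the supremum over \<open>\<nu>\<close> taken in
two steps, first at fixed entropy. For the converse, outside the range of the entropy the linear growth of
\<open>R\<close> makes the supremum infinite, and inside it a supporting line at level \<open>u\<close> with slope \<open>- s\<close>
is nearly optimal at \<open>t = s - 1\<close>.
\<close>

lemma legendre_duality:
  fixes \<phi> :: "'a::{finite,discrete_topology} observable"
  assumes cont: "continuous_on UNIV \<phi>"
    and rel: "\<And>\<nu>. \<nu> \<in> \<M> \<Longrightarrow> relative_entropy \<nu> \<rho> = - h \<nu> - mean \<nu> \<phi>"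
  shows "legendre_dual (rate_I \<rho>) (pressure_R \<phi>)"
proof -
  let ?L = "ln (real CARD('a))" and ?R = "pressure_R \<phi>" and ?I = "rate_I \<rho>"
  let ?e = "\<lambda>\<nu>. mean \<nu> \<phi>"
  note R = pressure_R_supremum[OF cont]
  have I_le: "?I (h \<nu>) \<le> ereal (- h \<nu> - ?e \<nu>)" if \<nu>: "\<nu> \<in> \<M>" for \<nu>
    using \<nu> ks_entropy_bounds[OF \<nu>] by (auto simp: rate_I_def rel[symmetric] intro!: INF_lower)
  have young: "ereal (t * u - ?R t) \<le> ?I u" for t u
  proof (cases "u \<in> {0..?L}")
    case True
    have "ereal (t * u - ?R t) \<le> ereal (relative_entropy \<nu> \<rho>)"
      if "\<nu> \<in> \<M>" "h \<nu> = u" for \<nu>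
      using R(1)[OF that(1), of t] that by (simp add: rel algebra_simps)
    then show ?thesis using True by (auto simp: rate_I_def intro!: INF_greatest)
  qed (auto simp: rate_I_def)
  have R_le: "?R t \<le> b" if "\<And>\<nu>. \<nu> \<in> \<M> \<Longrightarrow> (t + 1) * h \<nu> + ?e \<nu> \<le> b" for t b
  proof (rule field_le_epsilon)
    fix e :: real assume "0 < e"
    then obtain \<nu> where "\<nu> \<in> \<M>" "?R t - e < (t + 1) * h \<nu> + ?e \<nu>" using R(2) by blast
    then show "?R t \<le> b + e" using that[of \<nu>] by linarith
  qed
  define M where "M = (SUP \<eta>\<in>ergodic_measures. ?e \<eta>)"
  have e_le_M: "?e \<nu> \<le> M" if "\<nu> \<in> \<M>" for \<nu>
    unfolding M_def by (rule ergodic_supremum(1)[OF cont that])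
  have "ereal (?R t) = (SUP u. ereal (t * u) - ?I u)" for t
  proof (rule antisym)
    show "(SUP u. ereal (t * u) - ?I u) \<le> ereal (?R t)"
    proof (rule SUP_least)
      fix u
      have "ereal (t * u) - ?I u \<le> ereal (t * u) - ereal (t * u - ?R t)"
        by (intro ereal_minus_mono young order_refl)
      then show "ereal (t * u) - ?I u \<le> ereal (?R t)" by simp
    qed
    show "ereal (?R t) \<le> (SUP u. ereal (t * u) - ?I u)"
    proof (rule ereal_le_epsilon2)
      fix e :: real assume "0 < e"
      then obtain \<nu> where \<nu>: "\<nu> \<in> \<M>" "?R t - e < (t + 1) * h \<nu> + ?e \<nu>" using R(2) by blast
      let ?u = "h \<nu>"
      have "ereal (?R t - e) \<le> ereal (t * ?u) - ereal (- ?u - ?e \<nu>)"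
        using \<nu>(2) by (simp add: algebra_simps)
      also have "\<dots> \<le> ereal (t * ?u) - ?I ?u" by (intro ereal_minus_mono I_le \<nu>(1) order_refl)
      also have "\<dots> \<le> (SUP u. ereal (t * u) - ?I u)" by (rule SUP_upper) simp
      finally have "ereal (?R t - e) + ereal e \<le> (SUP u. ereal (t * u) - ?I u) + ereal e"
        by (rule add_right_mono)
      then show "ereal (?R t) \<le> (SUP u. ereal (t * u) - ?I u) + ereal e" by simp
    qed
  qed
  moreover have "?I u = (SUP t. ereal (t * u - ?R t))" for u
  proof (rule antisym)
    show "(SUP t. ereal (t * u - ?R t)) \<le> ?I u" by (intro SUP_least young)
    show "?I u \<le> (SUP t. ereal (t * u - ?R t))"
    proof -
      consider "u < 0" | "?L < u" | "0 \<le> u" "u \<le> ?L" by linarith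
      then show ?thesis
      proof cases
        case 1
        have "\<exists>t\<in>UNIV. ereal (real n) \<le> ereal (t * u - ?R t)" for n
        proof (intro bexI[of _ "min (-1) ((real n + M) / u)"])
          let ?t = "min (-1) ((real n + M) / u)"
          have "?R ?t \<le> M"
          proof (rule R_le)
            fix \<nu> :: "'a process" assume \<nu>: "\<nu> \<in> \<M>"
            have "(?t + 1) * h \<nu> \<le> 0"
              using ks_entropy_bounds(1)[OF \<nu>] by (intro mult_nonpos_nonneg) auto
            then show "(?t + 1) * h \<nu> + ?e \<nu> \<le> M" using e_le_M[OF \<nu>] by linarith
          qed
          moreover have "(real n + M) / u * u \<le> ?t * u" using 1 by (intro mult_right_mono_neg) auto
          ultimately show "ereal (real n) \<le> ereal (?t * u - ?R ?t)" using 1 by simp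
        qed simp
        then show ?thesis by (subst SUP_PInfty) auto
      next
        case 2
        have "\<exists>t\<in>UNIV. ereal (real n) \<le> ereal (t * u - ?R t)" for n
        proof -
          define t where "t = max 0 ((real n + ?L + M) / (u - ?L))"
          have "?R t \<le> (t + 1) * ?L + M"
            using ks_entropy_bounds(2) e_le_M by (intro R_le add_mono mult_left_mono) (auto simp: t_def)
          moreover have "(real n + ?L + M) / (u - ?L) * (u - ?L) \<le> t * (u - ?L)"
            unfolding t_def using 2 by (intro mult_right_mono) auto
          then have "real n + ?L + M \<le> t * (u - ?L)" using 2 by simp
          ultimately have "real n \<le> t * u - ?R t" by (simp add: algebra_simps)
          then have "ereal (real n) \<le> ereal (t * u - ?R t)" by simp
          then show ?thesis by blast
        qed
        then show ?thesis by (subst SUP_PInfty) auto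
      next
        case 3
        let ?S = "{\<nu> \<in> (\<M> :: 'a process set). h \<nu> = u}"
        define G where "G = (SUP \<nu>\<in>?S. ?e \<nu>)"
        have ne: "?S \<noteq> {}" using entropy_values[OF 3] by blast
        have bdd: "bdd_above (?e ` ?S)" using e_le_M by (intro bdd_aboveI2) auto
        have G: "?e \<nu> \<le> G" if "\<nu> \<in> \<M>" "h \<nu> = u" for \<nu>
          unfolding G_def using that by (intro cSUP_upper bdd) auto
        show ?thesis
        proof (rule ereal_le_epsilon2)
          fix e :: real assume e: "0 < e"
          then have "G - e / 2 < G" by simp
          then obtain \<nu> where \<nu>: "\<nu> \<in> \<M>" "h \<nu> = u" "G - e / 2 < ?e \<nu>"
            unfolding G_def less_cSUP_iff[OF ne bdd] by blast
          obtain s where s: "\<And>\<nu>. \<nu> \<in> \<M> \<Longrightarrow> ?e \<nu> + s * (h \<nu> - u) \<le> G + e / 2"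
            using supporting_line[OF cont 3, of "e / 2" G] G e by auto
          have "?R (s - 1) \<le> G + e / 2 + s * u"
            using s by (intro R_le) (simp add: algebra_simps)
          have "?I u \<le> ereal (- u - ?e \<nu>)" using I_le[OF \<nu>(1)] \<nu>(2) by simp
          also have "\<dots> \<le> ereal ((s - 1) * u - ?R (s - 1)) + ereal e"
            using \<open>?R (s - 1) \<le> G + e / 2 + s * u\<close> \<nu>(3) by (simp add: algebra_simps)
          also have "\<dots> \<le> (SUP t. ereal (t * u - ?R t)) + ereal e"
            by (intro add_right_mono SUP_upper) simp
          finally show "?I u \<le> (SUP t. ereal (t * u - ?R t)) + ereal e" .
        qed
      qed
    qed
  qed
  ultimately show ?thesis by (simp add: legendre_dual_def)
qed

theorem proposition3p4:
  fixes g :: "(nat \<Rightarrow> 'a::{finite,discrete_topology}) \<Rightarrow> real"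
    and \<rho> :: "(nat \<Rightarrow> 'a) measure"
    and k :: "nat \<Rightarrow> nat"
    and \<epsilon> :: real
  assumes "g_measure g \<rho>"
    and "\<And>n. n \<ge> 1 \<Longrightarrow> k n \<ge> 1"
    and "filterlim k at_top sequentially"
    and "0 < \<epsilon>" and "\<epsilon> < 1"
    and "\<forall>\<^sub>F n in sequentially. real (k n) \<le> (1 - \<epsilon>) / ln (real CARD('a)) * ln (real n)"
  shows "convex_on UNIV (pressure_R (\<lambda>x. ln (g x)))
    \<and> legendre_dual (rate_I \<rho>) (pressure_R (\<lambda>x. ln (g x)))
    \<and> (\<forall>t::real.
         (\<lambda>n. 1 / real n * ln (\<integral>x. exp (real n * t
               * empirical_conditional_entropy (k n) (initial n x)) \<partial>\<rho>))
           \<longlonglongrightarrow> pressure_R (\<lambda>x. ln (g x)) t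
       \<and> (\<lambda>n. 1 / real n * ln (\<integral>x. exp (real n * t
               * (empirical_block_entropy (k n) (initial n x) / real (k n))) \<partial>\<rho>))
           \<longlonglongrightarrow> pressure_R (\<lambda>x. ln (g x)) t)"
proof (intro conjI allI)
  let ?R = "pressure_R (\<lambda>x. ln (g x))"
  have g: "g_function g" using assms(1) by (simp add: g_measure_def)
  note cont = g_functionD(2)[OF g]
  show "convex_on UNIV (?R)" by (rule pressure_R_convex[OF cont])
  show "legendre_dual (rate_I \<rho>) (?R)"
    by (rule legendre_duality[OF cont relative_entropy_g_measure[OF assms(1)]])
  have kraft: "(\<lambda>n. kraft_cost TYPE('a) n (k n) / real n) \<longlonglongrightarrow> 0"
    by (rule kraft_cost_log[OF g_function_card[OF g] assms(4-6)])
  have ent: "empirical_conditional_entropy (k n) w = cyclic_h (k n) w"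
    "empirical_block_entropy (k n) w = cyclic_H (k n) w"
    "cyclic_h (k n) w \<le> cyclic_H (k n) w / real (k n)"
    if "1 \<le> n" "w \<in> words n" for n and w :: "'a list"
    using that empirical_entropies[of w "k n"] assms(2)[of n]
      conditional_entropy_le[OF stationary_empirical, of w "k n"]
    by (cases w; auto simp: words_def)+
  fix t :: real
  show "(\<lambda>n. 1 / real n * ln (\<integral>x. exp (real n * t
       * empirical_conditional_entropy (k n) (initial n x)) \<partial>\<rho>)) \<longlonglongrightarrow> ?R t"
    by (rule g_measure_moment_limit[OF cont assms(2,3) kraft _ _ assms(1) refl]) (simp_all add: ent)
  show "(\<lambda>n. 1 / real n * ln (\<integral>x. exp (real n * t
       * (empirical_block_entropy (k n) (initial n x) / real (k n))) \<partial>\<rho>)) \<longlonglongrightarrow> ?R t"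
    by (rule g_measure_moment_limit[OF cont assms(2,3) kraft _ _ assms(1) refl]) (simp_all add: ent)
qed

end
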